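(* Let $J\ge 1$, let $\mathbf{m}=(m_1,\ldots,m_J)$ and $\mathbf{r}=(r_1,\ldots,r_J)$ be sequences of positive integers with $1\le r_j<m_j$ for all $j$, and let $\boldsymbol{\delta}=(\delta_1,\ldots,\delta_J)$ be a sequence of nonzero integers. Let $g(n)$ be defined, for $|q|<1$, by $$\sum_{n\ge 0}g(n)q^n=\prod_{j=1}^J\Bigg(\prod_{k\ge 1}\big(1-q^{r_j+m_j(k-1)}\big)\big(1-q^{-r_j+m_jk}\big)\Bigg)^{\delta_j}.$$ Let $L$, $\Omega$, $\Delta$, $\lambda$, $\lambda^*$, $\omega_{h,k}$, $\mathrm{D}_{h,k}$, $\Pi_{h,k}$, $\Upsilon$ and $\mathcal{L}_{>0}$ be as defined in the context. Suppose that the inequality $$\min_{1\le j\le J}\left(\Upsilon\big(\lambda^*_{m_j,r_j}(\varkappa,\ell)\big)\frac{\gcd(m_j,\ell)^2}{m_j}\right)\ge \frac{\Delta(\varkappa,\ell)}{24}$$ holds for all integers $1\le \ell\le L$ and $0\le\varkappa<\ell$. Then for all positive integers $n>-\Omega/24$, $$g(n)=E(n)+2\pi\, i^{\sum_{j=1}^{J}\delta_j}\sum_{(\varkappa,\ell)\in\mathcal{L}_{>0}} \left(\frac{24n+\Omega}{\Delta(\varkappa,\ell)}\right)^{-\frac12}\sum_{\substack{1\le k\le N^\star\\ k\equiv \ell \bmod L}}\frac1k\, I_{-1}\!\left(\frac{\pi}{6k}\sqrt{\Delta(\varkappa,\ell)(24n+\Omega)}\right)$$ $$\qquad\times\sum_{\substack{0\le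 h<k\\ \gcd(h,k)=1\\ h\equiv\varkappa \bmod \ell}} e^{-\frac{2\pi i nh}{k}}(-1)^{\sum_{j=1}^J\delta_j\lambda_{m_j,r_j}(h,k)}\,\omega_{h,k}^2\,\mathrm{D}_{h,k}\,\Pi_{h,k},$$ where $$N^\star=\left\lfloor\sqrt{2\pi\left(n+\frac{\Omega}{24}\right)}\right\rfloor,$$ $I_s(x)$ is the modified Bessel function of the first kind, and $E(n)\ll_{\mathbf{m},\mathbf{r},\boldsymbol{\delta}}1$; that is, there is a constant $C$ depending only on $\mathbf{m},\mathbf{r},\boldsymbol{\delta}$ such that $|E(n)|\le C$ for all positive integers $n>-\Omega/24$.
   Context: Convention: $\gcd(0,n)=n$ for positive integers $n$. Let $L=\mathrm{lcm}(m_1,\ldots,m_J)$. For positive integers $r<m$ and integers $0\le h<k$, put $$\lambda_{m,r}(h,k):=\left\lceil\frac{rh}{\gcd(m,k)}\right\rceil,\qquad \lambda^*_{m,r}(h,k):=\lambda_{m,r}(h,k)-\frac{rh}{\gcd(m,k)}.$$ When $\gcd(h,k)=1$, $\hbar_m(h,k)$ denotes any integer with $$\hbar_m(h,k)\frac{mh}{\gcd(m,k)}\equiv-1 \pmod{\tfrac{k}{\gcd(m,k)}}.$$ Define $$\Omega:=\sum_{j=1}^J\delta_j\left(2m_j-12r_j+\frac{12r_j^2}{m_j}\right),$$ and for integers $0\le h<k$ (the definition is also used for non-coprime pairs) $$\Delta(h,k):=-\sum_{j=1}^J\delta_j\left(\frac{2\gcd(m_j,k)^2}{m_j}+\frac{12\gcd(m_j,k)^2}{m_j}\big(\lambda^*_{m_j,r_j}(h,k)^2-\lambda^*_{m_j,r_j}(h,k)\big)\right).$$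 For integers $0\le h<k$ with $\gcd(h,k)=1$: $$\omega_{h,k}:=\exp\left(-\pi i\sum_{j=1}^J\delta_j\, s\!\left(\frac{m_jh}{\gcd(m_j,k)},\frac{k}{\gcd(m_j,k)}\right)\right),$$ where $s(d,c):=\sum_{n\bmod c}\big(\!\big(\frac{dn}{c}\big)\!\big)\big(\!\big(\frac nc\big)\!\big)$ is the Dedekind sum, with $(\!(x)\!)=x-\lfloor x\rfloor-1/2$ if $x\notin\mathbb{Z}$ and $(\!(x)\!)=0$ if $x\in\mathbb{Z}$; $$\mathrm{D}_{h,k}:=\exp\Bigg(\pi i\sum_{j=1}^J\delta_j\bigg(\frac{r_jh}{k}-\frac{r_j\gcd(m_j,k)}{m_jk}+\frac{2r_j\gcd(m_j,k)\lambda^*_{m_j,r_j}(h,k)}{m_jk}+\frac{\hbar_{m_j}(h,k)\gcd(m_j,k)}{k}\big(\lambda_{m_j,r_j}(h,k)^2-\lambda_{m_j,r_j}(h,k)\big)\bigg)\Bigg);$$ $$\Pi_{h,k}:=\prod_{j:\,\lambda^*_{m_j,r_j}(h,k)=0}\left(1-\exp\left(2\pi i\,\frac{r_j\gcd(m_j,k)+r_j\hbar_{m_j}(h,k)m_jh}{m_jk}\right)\right)^{\delta_j},$$ with $\Pi_{h,k}:=1$ if no $j$ satisfies $\lambda^*_{m_j,r_j}(h,k)=0$. The values of $\mathrm{D}_{h,k}$ and $\Pi_{h,k}$ do not depend on the choice of $\hbar_{m_j}(h,k)$, and the factors in $\Pi_{h,k}$ are nonzero. For real $0\le x<1$: $\Upsilon(x)=1$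 if $x=0$, $\Upsilon(x)=x$ if $0<x\le1/2$, $\Upsilon(x)=1-x$ if $1/2<x<1$. $$\mathcal{L}_{>0}:=\{(\varkappa,\ell): 1\le\ell\le L,\ 0\le\varkappa<\ell,\ \Delta(\varkappa,\ell)>0\}\quad(\varkappa,\ell\in\mathbb{Z}).$$ *)

theory Defs
  imports "HOL-Analysis.Analysis" "HOL-Number_Theory.Number_Theory"
begin

text \<open>
  Sequences of length \<open>J\<close> are functions on \<open>nat\<close> of which only the values at
  \<open>1, \<dots>, J\<close> are used. The pairs \<open>(h, k)\<close> with \<open>0 \<le> h < k\<close> are pairs of natural numbers;
  the convention \<open>gcd 0 n = n\<close> is that of the library.
\<close>

text \<open>
  The modified Bessel function of the first kind for real order \<open>\<nu>\<close> and \<open>x > 0\<close>.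
  Since \<^term>\<open>rGamma\<close> is the reciprocal Gamma function, extended by 0 to the poles of Gamma,
  the definition also covers negative integer orders.
\<close>

definition bessel_I :: "real \<Rightarrow> real \<Rightarrow> real" where
  "bessel_I \<nu> x =
     (\<Sum>k::nat. rGamma (real k + \<nu> + 1) / fact k * (x / 2) powr (2 * real k + \<nu>))"

definition sawtooth :: "real \<Rightarrow> real" where
  "sawtooth x = (if x \<in> \<int> then 0 else x - of_int \<lfloor>x\<rfloor> - 1 / 2)"

definition dedekind_sum :: "nat \<Rightarrow> nat \<Rightarrow> real" where
  "dedekind_sum d c =
     (\<Sum>n<c. sawtooth (real d * real n / real c) * sawtooth (real n / real c))"

text \<open>
  The factor \<open>\<Prod>\<^sub>k\<^sub>\<ge>\<^sub>1 (1 - q\<^bsup>r+m(k-1)\<^esup>) (1 - q\<^bsup>-r+mk\<^esup>)\<close>, with \<open>k\<close> shifted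
  to start at 0. The subtraction on \<open>nat\<close> does not truncate because \<open>r < m\<close>.
\<close>

definition theta_prod :: "nat \<Rightarrow> nat \<Rightarrow> complex \<Rightarrow> complex" where
  "theta_prod m r q = (\<Prod>k. (1 - q ^ (r + m * k)) * (1 - q ^ (m * Suc k - r)))"

definition lam :: "nat \<Rightarrow> nat \<Rightarrow> nat \<Rightarrow> nat \<Rightarrow> int" where
  "lam m r h k = \<lceil>real (r * h) / real (gcd m k)\<rceil>"

definition lam_star :: "nat \<Rightarrow> nat \<Rightarrow> nat \<Rightarrow> nat \<Rightarrow> real" where
  "lam_star m r h k = of_int (lam m r h k) - real (r * h) / real (gcd m k)"

text \<open>
  \<open>hb m h k\<close> plays the role of \<open>\<hbar>\<^sub>m(h,k)\<close>, which is any integer satisfying the congruence.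
  Below, \<open>hb\<close> is an arbitrary choice of such integers. Both divisions are exact.
\<close>

definition hbar_choice :: "(nat \<Rightarrow> nat \<Rightarrow> nat \<Rightarrow> int) \<Rightarrow> bool" where
  "hbar_choice hb \<longleftrightarrow>
     (\<forall>m h k. 0 < m \<longrightarrow> h < k \<longrightarrow> coprime h k \<longrightarrow>
        [hb m h k * int (m * h div gcd m k) = - 1] (mod int (k div gcd m k)))"

lemma hbar_choice_exists: "\<exists>hb. hbar_choice hb"
proof -
  have "\<exists>x. [x * int (m * h div gcd m k) = - 1] (mod int (k div gcd m k))"
    if "0 < m" "h < k" "coprime h k" for m h k
  proof -
    have 1: "coprime (m div gcd m k) (k div gcd m k)" using that by (simp add: div_gcd_coprime)
    have "k div gcd m k dvd k" by (metis dvd_div_mult_self dvd_triv_left gcd_dvd2)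
    then have 2: "coprime h (k div gcd m k)" using that(3) coprime_divisors dvd_refl by blast
    have "m * h div gcd m k = m div gcd m k * h" by (simp add: dvd_div_mult)
    then have "coprime (m * h div gcd m k) (k div gcd m k)" using 1 2 by simp
    then have "coprime (int (m * h div gcd m k)) (int (k div gcd m k))" using coprime_int_iff by blast
    then obtain y where "[int (m * h div gcd m k) * y = 1] (mod int (k div gcd m k))"
      using cong_solve_coprime_int by blast
    then have "[(- y) * int (m * h div gcd m k) = - 1] (mod int (k div gcd m k))"
      by (metis cong_minus_minus_iff mult.commute mult_minus_left)
    then show ?thesis by blast
  qed
  then show ?thesis unfolding hbar_choice_def by metis
qed

definition lcm_mod :: "nat \<Rightarrow> (nat \<Rightarrow> nat) \<Rightarrow> nat" where
  "lcm_mod J m = Lcm (m ` {1..J})"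

definition Omega :: "nat \<Rightarrow> (nat \<Rightarrow> nat) \<Rightarrow> (nat \<Rightarrow> nat) \<Rightarrow> (nat \<Rightarrow> int) \<Rightarrow> real" where
  "Omega J m r \<delta> =
     (\<Sum>j=1..J. of_int (\<delta> j) *
        (2 * real (m j) - 12 * real (r j) + 12 * (real (r j))\<^sup>2 / real (m j)))"

definition Delta ::
  "nat \<Rightarrow> (nat \<Rightarrow> nat) \<Rightarrow> (nat \<Rightarrow> nat) \<Rightarrow> (nat \<Rightarrow> int) \<Rightarrow> nat \<Rightarrow> nat \<Rightarrow> real" where
  "Delta J m r \<delta> h k =
     - (\<Sum>j=1..J. of_int (\<delta> j) *
          (2 * (real (gcd (m j) k))\<^sup>2 / real (m j)
           + 12 * (real (gcd (m j) k))\<^sup>2 / real (m j)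
             * ((lam_star (m j) (r j) h k)\<^sup>2 - lam_star (m j) (r j) h k)))"

definition omega ::
  "nat \<Rightarrow> (nat \<Rightarrow> nat) \<Rightarrow> (nat \<Rightarrow> int) \<Rightarrow> nat \<Rightarrow> nat \<Rightarrow> complex" where
  "omega J m \<delta> h k =
     exp (- of_real pi * \<i> * of_real
       (\<Sum>j=1..J. of_int (\<delta> j) *
          dedekind_sum (m j * h div gcd (m j) k) (k div gcd (m j) k)))"

definition D_factor ::
  "nat \<Rightarrow> (nat \<Rightarrow> nat) \<Rightarrow> (nat \<Rightarrow> nat) \<Rightarrow> (nat \<Rightarrow> int) \<Rightarrow> (nat \<Rightarrow> nat \<Rightarrow> nat \<Rightarrow> int)
     \<Rightarrow> nat \<Rightarrow> nat \<Rightarrow> complex" where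
  "D_factor J m r \<delta> hb h k =
     exp (of_real pi * \<i> * of_real
       (\<Sum>j=1..J. of_int (\<delta> j) *
          (real (r j * h) / real k
           - real (r j * gcd (m j) k) / real (m j * k)
           + 2 * real (r j * gcd (m j) k) * lam_star (m j) (r j) h k / real (m j * k)
           + of_int (hb (m j) h k) * real (gcd (m j) k) / real k
             * of_int ((lam (m j) (r j) h k)\<^sup>2 - lam (m j) (r j) h k))))"

definition Pi_factor ::
  "nat \<Rightarrow> (nat \<Rightarrow> nat) \<Rightarrow> (nat \<Rightarrow> nat) \<Rightarrow> (nat \<Rightarrow> int) \<Rightarrow> (nat \<Rightarrow> nat \<Rightarrow> nat \<Rightarrow> int)
     \<Rightarrow> nat \<Rightarrow> nat \<Rightarrow> complex" where
  "Pi_factor J m r \<delta> hb h k =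
     (\<Prod>j \<in> {j \<in> {1..J}. lam_star (m j) (r j) h k = 0}.
        (1 - exp (2 * of_real pi * \<i> * of_real
           ((real (r j * gcd (m j) k) + real (r j) * of_int (hb (m j) h k) * real (m j * h))
            / real (m j * k)))) powi \<delta> j)"

text \<open>Only used for \<open>0 \<le> x < 1\<close>.\<close>

definition Upsilon :: "real \<Rightarrow> real" where
  "Upsilon x = (if x = 0 then 1 else if x \<le> 1 / 2 then x else 1 - x)"

definition L_pos ::
  "nat \<Rightarrow> (nat \<Rightarrow> nat) \<Rightarrow> (nat \<Rightarrow> nat) \<Rightarrow> (nat \<Rightarrow> int) \<Rightarrow> (nat \<times> nat) set" where
  "L_pos J m r \<delta> =
     {(\<kappa>, l). 1 \<le> l \<and> l \<le> lcm_mod J m \<and> \<kappa> < l \<and> Delta J m r \<delta> \<kappa> l > 0}"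

definition N_star ::
  "nat \<Rightarrow> (nat \<Rightarrow> nat) \<Rightarrow> (nat \<Rightarrow> nat) \<Rightarrow> (nat \<Rightarrow> int) \<Rightarrow> nat \<Rightarrow> nat" where
  "N_star J m r \<delta> n = nat \<lfloor>sqrt (2 * pi * (real n + Omega J m r \<delta> / 24))\<rfloor>"

end

theory Submission
  imports Defs "HOL-Complex_Analysis.Complex_Analysis"
begin

text \<open>
  The proof is the circle method of Hardy, Ramanujan and Rademacher for a product of weight zero.
  Let \<open>F\<close> be the product, write \<open>e(x)\<close> for \<open>exp (2\<pi>ix)\<close>, and let \<open>n' = n + \<Omega>/24\<close>. The
  coefficient \<open>g(n)\<close> is the integral of \<open>F(e(\<tau>)) e(-n\<tau>)\<close> over a horizontal segment of length 1
  at height \<open>\<rho> = 1/N\<^sup>2\<close>, with \<open>N\<close> the integer part of \<open>sqrt (2\<pi>n')\<close>. At this height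
  \<open>exp (2\<pi>n'\<rho>)\<close> stays bounded. The segment is cut into Farey arcs of order \<open>N\<close>
  (\<open>farey_dissection\<close>); the arc around \<open>h/k\<close> has length at most \<open>2/(kN)\<close>, so an integrand that is
  bounded on every arc contributes \<open>O(1)\<close> in total. Therefore everything may be neglected
  except what is unbounded.

  On the arc around \<open>h/k\<close> put \<open>\<tau> = h/k + iz\<close>. A modular transformation that sends \<open>h/k\<close> to the
  cusp at infinity turns every factor of \<open>F\<close> into an explicit constant times
  \<open>exp ((\<pi>/12) (\<Omega>\<^sub>j z + \<Delta>\<^sub>j/(k\<^sup>2z)))\<close> times a theta product in a variable of absolute value
  \<open>exp (- 2\<pi> (gcd(m\<^sub>j,k)\<^sup>2/m\<^sub>j) Re (1/z)/k\<^sup>2)\<close> (\<open>theta_prod_near_cusp\<close>). That product is its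
  constant term, which contributes to \<open>\<Pi>\<close>, times \<open>1 + O(the variable to the power \<Upsilon>)\<close>. The
  minimum condition says exactly that this error, multiplied by the growing exponential, is bounded
  (\<open>integrand_near_cusp\<close>). What remains is, for \<open>\<Delta> > 0\<close>, the integral of
  \<open>exp (2\<pi>n'z + \<pi>\<Delta>/(12k\<^sup>2z))\<close> over the arc. Closing the arc to a rectangle around \<open>0\<close> costs
  \<open>O(1/(kN))\<close>, and the residue at \<open>0\<close> is the Bessel function (\<open>integral_exp_near_cusp\<close>).

  The transformation law is obtained without the Dedekind eta function. For a fixed \<open>\<tau>\<close> the theta
  product is determined by its quasi-periods up to a constant factor (\<open>tprod_unique\<close>), which gives
  its behaviour under \<open>\<tau> \<mapsto> -1/\<tau>\<close> up to a factor. The values at the three points of order two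
  determine the factor, because the product of the three Weber functions is constant
  (\<open>tprod_S_transformation\<close>). For a general cusp \<open>H/K\<close> one inducts along the Euclidean algorithm
  (\<open>tprod_modular\<close>); the multiplier is carried along by the reciprocity law of the Dedekind sums
  (\<open>dedekind_reciprocity\<close>).
\<close>

section \<open>Infinite products in a geometric progression\<close>

text \<open>
  The product that is usually written \<open>(a; q)\<^sub>\<infinity>\<close>.
\<close>

definition qpoch :: "complex \<Rightarrow> complex \<Rightarrow> complex" where
  "qpoch a q = (\<Prod>n. 1 - a * q ^ n)"

lemma summable_norm_geometric:
  fixes a q :: complex
  assumes "norm q < 1"
  shows "summable (\<lambda>n. norm (a * q ^ n))"
  using assms by (simp add: norm_mult norm_power summable_mult summable_geometric)

lemma has_prod_qpoch:
  assumes "norm q < 1"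
  shows "(\<lambda>n. 1 - a * q ^ n) has_prod qpoch a q"
proof -
  have "summable (\<lambda>n. norm ((1 - a * q ^ n) - 1))"
    using summable_norm_geometric[OF assms, of a] by simp
  then show ?thesis
    unfolding qpoch_def
    by (intro convergent_prod_has_prod abs_convergent_prod_imp_convergent_prod
        summable_imp_abs_convergent_prod)
qed

lemma qpoch_tendsto:
  assumes "norm q < 1"
  shows "(\<lambda>n. \<Prod>k<n. 1 - a * q ^ k) \<longlonglongrightarrow> qpoch a q"
  by (rule has_prod_imp_tendsto'[OF has_prod_qpoch[OF assms]])

lemma qpoch_eq_0_iff:
  assumes "norm q < 1"
  shows "qpoch a q = 0 \<longleftrightarrow> (\<exists>n. a * q ^ n = 1)"
  using has_prod_eq_0_iff[OF has_prod_qpoch[OF assms, of a]] by (auto simp: image_iff)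

lemma qpoch_nonzero:
  assumes "norm q < 1" "norm a < 1"
  shows "qpoch a q \<noteq> 0"
proof
  assume "qpoch a q = 0"
  then obtain n where "a * q ^ n = 1" using qpoch_eq_0_iff[OF assms(1)] by blast
  then have "norm a * norm q ^ n = 1" by (metis norm_mult norm_power norm_one)
  moreover have "norm a * norm q ^ n \<le> norm a"
    using assms(1) by (simp add: mult_left_le power_le_one)
  ultimately show False using assms(2) by simp
qed

lemma qpoch_rec:
  assumes "norm q < 1"
  shows "qpoch a q = (1 - a) * qpoch (a * q) q"
proof -
  have "(\<lambda>n. (1 - a) * (\<Prod>k<n. 1 - (a * q) * q ^ k)) \<longlonglongrightarrow> (1 - a) * qpoch (a * q) q"
    by (intro tendsto_mult_left qpoch_tendsto assms)
  moreover have "(1 - a) * (\<Prod>k<n. 1 - (a * q) * q ^ k) = (\<Prod>k<Suc n. 1 - a * q ^ k)" for n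
    by (subst prod.lessThan_Suc_shift) (simp add: mult_ac)
  moreover have "(\<lambda>n. \<Prod>k<Suc n. 1 - a * q ^ k) \<longlonglongrightarrow> qpoch a q"
    using qpoch_tendsto[OF assms, of a] by (rule LIMSEQ_Suc)
  ultimately show ?thesis using LIMSEQ_unique by simp
qed

lemma qpoch_mult_minus:
  assumes "norm q < 1"
  shows "qpoch a q * qpoch (- a) q = qpoch (a\<^sup>2) (q\<^sup>2)"
proof -
  have "norm (q\<^sup>2) < 1" using assms by (simp add: norm_power power_less_one_iff)
  then have "(\<lambda>n. \<Prod>k<n. 1 - a\<^sup>2 * (q\<^sup>2) ^ k) \<longlonglongrightarrow> qpoch (a\<^sup>2) (q\<^sup>2)" by (rule qpoch_tendsto)
  moreover have "(\<lambda>n. (\<Prod>k<n. 1 - a * q ^ k) * (\<Prod>k<n. 1 - (- a) * q ^ k)) \<longlonglongrightarrow> qpoch a q * qpoch (- a) q"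
    by (intro tendsto_mult qpoch_tendsto assms)
  moreover have "(\<Prod>k<n. 1 - a * q ^ k) * (\<Prod>k<n. 1 - (- a) * q ^ k) = (\<Prod>k<n. 1 - a\<^sup>2 * (q\<^sup>2) ^ k)" for n
    unfolding prod.distrib[symmetric]
    by (intro prod.cong refl) (simp add: algebra_simps power2_eq_square power_mult_distrib)
  ultimately show ?thesis using LIMSEQ_unique by fastforce
qed

lemma qpoch_split_even_odd:
  assumes "norm q < 1"
  shows "qpoch a q = qpoch a (q\<^sup>2) * qpoch (a * q) (q\<^sup>2)"
proof -
  have q2: "norm (q\<^sup>2) < 1" using assms by (simp add: norm_power power_less_one_iff)
  have "(\<lambda>n. (\<Prod>k<n. 1 - a * (q\<^sup>2) ^ k) * (\<Prod>k<n. 1 - (a * q) * (q\<^sup>2) ^ k))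
          \<longlonglongrightarrow> qpoch a (q\<^sup>2) * qpoch (a * q) (q\<^sup>2)"
    by (intro tendsto_mult qpoch_tendsto q2)
  moreover have "(\<Prod>k<n. 1 - a * (q\<^sup>2) ^ k) * (\<Prod>k<n. 1 - (a * q) * (q\<^sup>2) ^ k) =
      (\<Prod>k<2 * n. 1 - a * q ^ k)" for n
    by (induction n) (simp_all add: power_mult[symmetric] mult_ac)
  moreover have "(\<lambda>n. \<Prod>k<2 * n. 1 - a * q ^ k) \<longlonglongrightarrow> qpoch a q"
    using LIMSEQ_subseq_LIMSEQ[OF qpoch_tendsto[OF assms, of a], of "\<lambda>n. 2 * n"]
    by (simp add: strict_mono_def comp_def)
  ultimately show ?thesis using LIMSEQ_unique by fastforce
qed

text \<open>
  Euler's identity between partitions into distinct and into odd parts. Splitting \<open>(q; q)\<^sub>\<infinity>\<close> into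
  even and odd exponents, and pairing it with \<open>(-q; q)\<^sub>\<infinity>\<close>, produces the factor
  \<open>(q\<^sup>2; q\<^sup>2)\<^sub>\<infinity>\<close> in two ways; it does not vanish and cancels.
\<close>

lemma euler_odd_distinct:
  assumes "norm q < 1"
  shows "qpoch (- q) q * qpoch q (q\<^sup>2) = 1"
proof -
  have q2: "norm (q\<^sup>2) < 1" using assms by (simp add: norm_power power_less_one_iff)
  have "qpoch q q = qpoch q (q\<^sup>2) * qpoch (q\<^sup>2) (q\<^sup>2)"
    using qpoch_split_even_odd[OF assms, of q] by (simp add: power2_eq_square)
  moreover have "qpoch q q * qpoch (- q) q = qpoch (q\<^sup>2) (q\<^sup>2)"
    by (rule qpoch_mult_minus[OF assms])
  ultimately have "(qpoch (- q) q * qpoch q (q\<^sup>2)) * qpoch (q\<^sup>2) (q\<^sup>2) = qpoch (q\<^sup>2) (q\<^sup>2)"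
    by (simp add: mult_ac)
  then show ?thesis using qpoch_nonzero[OF q2 q2] by simp
qed

text \<open>
  With \<open>w = e(\<tau>/2)\<close> the three factors are, up to powers of \<open>w\<close> and a constant, the Weber functions.
\<close>

lemma weber_product:
  assumes "norm w < 1"
  shows "qpoch (- (w\<^sup>2)) (w\<^sup>2) * qpoch w (w\<^sup>2) * qpoch (- w) (w\<^sup>2) = 1"
proof -
  have q: "norm (w\<^sup>2) < 1" using assms by (simp add: norm_power power_less_one_iff)
  show ?thesis
    using euler_odd_distinct[OF q] by (simp only: mult.assoc qpoch_mult_minus[OF q, of w])
qed

text \<open>
  Both arguments may vary. On a compact ball the first is bounded and the second stays away from
  the unit circle, so the logarithms are dominated by a geometric series.
\<close>

lemma holomorphic_qpoch:
  assumes A: "open A" and f: "f holomorphic_on A" and g: "g holomorphic_on A"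
    and lt: "\<And>x. x \<in> A \<Longrightarrow> norm (g x) < 1"
  shows "(\<lambda>x. qpoch (f x) (g x)) holomorphic_on A"
proof (rule holomorphic_uniform_sequence[OF A])
  show "(\<lambda>x. \<Prod>k<n. 1 - f x * g x ^ k) holomorphic_on A" for n
    by (intro holomorphic_intros f g)
next
  fix x assume "x \<in> A"
  then obtain d where d: "d > 0" "cball x d \<subseteq> A" using A open_contains_cball by blast
  let ?K = "cball x d"
  have cf: "continuous_on ?K f" and cg: "continuous_on ?K g"
    using f g d(2) holomorphic_on_imp_continuous_on continuous_on_subset by blast+
  have "bounded (f ` ?K)" using cf by (simp add: compact_continuous_image compact_imp_bounded)
  then obtain B where B: "\<And>y. y \<in> ?K \<Longrightarrow> norm (f y) \<le> B" unfolding bounded_iff by blast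
  obtain y0 where y0: "y0 \<in> ?K" "\<And>y. y \<in> ?K \<Longrightarrow> norm (g y) \<le> norm (g y0)"
    using continuous_attains_sup[of ?K "\<lambda>y. norm (g y)"] continuous_on_norm[OF cg] d(1)
    by (metis compact_cball cball_eq_empty less_imp_not_less)
  define c where "c = norm (g y0)"
  have c: "0 \<le> c" "c < 1" using lt d(2) y0(1) by (auto simp: c_def)
  have "uniformly_convergent_on ?K (\<lambda>N y. \<Prod>n<N. 1 - f y * g y ^ n)"
  proof (rule uniformly_convergent_on_prod')
    show "continuous_on ?K (\<lambda>y. 1 - f y * g y ^ n)" for n by (intro continuous_intros cf cg)
    show "uniformly_convergent_on ?K (\<lambda>N y. \<Sum>n<N. norm (1 - f y * g y ^ n - 1))"
    proof (rule Weierstrass_m_test')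
      fix n y assume y: "y \<in> ?K"
      have "norm (f y) * norm (g y) ^ n \<le> B * c ^ n"
        by (intro mult_mono power_mono B y) (use y0(2)[OF y] order_trans[OF norm_ge_zero B[OF y]] in \<open>auto simp: c_def\<close>)
      then show "norm (norm (1 - f y * g y ^ n - 1)) \<le> B * c ^ n"
        by (simp add: norm_mult norm_power)
    next
      show "summable (\<lambda>n. B * c ^ n)" using c by (intro summable_mult summable_geometric) auto
    qed
  qed auto
  then obtain l where l: "uniform_limit ?K (\<lambda>N y. \<Prod>n<N. 1 - f y * g y ^ n) l sequentially"
    by (auto simp: uniformly_convergent_on_def)
  have "l y = qpoch (f y) (g y)" if "y \<in> ?K" for y
    using tendsto_uniform_limitI[OF l that] qpoch_tendsto[OF lt, of y "f y"] d(2) that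
      LIMSEQ_unique by blast
  then have "uniform_limit ?K (\<lambda>N y. \<Prod>n<N. 1 - f y * g y ^ n) (\<lambda>y. qpoch (f y) (g y)) sequentially"
    using l by (subst uniform_limit_cong'[of _ _ _ _ l]) auto
  then show "\<exists>d>0. cball x d \<subseteq> A \<and>
      uniform_limit (cball x d) (\<lambda>N y. \<Prod>n<N. 1 - f y * g y ^ n) (\<lambda>y. qpoch (f y) (g y)) sequentially"
    using d by blast
qed

lemma norm_qpoch_minus_1_le:
  assumes "norm q \<le> c" "c < 1"
  shows "norm (qpoch a q - 1) \<le> exp (norm a / (1 - c)) - 1"
proof -
  have q: "norm q < 1" and c: "0 \<le> c" using assms norm_ge_zero[of q] by linarith+
  have "norm ((\<Prod>k<n. 1 - a * q ^ k) - 1) \<le> exp (norm a / (1 - c)) - 1" for n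
  proof -
    have "norm ((\<Prod>k<n. 1 + (- a * q ^ k)) - 1) \<le> (\<Prod>k<n. 1 + norm (- a * q ^ k)) - 1"
      by (rule norm_prod_minus1_le_prod_minus1)
    also have "(\<Prod>k<n. 1 + norm (- a * q ^ k)) \<le> exp (\<Sum>k<n. norm (- a * q ^ k))"
      by (rule prod_le_exp_sum) auto
    also have "(\<Sum>k<n. norm (- a * q ^ k)) \<le> norm a / (1 - c)"
    proof -
      have "(\<Sum>k<n. norm (- a * q ^ k)) \<le> (\<Sum>k<n. norm a * c ^ k)"
        by (intro sum_mono) (auto simp: norm_mult norm_power intro!: mult_left_mono power_mono assms)
      also have "\<dots> \<le> (\<Sum>k. norm a * c ^ k)"
        using c assms by (intro sum_le_suminf summable_mult summable_geometric) auto
      also have "\<dots> = norm a / (1 - c)"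
        using c assms by (subst suminf_mult) (auto simp: summable_geometric suminf_geometric divide_inverse)
      finally show ?thesis .
    qed
    finally show ?thesis by simp
  qed
  moreover have "(\<lambda>n. norm ((\<Prod>k<n. 1 - a * q ^ k) - 1)) \<longlonglongrightarrow> norm (qpoch a q - 1)"
    by (intro tendsto_intros qpoch_tendsto q)
  ultimately show ?thesis by (meson LIMSEQ_le_const2)
qed

section \<open>The theta product and its quasi-periods\<close>

definition e2pi :: "complex \<Rightarrow> complex" where
  "e2pi x = exp (2 * of_real pi * \<i> * x)"

lemma e2pi_add: "e2pi (x + y) = e2pi x * e2pi y"
  by (simp add: e2pi_def ring_distribs exp_add)

lemma e2pi_minus: "e2pi (- x) = inverse (e2pi x)"
  by (simp add: e2pi_def exp_minus)

lemma e2pi_diff: "e2pi (x - y) = e2pi x / e2pi y"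
  by (simp add: e2pi_def ring_distribs exp_diff)

lemma e2pi_nonzero [simp]: "e2pi x \<noteq> 0"
  by (simp add: e2pi_def)

lemma e2pi_of_int [simp]: "e2pi (of_int n) = 1"
  using exp_integer_2pi[of "of_int n"] by (simp add: e2pi_def mult_ac)

lemma e2pi_of_nat [simp]: "e2pi (of_nat n) = 1"
  using e2pi_of_int[of "int n"] by simp

lemma e2pi_0 [simp]: "e2pi 0 = 1" and e2pi_1 [simp]: "e2pi 1 = 1"
  using e2pi_of_nat[of 0] e2pi_of_nat[of 1] by (simp_all del: e2pi_of_nat)

lemma e2pi_eq_1_iff: "e2pi x = 1 \<longleftrightarrow> (\<exists>n::int. x = of_int n)"
proof -
  have "e2pi x = 1 \<longleftrightarrow> (\<exists>n::int. 2 * of_real pi * \<i> * x = (of_int (2 * n) * pi) * \<i>)"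
    unfolding e2pi_def exp_eq_1
    by (auto simp: complex_eq_iff)
  also have "\<dots> \<longleftrightarrow> (\<exists>n::int. x = of_int n)"
    by (auto simp: field_simps)
  finally show ?thesis .
qed

lemma e2pi_mult_nat: "e2pi (of_nat n * x) = e2pi x ^ n"
  by (simp add: e2pi_def exp_of_nat_mult[symmetric] mult_ac)

lemma norm_e2pi: "norm (e2pi x) = exp (- 2 * pi * Im x)"
  by (simp add: e2pi_def)

lemma norm_e2pi_less_1: "Im x > 0 \<Longrightarrow> norm (e2pi x) < 1"
  by (simp add: norm_e2pi)

lemma e2pi_half [simp]: "e2pi (1/2) = -1" "e2pi (-1/2) = -1"
  by (simp_all add: e2pi_def exp_minus)

lemma holomorphic_e2pi [holomorphic_intros]:
  "f holomorphic_on A \<Longrightarrow> (\<lambda>x. e2pi (f x)) holomorphic_on A"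
  unfolding e2pi_def by (intro holomorphic_intros)

text \<open>
  Jacobi's theta function in product form, without its eta factor. The variables are additive:
  periods become translations, and the two rows of factors of \<open>theta_prod m r\<close> at \<open>e(\<tau>)\<close> become
  the point \<open>r\<tau>\<close> for the modulus \<open>m\<tau>\<close>.
\<close>

definition tprod :: "complex \<Rightarrow> complex \<Rightarrow> complex" where
  "tprod x \<tau> = qpoch (e2pi x) (e2pi \<tau>) * qpoch (e2pi (\<tau> - x)) (e2pi \<tau>)"

lemma tprod_plus_1: "tprod (x + 1) \<tau> = tprod x \<tau>"
proof -
  have "\<tau> - (x + 1) = (\<tau> - x) - 1" by simp
  then have "e2pi (\<tau> - (x + 1)) = e2pi (\<tau> - x)" by (simp only: e2pi_diff e2pi_1 div_by_1)
  then show ?thesis by (simp add: tprod_def e2pi_add)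
qed

lemma tprod_tau_plus_int: "tprod x (\<tau> + of_int n) = tprod x \<tau>"
proof -
  have "\<tau> + of_int n - x = (\<tau> - x) + of_int n" by simp
  then have "e2pi (\<tau> + of_int n - x) = e2pi (\<tau> - x)" by (simp only: e2pi_add e2pi_of_int mult_1_right)
  then show ?thesis by (simp add: tprod_def e2pi_add)
qed

lemma tprod_minus:
  assumes "Im \<tau> > 0"
  shows "tprod (- x) \<tau> = - e2pi (- x) * tprod x \<tau>"
proof -
  let ?q = "e2pi \<tau>"
  have q: "norm ?q < 1" using assms by (rule norm_e2pi_less_1)
  have "qpoch (e2pi x) ?q = (1 - e2pi x) * qpoch (e2pi (\<tau> + x)) ?q"
    using qpoch_rec[OF q, of "e2pi x"] by (simp add: e2pi_add mult.commute)
  moreover have "qpoch (e2pi (- x)) ?q = (1 - e2pi (- x)) * qpoch (e2pi (\<tau> - x)) ?q"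
    using qpoch_rec[OF q, of "e2pi (-x)"] by (simp add: e2pi_diff e2pi_minus divide_inverse mult.commute)
  moreover have "1 - e2pi (- x) = - e2pi (- x) * (1 - e2pi x)"
    by (simp add: e2pi_minus algebra_simps)
  ultimately show ?thesis by (simp add: tprod_def)
qed

lemma tprod_plus_tau:
  assumes "Im \<tau> > 0"
  shows "tprod (x + \<tau>) \<tau> = - e2pi (- x) * tprod x \<tau>"
proof -
  have "tprod (- x) \<tau> = tprod (x + \<tau>) \<tau>"
    by (simp add: tprod_def add_ac mult.commute)
  then show ?thesis using tprod_minus[OF assms] by simp
qed

lemma holomorphic_tprod:
  assumes "Im \<tau> > 0"
  shows "(\<lambda>x. tprod x \<tau>) holomorphic_on A"
proof -
  have "(\<lambda>x. tprod x \<tau>) holomorphic_on UNIV"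
    unfolding tprod_def
    by (intro holomorphic_intros holomorphic_qpoch) (use assms norm_e2pi_less_1 in auto)
  then show ?thesis by (rule holomorphic_on_subset) auto
qed

text \<open>
  The factor \<open>1 - e(x)\<close> that carries the zero at the origin is split off, which shows that the zero
  is simple.
\<close>

lemma tprod_factor:
  assumes "Im \<tau> > 0"
  shows "tprod x \<tau> = (1 - e2pi x) * (qpoch (e2pi (\<tau> + x)) (e2pi \<tau>) * qpoch (e2pi (\<tau> - x)) (e2pi \<tau>))"
  using qpoch_rec[OF norm_e2pi_less_1[OF assms], of "e2pi x"]
  by (simp add: tprod_def e2pi_add mult_ac)

lemma tprod_eq_0_iff:
  assumes "Im \<tau> > 0"
  shows "tprod x \<tau> = 0 \<longleftrightarrow> (\<exists>a b::int. x = of_int a + of_int b * \<tau>)"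
proof -
  have q: "norm (e2pi \<tau>) < 1" using assms by (rule norm_e2pi_less_1)
  have 1: "qpoch (e2pi y) (e2pi \<tau>) = 0 \<longleftrightarrow> (\<exists>n::nat. \<exists>a::int. y + of_nat n * \<tau> = of_int a)" for y
    unfolding qpoch_eq_0_iff[OF q] e2pi_mult_nat[symmetric] e2pi_add[symmetric] e2pi_eq_1_iff ..
  show ?thesis
  proof
    assume "tprod x \<tau> = 0"
    then consider "qpoch (e2pi x) (e2pi \<tau>) = 0" | "qpoch (e2pi (\<tau> - x)) (e2pi \<tau>) = 0"
      by (auto simp: tprod_def)
    then show "\<exists>a b::int. x = of_int a + of_int b * \<tau>"
    proof cases
      case 1
      then obtain n a where "x + of_nat n * \<tau> = of_int a" using \<open>\<And>y. qpoch (e2pi y) _ = 0 \<longleftrightarrow> _\<close> by blast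
      then have "x = of_int a + of_int (- int n) * \<tau>" by (simp add: algebra_simps)
      then show ?thesis by blast
    next
      case 2
      then obtain n a where "\<tau> - x + of_nat n * \<tau> = of_int a" using \<open>\<And>y. qpoch (e2pi y) _ = 0 \<longleftrightarrow> _\<close> by blast
      then have "x = of_int (- a) + of_int (int n + 1) * \<tau>" by (simp add: algebra_simps)
      then show ?thesis by blast
    qed
  next
    assume "\<exists>a b::int. x = of_int a + of_int b * \<tau>"
    then obtain a b :: int where x: "x = of_int a + of_int b * \<tau>" by blast
    show "tprod x \<tau> = 0"
    proof (cases "b \<le> 0")
      case True
      then have "x + of_nat (nat (- b)) * \<tau> = of_int a" by (simp add: x)
      then have "qpoch (e2pi x) (e2pi \<tau>) = 0" using 1 by blast
      then show ?thesis by (simp add: tprod_def)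
    next
      case False
      then have "\<tau> - x + of_nat (nat (b - 1)) * \<tau> = of_int (- a)" by (simp add: x algebra_simps)
      then have "qpoch (e2pi (\<tau> - x)) (e2pi \<tau>) = 0" using 1 by blast
      then show ?thesis by (simp add: tprod_def)
    qed
  qed
qed

lemma theta_prod_eq_tprod:
  assumes "Im \<tau> > 0" "0 < r" "r < m"
  shows "theta_prod m r (e2pi \<tau>) = tprod (of_nat r * \<tau>) (of_nat m * \<tau>)"
proof -
  let ?q = "e2pi \<tau>"
  have qm: "norm (?q ^ m) < 1"
    using norm_e2pi_less_1[OF assms(1)] assms by (simp add: norm_power power_less_one_iff)
  have *: "(\<lambda>k. 1 - ?q ^ r * (?q ^ m) ^ k) = (\<lambda>k. 1 - ?q ^ (r + m * k))"
    "(\<lambda>k. 1 - ?q ^ (m - r) * (?q ^ m) ^ k) = (\<lambda>k. 1 - ?q ^ (m * Suc k - r))"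
    using assms by (auto simp: power_add[symmetric] power_mult[symmetric] fun_eq_iff)
  have "qpoch (?q ^ r) (?q ^ m) * qpoch (?q ^ (m - r)) (?q ^ m) = theta_prod m r ?q"
    unfolding theta_prod_def qpoch_def *
    by (rule prodinf_mult)
      (use has_prod_qpoch[OF qm, of "?q ^ r"] has_prod_qpoch[OF qm, of "?q ^ (m - r)"] in
        \<open>auto simp: * has_prod_iff\<close>)
  moreover have "?q ^ (m - r) = e2pi (of_nat m * \<tau> - of_nat r * \<tau>)"
    using assms by (simp flip: e2pi_mult_nat add: of_nat_diff algebra_simps)
  ultimately show ?thesis by (simp add: tprod_def e2pi_mult_nat)
qed

section \<open>The inversion \<open>\<tau> \<mapsto> -1/\<tau>\<close>\<close>

lemma shift_invariant_multiple:
  fixes c :: complex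
  assumes "\<And>x. f (x + c) = f x"
  shows "f (x + of_int n * c) = f x"
proof (induction n rule: int_induct[where k = 0])
  case (step1 i)
  then show ?case using assms[of "x + of_int i * c"] by (simp add: algebra_simps)
next
  case (step2 i)
  then show ?case using assms[of "x + of_int (i - 1) * c"] by (simp add: algebra_simps)
qed simp

text \<open>
  A function with the quasi-periods of the theta product and with a zero at the origin vanishes on
  the whole lattice. The theta product has simple zeros, exactly there. The quotient is therefore
  an entire function with two periods, and it is constant by Liouville's theorem.
\<close>

lemma tprod_unique:
  assumes \<tau>: "Im \<tau> > 0" and f: "f holomorphic_on UNIV"
    and per1: "\<And>x. f (x + 1) = f x" and per2: "\<And>x. f (x + \<tau>) = - e2pi (- x) * f x"
    and f0: "f 0 = 0"
  shows "\<exists>c. \<forall>x. f x = c * tprod x \<tau>"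
proof -
  define A where "A = (\<lambda>x. tprod x \<tau>)"
  define Q where "Q = (\<lambda>x. f x / A x)"
  define R where "R = remove_sings Q"
  have A_hol: "A holomorphic_on UNIV" unfolding A_def by (rule holomorphic_tprod[OF \<tau>])
  have Q1: "Q (x + 1) = Q x" for x by (simp add: Q_def A_def per1 tprod_plus_1)
  have Qt: "Q (x + \<tau>) = Q x" for x by (simp add: Q_def A_def per2 tprod_plus_tau[OF \<tau>])
  have Q1': "Q (x + of_int n) = Q x" for x n using shift_invariant_multiple[of Q 1] Q1 by simp
  have Qt': "Q (x + of_int n * \<tau>) = Q x" for x n using shift_invariant_multiple[of Q \<tau>] Qt by simp
  have Qlat: "Q (x + (of_int a + of_int b * \<tau>)) = Q x" for x a b
    using Qt'[of "x + of_int a" b] Q1'[of x a] by (simp add: add_ac)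
  have Rlat: "R (x + (of_int a + of_int b * \<tau>)) = R x" for x a b
  proof -
    have "R (x + (of_int a + of_int b * \<tau>)) = remove_sings (\<lambda>w. Q ((x + (of_int a + of_int b * \<tau>)) + w)) 0"
      unfolding R_def by (rule remove_sings_shift_0)
    also have "(\<lambda>w. Q ((x + (of_int a + of_int b * \<tau>)) + w)) = (\<lambda>w. Q (x + w))"
    proof
      fix w show "Q ((x + (of_int a + of_int b * \<tau>)) + w) = Q (x + w)"
        using Qlat[of "x + w" a b] by (simp add: add_ac)
    qed
    also have "remove_sings \<dots> 0 = R x"
      unfolding R_def by (rule remove_sings_shift_0[symmetric])
    finally show ?thesis .
  qed
  have Q_mero: "Q meromorphic_on UNIV"
    unfolding Q_def using f A_hol
    by (intro meromorphic_on_divide analytic_on_imp_meromorphic_on) (auto simp: analytic_on_open)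
  then have iso: "isolated_singularity_at Q z" for z
    using meromorphic_on_isolated_singularity meromorphic_on_subset by blast
  \<comment> \<open>The zero of the denominator at the origin is simple, so the quotient has a limit there.\<close>
  obtain c0 where c0: "Q \<midarrow>0\<rightarrow> c0"
  proof -
    define U where "U = (\<lambda>x. qpoch (e2pi (\<tau> + x)) (e2pi \<tau>) * qpoch (e2pi (\<tau> - x)) (e2pi \<tau>))"
    have q: "norm (e2pi \<tau>) < 1" using \<tau> by (rule norm_e2pi_less_1)
    have "U holomorphic_on UNIV"
      unfolding U_def by (intro holomorphic_intros holomorphic_qpoch) (use q in auto)
    then have dU: "(U has_field_derivative deriv U 0) (at 0)"
      by (simp add: holomorphic_derivI)
    have U0: "U 0 \<noteq> 0" using qpoch_nonzero[OF q q] by (simp add: U_def)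
    have AU: "A = (\<lambda>x. (1 - e2pi x) * U x)"
      unfolding A_def U_def by (rule ext) (rule tprod_factor[OF \<tau>])
    have "((\<lambda>x. 1 - e2pi x) has_field_derivative (- 2 * of_real pi * \<i>)) (at 0)"
      unfolding e2pi_def by (auto intro!: derivative_eq_intros)
    from DERIV_mult[OF this dU] have dA: "(A has_field_derivative (- 2 * of_real pi * \<i> * U 0)) (at 0)"
      unfolding AU by (simp add: e2pi_def mult_ac)
    have df: "(f has_field_derivative deriv f 0) (at 0)"
      using f by (simp add: holomorphic_derivI)
    have "(\<lambda>x. f x / A x) \<midarrow>0\<rightarrow> deriv f 0 / (- 2 * of_real pi * \<i> * U 0)"
      by (rule lhopital_complex_simple[OF df dA]) (use U0 f0 in \<open>auto simp: AU\<close>)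
    then show ?thesis using that unfolding Q_def by blast
  qed
  have "R analytic_on {z}" for z
  proof (cases "A z = 0")
    case True
    then obtain a b :: int where z: "z = of_int a + of_int b * \<tau>"
      using tprod_eq_0_iff[OF \<tau>] by (auto simp: A_def)
    have "(\<lambda>h. Q (z + h)) = Q"
    proof
      fix h show "Q (z + h) = Q h" using Qlat[of h a b] by (simp add: z add_ac)
    qed
    then have "Q \<midarrow>z\<rightarrow> c0" using c0 LIM_offset_zero_cancel by metis
    then show ?thesis unfolding R_def by (rule remove_sings_analytic_at[OF iso])
  next
    case False
    have "Q analytic_on {z}" unfolding Q_def
      using f A_hol False by (intro analytic_intros) (auto simp: holomorphic_on_imp_analytic_at)
    then show ?thesis unfolding R_def by (rule remove_sings_analytic_on)
  qed
  then have R_an: "R analytic_on UNIV" using analytic_on_analytic_at by blast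
  then have R_hol: "R holomorphic_on UNIV" by (rule analytic_imp_holomorphic)
  \<comment> \<open>a compact period parallelogram, on which the quotient is bounded\<close>
  define K where "K = (\<lambda>(s, t). of_real s + of_real t * \<tau>) ` ({0..1::real} \<times> {0..1::real})"
  have "compact K" unfolding K_def
    by (intro compact_continuous_image compact_Times compact_Icc)
       (auto simp: case_prod_unfold intro!: continuous_intros)
  then have "compact (R ` K)"
    using R_hol holomorphic_on_imp_continuous_on continuous_on_subset
    by (intro compact_continuous_image) blast+
  then have "bounded (R ` K)" by (rule compact_imp_bounded)
  moreover have "R x \<in> R ` K" for x
  proof -
    define t where "t = Im x / Im \<tau>"
    define s where "s = Re x - t * Re \<tau>"
    have x: "x = of_real s + of_real t * \<tau>" using \<tau> by (simp add: complex_eq_iff s_def t_def)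
    define y where "y = of_real (frac s) + of_real (frac t) * \<tau>"
    have "y \<in> K" unfolding y_def K_def
      by (rule image_eqI[of _ _ "(frac s, frac t)"]) (auto simp: frac_lt_1 less_imp_le)
    moreover have "x = y + (of_int \<lfloor>s\<rfloor> + of_int \<lfloor>t\<rfloor> * \<tau>)"
      unfolding x y_def frac_def by (simp add: algebra_simps)
    then have "R x = R y" using Rlat by metis
    ultimately show ?thesis by blast
  qed
  ultimately have "bounded (range R)" by (auto intro: bounded_subset)
  then obtain c where c: "\<And>x. R x = c"
    using Liouville_theorem[OF R_hol] by (auto simp: constant_on_def)
  have "f x = c * A x" for x
  proof (cases "A x = 0")
    case True
    then obtain a b :: int where z: "x = of_int a + of_int b * \<tau>"
      using tprod_eq_0_iff[OF \<tau>] by (auto simp: A_def)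
    have g1: "f (y + of_int n) = 0 \<longleftrightarrow> f y = 0" for y n
      using shift_invariant_multiple[of "\<lambda>y. f y = 0" 1] per1 by simp
    have g2: "f (y + of_int n * \<tau>) = 0 \<longleftrightarrow> f y = 0" for y n
      using shift_invariant_multiple[of "\<lambda>y. f y = 0" \<tau>] per2 by simp
    have "f x = 0" using g2[of "of_int a" b] g1[of 0 a] f0 by (simp add: z)
    then show ?thesis using True by simp
  next
    case False
    have "Q analytic_on {x}" unfolding Q_def
      using f A_hol False by (intro analytic_intros) (auto simp: holomorphic_on_imp_analytic_at)
    then have "R x = Q x" unfolding R_def by (rule remove_sings_at_analytic)
    then show ?thesis using c[of x] False by (simp add: Q_def)
  qed
  then show ?thesis unfolding A_def by blast
qed

lemma Im_minus_inverse_pos: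
  assumes "Im \<tau> > 0" shows "Im (- 1 / \<tau>) > 0"
  using assms by (simp add: Im_divide power2_eq_square sum_power2_gt_zero_iff)
     (metis add_nonneg_pos assms divide_pos_pos mult_pos_pos zero_le_square)

text \<open>
  The values at the three points of order two are squares of the Weber functions.
\<close>

lemma tprod_half:
  assumes "Im \<tau> > 0"
  shows "tprod (1/2) \<tau> = 2 * qpoch (- e2pi \<tau>) (e2pi \<tau>) ^ 2"
proof -
  have "qpoch (- 1) (e2pi \<tau>) = 2 * qpoch (- e2pi \<tau>) (e2pi \<tau>)"
    using qpoch_rec[OF norm_e2pi_less_1[OF assms], of "-1"] by simp
  then show ?thesis by (simp add: tprod_def e2pi_diff power2_eq_square)
qed

lemma tprod_half_tau: "tprod (\<tau>/2) \<tau> = qpoch (e2pi (\<tau>/2)) (e2pi \<tau>) ^ 2"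
proof -
  have "\<tau> - \<tau>/2 = \<tau>/2" by simp
  then show ?thesis by (simp add: tprod_def power2_eq_square)
qed

lemma tprod_half_1_tau: "tprod (1/2 + \<tau>/2) \<tau> = qpoch (- e2pi (\<tau>/2)) (e2pi \<tau>) ^ 2"
proof -
  have "\<tau> - (1/2 + \<tau>/2) = \<tau>/2 - 1/2" by simp
  then have "e2pi (\<tau> - (1/2 + \<tau>/2)) = - e2pi (\<tau>/2)" by (simp only: e2pi_diff e2pi_half) simp
  then show ?thesis by (simp add: tprod_def power2_eq_square e2pi_add)
qed

text \<open>
  Inversion maps the lattice of \<open>\<tau>\<close> to a multiple of that of \<open>-1/\<tau>\<close>. The quadratic exponential
  corrects the quasi-periods, so that uniqueness applies.
\<close>

lemma tprod_S_transformation_up_to_constant: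
  assumes \<tau>: "Im \<tau> > 0"
  shows "\<exists>c. \<forall>x. exp (of_real pi * \<i> * (x - x / \<tau> - x\<^sup>2 / \<tau>)) * tprod (x / \<tau>) (- 1 / \<tau>) = c * tprod x \<tau>"
proof (rule tprod_unique[OF \<tau>])
  have \<tau>0: "\<tau> \<noteq> 0" using assms by auto
  have \<tau>': "Im (- 1 / \<tau>) > 0" using assms by (rule Im_minus_inverse_pos)
  have "(\<lambda>y. tprod y (- 1 / \<tau>)) \<circ> (\<lambda>x. x / \<tau>) holomorphic_on UNIV"
    by (intro holomorphic_on_compose holomorphic_tprod[OF \<tau>'] holomorphic_intros) (use \<tau>0 in auto)
  then have "(\<lambda>x. tprod (x / \<tau>) (- 1 / \<tau>)) holomorphic_on UNIV" by (simp add: o_def)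
  then show "(\<lambda>x. exp (of_real pi * \<i> * (x - x / \<tau> - x\<^sup>2 / \<tau>)) * tprod (x / \<tau>) (- 1 / \<tau>)) holomorphic_on UNIV"
    using \<tau>0 by (intro holomorphic_intros) auto
  show "exp (of_real pi * \<i> * (x + 1 - (x + 1) / \<tau> - (x + 1)\<^sup>2 / \<tau>)) * tprod ((x + 1) / \<tau>) (- 1 / \<tau>) =
        exp (of_real pi * \<i> * (x - x / \<tau> - x\<^sup>2 / \<tau>)) * tprod (x / \<tau>) (- 1 / \<tau>)" for x
  proof -
    have "x / \<tau> = (x + 1) / \<tau> + (- 1 / \<tau>)" by (simp add: add_divide_distrib)
    then have "tprod (x / \<tau>) (- 1 / \<tau>) = - e2pi (- ((x + 1) / \<tau>)) * tprod ((x + 1) / \<tau>) (- 1 / \<tau>)"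
      using tprod_plus_tau[OF \<tau>', of "(x + 1) / \<tau>"] by simp
    moreover have "exp (of_real pi * \<i> * (x + 1 - (x + 1) / \<tau> - (x + 1)\<^sup>2 / \<tau>)) =
      exp (of_real pi * \<i>) * (exp (of_real pi * \<i> * (x - x / \<tau> - x\<^sup>2 / \<tau>)) * e2pi (- ((x + 1) / \<tau>)))"
      unfolding e2pi_def mult_exp_exp using \<tau>0 by (intro arg_cong[where f = exp]) (simp add: field_simps power2_eq_square)
    ultimately show ?thesis by simp
  qed
  show "exp (of_real pi * \<i> * (x + \<tau> - (x + \<tau>) / \<tau> - (x + \<tau>)\<^sup>2 / \<tau>)) * tprod ((x + \<tau>) / \<tau>) (- 1 / \<tau>) =
        - e2pi (- x) * (exp (of_real pi * \<i> * (x - x / \<tau> - x\<^sup>2 / \<tau>)) * tprod (x / \<tau>) (- 1 / \<tau>))" for x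
  proof -
    have "(x + \<tau>) / \<tau> = x / \<tau> + 1" using \<tau>0 by (simp add: add_divide_distrib)
    then have "tprod ((x + \<tau>) / \<tau>) (- 1 / \<tau>) = tprod (x / \<tau>) (- 1 / \<tau>)"
      by (simp add: tprod_plus_1)
    moreover have "exp (of_real pi * \<i> * (x + \<tau> - (x + \<tau>) / \<tau> - (x + \<tau>)\<^sup>2 / \<tau>)) * exp (of_real pi * \<i>) =
       exp (of_real pi * \<i> * (x - x / \<tau> - x\<^sup>2 / \<tau>)) * e2pi (- x)"
      unfolding e2pi_def mult_exp_exp using \<tau>0 by (intro arg_cong[where f = exp]) (simp add: field_simps power2_eq_square)
    then have "exp (of_real pi * \<i> * (x + \<tau> - (x + \<tau>) / \<tau> - (x + \<tau>)\<^sup>2 / \<tau>)) =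
       - e2pi (- x) * exp (of_real pi * \<i> * (x - x / \<tau> - x\<^sup>2 / \<tau>))"
      by (simp only: exp_pi_i) (simp add: minus_equation_iff mult.commute)
    ultimately show ?thesis by (simp only: mult.assoc)
  qed
  show "exp (of_real pi * \<i> * (0 - 0 / \<tau> - 0\<^sup>2 / \<tau>)) * tprod (0 / \<tau>) (- 1 / \<tau>) = 0"
    using tprod_eq_0_iff[OF \<tau>', of 0] by (auto intro!: exI[of _ 0])
qed

text \<open>
  A rewriting pattern for the next proof: the value at a reflected point is moved to the point itself.
  The factor \<open>e(1)\<close>, which is 1, absorbs a full period in the exponent.
\<close>

lemma combine_factors:
  fixes E :: complex
  assumes "E * T' = C" "T' = P * T" "E * P = M * e2pi 1"
  shows "M * T = C"
proof -
  have "M * T = (E * P) * T" using assms(3) by simp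
  also have "\<dots> = C" using assms(1,2) by (simp only: mult.assoc)
  finally show ?thesis .
qed

text \<open>
  Inversion fixes the point \<open>(1 + \<tau>)/2\<close> and exchanges \<open>1/2\<close> and \<open>\<tau>/2\<close>, up to lattice points and signs.
\<close>

lemma tprod_S_values:
  assumes \<tau>: "Im \<tau> > 0"
    and c: "\<And>x. exp (of_real pi * \<i> * (x - x / \<tau> - x\<^sup>2 / \<tau>)) * tprod (x / \<tau>) (- 1 / \<tau>) = c * tprod x \<tau>"
  shows "- \<i> * exp (of_real pi * \<i> / (4 * \<tau>)) * tprod ((- 1 / \<tau>) / 2) (- 1 / \<tau>) = c * tprod (1/2) \<tau>"
    and "- \<i> * exp (of_real pi * \<i> * \<tau> / 4) * tprod (1/2) (- 1 / \<tau>) = c * tprod (\<tau>/2) \<tau>"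
    and "- \<i> * exp (of_real pi * \<i> * (\<tau> / 4 + 1 / (4 * \<tau>))) * tprod (1/2 + (- 1 / \<tau>) / 2) (- 1 / \<tau>)
           = c * tprod (1/2 + \<tau>/2) \<tau>"
proof -
  have \<tau>0: "\<tau> \<noteq> 0" using assms by auto
  have \<tau>': "Im (- 1 / \<tau>) > 0" using assms(1) by (rule Im_minus_inverse_pos)
  have i: "- \<i> = exp (- of_real pi * \<i> / 2)"
    using cis_conv_exp[of "- pi / 2"] by (simp add: mult_ac complex_eq_iff)
  have m1: "(-1::complex) = exp (of_real pi * \<i>)" by simp
  show "- \<i> * exp (of_real pi * \<i> / (4 * \<tau>)) * tprod ((- 1 / \<tau>) / 2) (- 1 / \<tau>) = c * tprod (1/2) \<tau>"
  proof -
    have "(1/2) / \<tau> = - ((- 1 / \<tau>) / 2)" by simp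
    then have "tprod ((1/2) / \<tau>) (- 1 / \<tau>) = (- 1) * e2pi (- ((- 1 / \<tau>) / 2)) * tprod ((- 1 / \<tau>) / 2) (- 1 / \<tau>)"
      by (simp only: tprod_minus[OF \<tau>']) simp
    moreover have "exp (of_real pi * \<i> * (1/2 - (1/2) / \<tau> - (1/2)\<^sup>2 / \<tau>)) * (- 1 * e2pi (- ((- 1 / \<tau>) / 2)))
        = - \<i> * exp (of_real pi * \<i> / (4 * \<tau>)) * e2pi 1"
      unfolding e2pi_def i m1 mult_exp_exp using \<tau>0
      by (intro arg_cong[where f = exp]) (simp add: field_simps power2_eq_square)
    ultimately show ?thesis using combine_factors[OF c[of "1/2"]] by blast
  qed
  show "- \<i> * exp (of_real pi * \<i> * \<tau> / 4) * tprod (1/2) (- 1 / \<tau>) = c * tprod (\<tau>/2) \<tau>"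
  proof -
    have "(\<tau>/2) / \<tau> = 1/2" using \<tau>0 by simp
    moreover have "exp (of_real pi * \<i> * (\<tau>/2 - (\<tau>/2) / \<tau> - (\<tau>/2)\<^sup>2 / \<tau>)) = - \<i> * exp (of_real pi * \<i> * \<tau> / 4)"
      unfolding e2pi_def i m1 mult_exp_exp using \<tau>0
      by (intro arg_cong[where f = exp]) (simp add: field_simps power2_eq_square)
    ultimately show ?thesis using c[of "\<tau>/2"] by (simp only:)
  qed
  show "- \<i> * exp (of_real pi * \<i> * (\<tau> / 4 + 1 / (4 * \<tau>))) * tprod (1/2 + (- 1 / \<tau>) / 2) (- 1 / \<tau>)
           = c * tprod (1/2 + \<tau>/2) \<tau>"
  proof -
    have "(1/2 + \<tau>/2) / \<tau> = - ((1/2 + (- 1 / \<tau>) / 2) - 1)" using \<tau>0 by (simp add: field_simps)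
    then have "tprod ((1/2 + \<tau>/2) / \<tau>) (- 1 / \<tau>) =
        (-1) * e2pi (- ((1/2 + (- 1 / \<tau>) / 2) - 1)) * tprod ((1/2 + (- 1 / \<tau>) / 2) - 1) (- 1 / \<tau>)"
      using tprod_minus[OF \<tau>', of "(1/2 + (- 1 / \<tau>) / 2) - 1"] by simp
    also have "tprod ((1/2 + (- 1 / \<tau>) / 2) - 1) (- 1 / \<tau>) = tprod (1/2 + (- 1 / \<tau>) / 2) (- 1 / \<tau>)"
      using tprod_plus_1[of "(1/2 + (- 1 / \<tau>) / 2) - 1"] by simp
    finally have "tprod ((1/2 + \<tau>/2) / \<tau>) (- 1 / \<tau>) =
        (-1) * e2pi (- ((1/2 + (- 1 / \<tau>) / 2) - 1)) * tprod (1/2 + (- 1 / \<tau>) / 2) (- 1 / \<tau>)" .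
    moreover have "exp (of_real pi * \<i> * ((1/2 + \<tau>/2) - (1/2 + \<tau>/2) / \<tau> - (1/2 + \<tau>/2)\<^sup>2 / \<tau>)) *
           (- 1 * e2pi (- ((1/2 + (- 1 / \<tau>) / 2) - 1)))
        = - \<i> * exp (of_real pi * \<i> * (\<tau> / 4 + 1 / (4 * \<tau>))) * e2pi 1"
      unfolding e2pi_def i m1 mult_exp_exp using \<tau>0
      by (intro arg_cong[where f = exp]) (simp add: field_simps power2_eq_square)
    ultimately show ?thesis using combine_factors[OF c[of "1/2 + \<tau>/2"]] by blast
  qed
qed

text \<open>
  Let \<open>u\<close> be the unknown constant, normalised by the expected exponential. Multiplying the
  relations at the three points of order two gives \<open>u\<^sup>3 = 1\<close>, because the product of the Weber
  functions is the same at \<open>\<tau>\<close> and at \<open>-1/\<tau>\<close>. Hence \<open>u\<close> is a continuous function of \<open>\<tau>\<close> with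
  finitely many values and is constant on the half plane; at the fixed point \<open>\<tau> = i\<close> it is 1.
\<close>

lemma tprod_S_transformation:
  assumes \<tau>: "Im \<tau> > 0"
  shows "tprod x \<tau> = \<i> * exp (of_real pi * \<i> * (x - x / \<tau> - x\<^sup>2 / \<tau> - (\<tau> + 1 / \<tau>) / 6)) *
           tprod (x / \<tau>) (- 1 / \<tau>)"
proof -
  define H where "H = {\<tau>. Im \<tau> > 0}"
  have opH: "open H" unfolding H_def by (rule open_halfspace_Im_gt)
  obtain c where c: "\<And>\<tau> x. \<tau> \<in> H \<Longrightarrow>
      exp (of_real pi * \<i> * (x - x / \<tau> - x\<^sup>2 / \<tau>)) * tprod (x / \<tau>) (- 1 / \<tau>) = c \<tau> * tprod x \<tau>"
    using tprod_S_transformation_up_to_constant unfolding H_def mem_Collect_eq by metis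
  \<comment> \<open>normalised so that the claim becomes \<open>u = 1\<close>\<close>
  define u where "u = (\<lambda>\<tau>. \<i> * c \<tau> * exp (- (of_real pi * \<i> * ((\<tau> + 1 / \<tau>) / 6))))"
  define V0 where "V0 = (\<lambda>\<tau>. qpoch (- e2pi (\<tau>/2)) (e2pi \<tau>))"
  define V1 where "V1 = (\<lambda>\<tau>. qpoch (e2pi (\<tau>/2)) (e2pi \<tau>))"
  define V2 where "V2 = (\<lambda>\<tau>. qpoch (- e2pi \<tau>) (e2pi \<tau>))"
  have V0nz: "V0 t \<noteq> 0" if "t \<in> H" for t
    unfolding V0_def by (rule qpoch_nonzero) (use that norm_e2pi_less_1[of t] norm_e2pi_less_1[of "t/2"] in \<open>auto simp: H_def\<close>)
  have V: "V2 t * V1 t * V0 t = 1" if "t \<in> H" for t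
  proof -
    have "e2pi (t/2) ^ 2 = e2pi t" using e2pi_mult_nat[of 2 "t/2"] by simp
    then show ?thesis using weber_product[of "e2pi (t/2)"] that norm_e2pi_less_1[of "t/2"]
      by (simp add: V0_def V1_def V2_def H_def)
  qed
  have inH: "- 1 / t \<in> H" if "t \<in> H" for t using that Im_minus_inverse_pos by (simp add: H_def)
  have nz: "t \<noteq> 0" if "t \<in> H" for t using that by (auto simp: H_def)
  have vals: "- \<i> * exp (of_real pi * \<i> / (4 * t)) * V1 (- 1 / t) ^ 2 = c t * (2 * V2 t ^ 2)"
             "- \<i> * exp (of_real pi * \<i> * t / 4) * (2 * V2 (- 1 / t) ^ 2) = c t * V1 t ^ 2"
             "- \<i> * exp (of_real pi * \<i> * (t / 4 + 1 / (4 * t))) * V0 (- 1 / t) ^ 2 = c t * V0 t ^ 2"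
    if t: "t \<in> H" for t
    using tprod_S_values[of t "c t", OF _ c[OF t]] t tprod_half[of t] tprod_half[of "- 1 / t"] inH[OF t]
      tprod_half_tau[of t] tprod_half_tau[of "- 1 / t"] tprod_half_1_tau[of t] tprod_half_1_tau[of "- 1 / t"]
    unfolding V0_def V1_def V2_def H_def mem_Collect_eq by auto
  have u3: "u t ^ 3 = 1" if t: "t \<in> H" for t
  proof -
    have "(- \<i> * exp (of_real pi * \<i> / (4 * t)) * V1 (- 1 / t) ^ 2) *
          (- \<i> * exp (of_real pi * \<i> * t / 4) * (2 * V2 (- 1 / t) ^ 2)) *
          (- \<i> * exp (of_real pi * \<i> * (t / 4 + 1 / (4 * t))) * V0 (- 1 / t) ^ 2) =
          (c t * (2 * V2 t ^ 2)) * (c t * V1 t ^ 2) * (c t * V0 t ^ 2)"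
      by (simp only: vals[OF t])
    then have "(- \<i>) ^ 3 * 2 * (exp (of_real pi * \<i> / (4 * t)) * exp (of_real pi * \<i> * t / 4) *
        exp (of_real pi * \<i> * (t / 4 + 1 / (4 * t)))) * (V2 (- 1 / t) * V1 (- 1 / t) * V0 (- 1 / t)) ^ 2 =
        c t ^ 3 * 2 * (V2 t * V1 t * V0 t) ^ 2"
      by (simp only: power_mult_distrib power2_eq_square power3_eq_cube mult_ac)
    then have "(- \<i>) ^ 3 * (exp (of_real pi * \<i> / (4 * t)) * exp (of_real pi * \<i> * t / 4) *
        exp (of_real pi * \<i> * (t / 4 + 1 / (4 * t)))) = c t ^ 3"
      by (simp only: V[OF t] V[OF inH[OF t]]) (simp add: mult.assoc)
    moreover have "exp (of_real pi * \<i> / (4 * t)) * exp (of_real pi * \<i> * t / 4) *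
        exp (of_real pi * \<i> * (t / 4 + 1 / (4 * t))) = exp (of_real pi * \<i> * ((t + 1 / t) / 6)) ^ 3"
      unfolding exp_of_nat_mult[symmetric] mult_exp_exp using nz[OF t]
      by (intro arg_cong[where f = exp]) (simp add: field_simps)
    ultimately have "c t ^ 3 = (- \<i> * exp (of_real pi * \<i> * ((t + 1 / t) / 6))) ^ 3"
      by (simp add: power_mult_distrib)
    then have "u t ^ 3 = (\<i> * (- \<i> * exp (of_real pi * \<i> * ((t + 1 / t) / 6))) * exp (- (of_real pi * \<i> * ((t + 1 / t) / 6)))) ^ 3"
      unfolding u_def power_mult_distrib by simp
    then show ?thesis by (simp add: exp_minus)
  qed
  have u_eq: "u t = exp (of_real pi * \<i> * (t / 4 + 1 / (4 * t))) * (V0 (- 1 / t) / V0 t) ^ 2 *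
       exp (- (of_real pi * \<i> * ((t + 1 / t) / 6)))" if t: "t \<in> H" for t
  proof -
    have "c t = - \<i> * exp (of_real pi * \<i> * (t / 4 + 1 / (4 * t))) * V0 (- 1 / t) ^ 2 / V0 t ^ 2"
      using vals(3)[OF t] V0nz[OF t] by (simp add: field_simps)
    moreover have "\<i> * (- \<i> * E * v / w) * F = E * (v / w) * F" for E v w F :: complex
      by (simp add: mult.assoc[symmetric])
    ultimately show ?thesis unfolding u_def by (simp only: power_divide)
  qed
  have hV0: "V0 holomorphic_on H" unfolding V0_def
    by (intro holomorphic_qpoch opH holomorphic_intros) (auto simp: H_def norm_e2pi_less_1)
  have "V0 \<circ> (\<lambda>t. - 1 / t) holomorphic_on H"
    by (rule holomorphic_on_compose_gen[OF _ hV0]) (use inH nz in \<open>auto intro!: holomorphic_intros\<close>)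
  then have hV0': "(\<lambda>t. V0 (- 1 / t)) holomorphic_on H" by (simp add: o_def)
  have "(\<lambda>t. exp (of_real pi * \<i> * (t / 4 + 1 / (4 * t))) * (V0 (- 1 / t) / V0 t) ^ 2 *
       exp (- (of_real pi * \<i> * ((t + 1 / t) / 6)))) holomorphic_on H"
    by (intro holomorphic_intros hV0 hV0') (use nz V0nz in auto)
  then have "u holomorphic_on H" by (rule holomorphic_transform) (simp add: u_eq)
  then have cu: "continuous_on H u" by (rule holomorphic_on_imp_continuous_on)
  have "connected H" unfolding H_def by (intro convex_connected convex_halfspace_Im_gt)
  moreover have "finite (u ` H)"
    by (rule finite_subset[of _ "{z. z ^ 3 = 1}"]) (use u3 finite_roots_unity[of 3] in auto)
  ultimately have "u constant_on H" using cu continuous_finite_range_constant_eq by blast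
  moreover have "\<i> \<in> H" by (simp add: H_def)
  moreover have "u \<i> = 1"
    using u_eq[OF \<open>\<i> \<in> H\<close>] V0nz[OF \<open>\<i> \<in> H\<close>] by (simp add: field_simps)
  ultimately have "u t = 1" if "t \<in> H" for t using that by (metis constant_on_def)
  moreover have tH: "\<tau> \<in> H" using \<tau> by (simp add: H_def)
  ultimately have "\<i> * c \<tau> * exp (- (of_real pi * \<i> * ((\<tau> + 1 / \<tau>) / 6))) = 1" by (simp add: u_def)
  then have "tprod x \<tau> = \<i> * exp (- (of_real pi * \<i> * ((\<tau> + 1 / \<tau>) / 6))) * (c \<tau> * tprod x \<tau>)"
    by (metis mult.assoc mult.commute mult_1)
  also have "c \<tau> * tprod x \<tau> = exp (of_real pi * \<i> * (x - x / \<tau> - x\<^sup>2 / \<tau>)) * tprod (x / \<tau>) (- 1 / \<tau>)"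
    using c[OF tH] by simp
  also have "\<i> * exp (- (of_real pi * \<i> * ((\<tau> + 1 / \<tau>) / 6))) * \<dots> =
     \<i> * (exp (- (of_real pi * \<i> * ((\<tau> + 1 / \<tau>) / 6))) * exp (of_real pi * \<i> * (x - x / \<tau> - x\<^sup>2 / \<tau>))) * tprod (x / \<tau>) (- 1 / \<tau>)"
    by (simp only: mult_ac)
  finally show ?thesis by (simp only: mult_exp_exp) (simp add: algebra_simps)
qed

section \<open>Dedekind sums and their reciprocity\<close>

lemma sawtooth_plus_int: "sawtooth (x + of_int n) = sawtooth x"
  by (simp add: sawtooth_def)

lemma sawtooth_minus: "sawtooth (- x) = - sawtooth x"
proof (cases "x \<in> \<int>")
  case False
  then have "- x \<notin> \<int>" by simp
  moreover have "\<lfloor>- x\<rfloor> = - \<lfloor>x\<rfloor> - 1"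
    using False by (simp add: floor_minus ceiling_altdef) (metis Ints_of_int)
  ultimately show ?thesis using False by (simp add: sawtooth_def)
qed (auto simp: sawtooth_def)

text \<open>
  The first argument is an integer here, because the Euclidean algorithm below produces negative ones.
\<close>

definition ded_sum :: "int \<Rightarrow> nat \<Rightarrow> real" where
  "ded_sum h k = (\<Sum>n<k. sawtooth (of_int h * real n / real k) * sawtooth (real n / real k))"

lemma dedekind_sum_eq: "dedekind_sum d c = ded_sum (int d) c"
  by (simp add: dedekind_sum_def ded_sum_def)

lemma ded_sum_minus: "ded_sum (- h) k = - ded_sum h k"
  by (simp add: ded_sum_def sawtooth_minus sum_negf)

lemma ded_sum_periodic:
  assumes "[h = h'] (mod int k)"
  shows "ded_sum h k = ded_sum h' k"
proof -
  obtain t where t: "h = h' + int k * t" using assms by (metis cong_iff_lin cong_sym)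
  show ?thesis unfolding ded_sum_def
  proof (intro sum.cong refl)
    fix n assume "n \<in> {..<k}"
    then have "of_int h * real n / real k = of_int h' * real n / real k + of_int (t * int n)"
      by (simp add: t field_simps)
    then show "sawtooth (of_int h * real n / real k) * sawtooth (real n / real k) =
        sawtooth (of_int h' * real n / real k) * sawtooth (real n / real k)"
      by (simp only: sawtooth_plus_int)
  qed
qed

lemma sawtooth_fraction:
  assumes "k > 0"
  shows "sawtooth (real a / real k) = (if a mod k = 0 then 0 else real (a mod k) / real k - 1 / 2)"
proof -
  have e: "real a / real k = real (a mod k) / real k + of_int (int (a div k))"
    using assms by (simp add: field_simps flip: of_nat_mult of_nat_add)
  have "sawtooth (real a / real k) = sawtooth (real (a mod k) / real k)"
    unfolding e by (rule sawtooth_plus_int)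
  moreover have "\<lfloor>real (a mod k) / real k\<rfloor> = 0" using assms by (simp add: floor_eq_iff)
  moreover have "real (a mod k) / real k \<in> \<int> \<longleftrightarrow> a mod k = 0"
  proof
    assume "real (a mod k) / real k \<in> \<int>"
    then have "real (a mod k) / real k = of_int \<lfloor>real (a mod k) / real k\<rfloor>" by (auto elim: Ints_cases)
    then show "a mod k = 0" using \<open>\<lfloor>_\<rfloor> = 0\<close> assms by simp
  qed auto
  ultimately show ?thesis by (simp add: sawtooth_def)
qed

text \<open>
  A square is a sum of odd numbers, so the left side counts, with the weights \<open>2v - 1\<close>, the lattice
  points \<open>(n, v)\<close> under the line of slope \<open>h/k\<close>. Summing over the rows \<open>v\<close> first gives the right
  side; no point lies on the line because \<open>h\<close> and \<open>k\<close> are coprime. The row \<open>v = 0\<close> on the right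
  contributes \<open>-(k - 1)\<close>, which the last summand compensates.
\<close>

lemma sum_div_squares:
  fixes h k :: nat
  assumes "coprime h k" "h > 0" "k > 0"
  shows "(\<Sum>n<k. (real (h * n div k))\<^sup>2) =
     (\<Sum>v<h. (2 * real v - 1) * (real k - 1 - real (k * v div h))) + (real k - 1)"
proof -
  have sq: "(real a)\<^sup>2 = (\<Sum>v\<in>{1..a}. 2 * real v - 1)" for a
    by (induction a) (simp_all add: power2_eq_square algebra_simps)
  have lt: "h * n div k < h" if "n < k" for n
    using that assms by (simp add: less_mult_imp_div_less mult.commute)
  have "(\<Sum>n<k. (real (h * n div k))\<^sup>2) = (\<Sum>n<k. \<Sum>v\<in>{v\<in>{1..<h}. v \<le> h * n div k}. 2 * real v - 1)"
  proof (intro sum.cong refl)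
    fix n assume "n \<in> {..<k}"
    then have "{v\<in>{1..<h}. v \<le> h * n div k} = {1..h * n div k}" using lt[of n] by auto
    then show "(real (h * n div k))\<^sup>2 = (\<Sum>v\<in>{v\<in>{1..<h}. v \<le> h * n div k}. 2 * real v - 1)"
      by (simp add: sq)
  qed
  also have "\<dots> = (\<Sum>v\<in>{1..<h}. \<Sum>n\<in>{n\<in>{..<k}. v \<le> h * n div k}. 2 * real v - 1)"
    by (rule sum.swap_restrict) auto
  also have "\<dots> = (\<Sum>v\<in>{1..<h}. (2 * real v - 1) * (real k - 1 - real (k * v div h)))"
  proof (intro sum.cong refl)
    fix v assume v: "v \<in> {1..<h}"
    have "v \<le> h * n div k \<longleftrightarrow> k * v div h < n" for n
    proof -
      have "v \<le> h * n div k \<longleftrightarrow> v * k \<le> h * n" using assms by (simp add: less_eq_div_iff_mult_less_eq)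
      also have "\<dots> \<longleftrightarrow> k * v < h * n"
      proof -
        have "k * v \<noteq> h * n"
        proof
          assume "k * v = h * n"
          then have "h dvd k * v" by simp
          then have "h dvd v" using assms(1) coprime_dvd_mult_right_iff by blast
          then show False using v by (auto dest: dvd_imp_le)
        qed
        then show ?thesis by (auto simp: mult.commute)
      qed
      also have "\<dots> \<longleftrightarrow> k * v div h < n" using assms by (simp add: div_less_iff_less_mult mult.commute)
      finally show ?thesis .
    qed
    then have "{n\<in>{..<k}. v \<le> h * n div k} = {n\<in>{..<k}. k * v div h < n}" by (simp only:)
    also have "\<dots> = {k * v div h<..<k}" by auto
    finally have "{n\<in>{..<k}. v \<le> h * n div k} = {k * v div h<..<k}" .
    moreover have "k * v div h < k" using v assms by (simp add: less_mult_imp_div_less)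
    ultimately show "(\<Sum>n\<in>{n\<in>{..<k}. v \<le> h * n div k}. 2 * real v - 1) =
        (2 * real v - 1) * (real k - 1 - real (k * v div h))"
      by (simp add: of_nat_diff algebra_simps)
  qed
  also have "\<dots> = (\<Sum>v<h. (2 * real v - 1) * (real k - 1 - real (k * v div h))) + (real k - 1)"
  proof -
    have "{..<h} = insert 0 {1..<h}" using assms by auto
    then show ?thesis by simp
  qed
  finally show ?thesis .
qed

lemma sum_lessThan_real: "(\<Sum>n<k. real n) = real k * (real k - 1) / 2"
  by (induction k) (simp_all add: field_simps)

lemma sum_lessThan_square_real: "(\<Sum>n<k. (real n)\<^sup>2) = real k * (real k - 1) * (2 * real k - 1) / 6"
  by (induction k) (simp_all add: field_simps power2_eq_square)

lemma bij_betw_mult_mod: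
  fixes h k :: nat
  assumes "coprime h k" "k > 0"
  shows "bij_betw (\<lambda>n. h * n mod k) {..<k} {..<k}"
proof -
  have "inj_on (\<lambda>n. h * n mod k) {..<k}"
  proof (rule inj_onI)
    fix x y assume *: "x \<in> {..<k}" "y \<in> {..<k}" "h * x mod k = h * y mod k"
    then have "[h * x = h * y] (mod k)" by (simp add: cong_def)
    then have "[x = y] (mod k)" using assms(1) by (simp add: cong_mult_lcancel_nat)
    then show "x = y" using * by (simp add: cong_def)
  qed
  moreover have "(\<lambda>n. h * n mod k) ` {..<k} \<subseteq> {..<k}" using assms by auto
  ultimately show ?thesis
    by (simp add: bij_betw_def endo_inj_surj)
qed

lemma mod_real: "real (a mod k) = real a - real k * real (a div k)" for a k :: nat
  by (simp add: algebra_simps flip: of_nat_mult of_nat_add)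

text \<open>
  The formula \<open>(x - 1/2)(y - 1/2)\<close> for the product of sawtooth values is wrong only at \<open>n = 0\<close>, where
  it gives \<open>1/4\<close> instead of 0.
\<close>

lemma ded_sum_formula:
  fixes h k :: nat
  assumes "coprime h k" "k > 0"
  shows "ded_sum (int h) k = (\<Sum>n<k. real n * real (h * n mod k)) / (real k)\<^sup>2 - (real k - 1) / 4 "
proof -
  have z: "h * n mod k = 0 \<longleftrightarrow> n = 0" if "n < k" for n
  proof
    assume "h * n mod k = 0"
    then have "k dvd h * n" by auto
    then have "k dvd n" using assms(1) by (simp add: coprime_commute coprime_dvd_mult_right_iff)
    then show "n = 0" using that by (auto dest: dvd_imp_le)
  qed simp
  let ?S = "\<Sum>n<k. real n"
  have S': "(\<Sum>n<k. real (h * n mod k)) = ?S"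
    using sum.reindex_bij_betw[OF bij_betw_mult_mod[OF assms], of real] by simp
  have "ded_sum (int h) k = (\<Sum>n<k. (real (h * n mod k) / real k - 1/2) * (real n / real k - 1/2) - (if n = 0 then 1/4 else 0))"
    unfolding ded_sum_def
  proof (intro sum.cong refl)
    fix n assume "n \<in> {..<k}"
    then have n: "n < k" by simp
    show "sawtooth (of_int (int h) * real n / real k) * sawtooth (real n / real k) =
      (real (h * n mod k) / real k - 1/2) * (real n / real k - 1/2) - (if n = 0 then 1/4 else 0)"
      using sawtooth_fraction[OF assms(2), of "h * n"] sawtooth_fraction[OF assms(2), of n] z[OF n] n by simp
  qed
  also have "\<dots> = (\<Sum>n<k. (real (h * n mod k) / real k - 1/2) * (real n / real k - 1/2)) - 1/4"
    using assms(2) by (simp add: sum_subtractf sum.delta')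
  also have "(\<Sum>n<k. (real (h * n mod k) / real k - 1/2) * (real n / real k - 1/2)) =
     (\<Sum>n<k. (real n * real (h * n mod k)) / (real k)\<^sup>2 - real n / (2 * real k) - real (h * n mod k) / (2 * real k) + 1/4)"
    by (intro sum.cong refl) (simp add: field_simps power2_eq_square)
  also have "\<dots> = (\<Sum>n<k. real n * real (h * n mod k)) / (real k)\<^sup>2 - ?S / (2 * real k) - ?S / (2 * real k) + real k / 4"
    by (simp add: sum.distrib sum_subtractf S' flip: sum_divide_distrib)
  also have "?S / (2 * real k) = (real k - 1) / 4" using assms(2) by (simp add: sum_lessThan_real)
  finally have e: "ded_sum (int h) k = (\<Sum>n<k. real n * real (h * n mod k)) / (real k)\<^sup>2
     - (real k - 1) / 4 - (real k - 1) / 4 + real k / 4 - 1 / 4" .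
  have "a - (x - 1) / 4 - (x - 1) / 4 + x / 4 - 1 / 4 = a - (x - 1) / 4" for a x :: real by argo
  then show ?thesis unfolding e .
qed

lemma reciprocity_polynomial_identity:
  fixes x y :: real
  assumes "x \<noteq> 0" "y \<noteq> 0"
  shows "x\<^sup>2 * ((y - 1) * (2 * y - 1) / 6) / 2 + y\<^sup>2 * ((x - 1) * (2 * x - 1) / 6) + (y - 1) * (2 * y - 1) / 6 / 2
      - y * ((y - 1) * (x * (x - 1)) - x * (y - 1) + (y - 1) * (x - 1) / 2 + (y - 1)) / 2
      - x * y * (y - 1) / 4 - x * y * (x - 1) / 4
    = (- 1 / 4 + (x / y + y / x + 1 / (x * y)) / 12) * (x * y)"
proof -
  have "(- 1 / 4 + (x / y + y / x + 1 / (x * y)) / 12) * (x * y) = - (x * y) / 4 + (x * x + y * y + 1) / 12"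
    using assms by (simp add: field_simps)
  then show ?thesis by (simp only: power2_eq_square) (simp add: algebra_simps add_divide_distrib diff_divide_distrib)
qed

text \<open>
  Since \<open>n \<mapsto> hn mod k\<close> permutes the residues, the sum of \<open>(hn mod k)\<^sup>2\<close> is known. Expanding it
  expresses the sum of \<open>n\<lfloor>hn/k\<rfloor>\<close>, which is what the Dedekind sum contains, by that of
  \<open>\<lfloor>hn/k\<rfloor>\<^sup>2\<close>; the lattice point count turns the latter into the sum for \<open>s(k, h)\<close>.
\<close>

lemma dedekind_reciprocity:
  fixes h k :: nat
  assumes "coprime h k" "h > 0" "k > 0"
  shows "ded_sum (int h) k + ded_sum (int k) h =
    - 1 / 4 + (real h / real k + real k / real h + 1 / (real h * real k)) / 12"
proof -
  define A where "A = (\<Sum>n<k. real n * real (h * n div k))"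
  define B where "B = (\<Sum>n<h. real n * real (k * n div h))"
  define A2 where "A2 = (\<Sum>n<k. (real (h * n div k))\<^sup>2)"
  define Q where "Q = (\<lambda>k. real k * (real k - 1) * (2 * real k - 1) / 6)"
  have k0: "real k \<noteq> 0" "real h \<noteq> 0" using assms by auto
  have hk: "coprime k h" using assms(1) by (simp add: coprime_commute)
  have s: "ded_sum (int h) k = (real h * Q k - real k * A) / (real k)\<^sup>2 - (real k - 1) / 4"
    if "coprime h k" "k > 0" "A = (\<Sum>n<k. real n * real (h * n div k))" for h k A
  proof -
    have "(\<Sum>n<k. real n * real (h * n mod k)) = (\<Sum>n<k. real h * (real n)\<^sup>2 - real k * (real n * real (h * n div k)))"
      by (intro sum.cong refl) (simp add: mod_real algebra_simps power2_eq_square)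
    also have "\<dots> = real h * Q k - real k * A"
      by (simp add: sum_subtractf sum_distrib_left[symmetric] sum_lessThan_square_real Q_def that(3))
    finally show ?thesis using ded_sum_formula[OF that(1,2)] by simp
  qed
  note s1 = s[OF assms(1,3) A_def] and s2 = s[OF hk assms(2) B_def]
  have "(\<Sum>n<k. (real (h * n mod k))\<^sup>2) = Q k"
    using sum.reindex_bij_betw[OF bij_betw_mult_mod[OF assms(1,3)], of "\<lambda>n. (real n)\<^sup>2"]
    by (simp add: sum_lessThan_square_real Q_def)
  moreover have "(\<Sum>n<k. (real (h * n mod k))\<^sup>2) = (\<Sum>n<k. (real h)\<^sup>2 * (real n)\<^sup>2 - 2 * real h * real k * (real n * real (h * n div k)) + (real k)\<^sup>2 * (real (h * n div k))\<^sup>2)"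
    by (intro sum.cong refl) (simp add: mod_real algebra_simps power2_eq_square)
  ultimately have e1: "Q k = (real h)\<^sup>2 * Q k - 2 * real h * real k * A + (real k)\<^sup>2 * A2"
    by (simp add: sum.distrib sum_subtractf sum_distrib_left[symmetric] sum_lessThan_square_real Q_def A_def A2_def)
  have C: "(\<Sum>v<h. real (k * v div h)) = (real k - 1) * (real h - 1) / 2"
  proof -
    have "(\<Sum>n<h. real (k * n mod h)) = (\<Sum>n<h. real n)"
      using sum.reindex_bij_betw[OF bij_betw_mult_mod[OF hk assms(2)], of real] by simp
    moreover have "(\<Sum>n<h. real (k * n mod h)) = (\<Sum>n<h. real k * real n - real h * real (k * n div h))"
      by (intro sum.cong refl) (simp add: mod_real)
    ultimately have "real k * (\<Sum>n<h. real n) - real h * (\<Sum>v<h. real (k * v div h)) = (\<Sum>n<h. real n)"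
      by (simp add: sum_subtractf sum_distrib_left[symmetric])
    then have "real h * (\<Sum>v<h. real (k * v div h)) = real h * ((real k - 1) * (real h - 1) / 2)"
      by (simp add: sum_lessThan_real field_simps)
    then show ?thesis by (simp only: mult_left_cancel[OF k0(2)])
  qed
  have "A2 = (\<Sum>v<h. 2 * (real k - 1) * real v - 2 * (real v * real (k * v div h)) - (real k - 1) + real (k * v div h)) + (real k - 1)"
    unfolding A2_def sum_div_squares[OF assms] by (intro arg_cong2[where f = "(+)"] sum.cong refl) (simp add: algebra_simps)
  also have "\<dots> = 2 * (real k - 1) * (real h * (real h - 1) / 2) - 2 * B - real h * (real k - 1) + (real k - 1) * (real h - 1) / 2 + (real k - 1)"
    by (simp add: sum.distrib sum_subtractf sum_distrib_left[symmetric] C B_def sum_lessThan_real)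
  finally have "A2 = 2 * (real k - 1) * (real h * (real h - 1) / 2) - 2 * B - real h * (real k - 1) + (real k - 1) * (real h - 1) / 2 + (real k - 1)" .
  moreover have "2 * a * (c / 2) = a * c" for a c :: real by simp
  ultimately have e2: "A2 = (real k - 1) * (real h * (real h - 1)) - 2 * B - real h * (real k - 1) + (real k - 1) * (real h - 1) / 2 + (real k - 1)"
    by (simp only:)
  have e3: "2 * real h * real k * A = (real h)\<^sup>2 * Q k - Q k + (real k)\<^sup>2 * A2" using e1 by linarith
  define qk where "qk = (real k - 1) * (2 * real k - 1) / 6"
  define qh where "qh = (real h - 1) * (2 * real h - 1) / 6"
  have Qk: "Q k = real k * qk" and Qh: "Q h = real h * qh" by (simp_all add: Q_def qk_def qh_def)
  have m1: "ded_sum (int h) k * (real h * real k) = (real h)\<^sup>2 * qk - real h * A - real h * real k * (real k - 1) / 4"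
    unfolding s1 Qk using k0 by (simp add: field_simps power2_eq_square)
  have m2: "ded_sum (int k) h * (real h * real k) = (real k)\<^sup>2 * qh - real k * B - real h * real k * (real h - 1) / 4"
    unfolding s2 Qh using k0 by (simp add: field_simps power2_eq_square)
  have "real k * (2 * (real h * A)) = real k * ((real h)\<^sup>2 * qk - qk + real k * A2)"
    using e3 unfolding Qk by (simp add: algebra_simps power2_eq_square)
  then have m3: "2 * (real h * A) = (real h)\<^sup>2 * qk - qk + real k * A2"
    by (simp only: mult_left_cancel[OF k0(1)])
  define P where "P = (real k - 1) * (real h * (real h - 1)) - real h * (real k - 1) + (real k - 1) * (real h - 1) / 2 + (real k - 1)"
  have "A2 = P - 2 * B" unfolding e2 P_def by simp
  then have m4: "real k * A2 = real k * P - 2 * (real k * B)" by (simp add: right_diff_distrib)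
  have lin: "a - u - c1 + (b - w - c2) = a / 2 + b + q / 2 - p / 2 - c1 - c2"
    if "2 * u = a - q + v" "v = p - 2 * w" for a b u v w p q c1 c2 :: real
    using that by linarith
  have "(ded_sum (int h) k + ded_sum (int k) h) * (real h * real k) =
      (real h)\<^sup>2 * qk / 2 + (real k)\<^sup>2 * qh + qk / 2 - real k * P / 2 - real h * real k * (real k - 1) / 4 - real h * real k * (real h - 1) / 4"
    unfolding distrib_right[of _ _ "real h * real k"] m1 m2 by (rule lin[OF m3 m4])
  also have "\<dots> = (- 1 / 4 + (real h / real k + real k / real h + 1 / (real h * real k)) / 12) * (real h * real k)"
    unfolding qk_def qh_def P_def by (rule reciprocity_polynomial_identity[OF k0(2,1)])
  finally show ?thesis using k0 by (simp only: mult_right_cancel[of "real h * real k"] mult_eq_0_iff simp_thms)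
qed

section \<open>The transformation at an arbitrary cusp\<close>

text \<open>
  The exponents of one step of the Euclidean algorithm: inversion at \<open>\<tau> = (h + iZ)/K\<close>, followed by
  the transformation at the cusp \<open>-K/h\<close> with local parameter \<open>Z/\<tau>\<close>. The rational number in the
  first line of the result is the one that occurs in the reciprocity law.
\<close>

lemma tprod_modular_exponent_identity:
  fixes \<tau> Z K h x :: complex
  assumes Z: "\<i> * Z = K * \<tau> - h" and nz: "\<tau> \<noteq> 0" "Z \<noteq> 0" "K \<noteq> 0" "h \<noteq> 0"
  shows "\<i> * (x - x / \<tau> - x\<^sup>2 / \<tau> - (\<tau> + 1 / \<tau>) / 6) +
      ((Z / \<tau> - 1 / (Z / \<tau>)) / (6 * h) + \<i> * (x / \<tau>) - (x / \<tau>) / (Z / \<tau>) - h * (x / \<tau>)\<^sup>2 / (Z / \<tau>)) =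
    - (\<i> / 6) * (h / K + K / h + 1 / (h * K)) +
      ((Z - 1 / Z) / (6 * K) + \<i> * x - x / Z - K * x\<^sup>2 / Z)"
proof -
  have \<tau>: "\<tau> = (\<i> * Z + h) / K" using Z nz by (simp add: field_simps)
  have 1: "Z / \<tau> = - \<i> * K + \<i> * h / \<tau>"
  proof -
    have "Z = - \<i> * (K * \<tau> - h)" unfolding Z[symmetric] by (simp add: mult.assoc[symmetric])
    then show ?thesis using nz by (simp add: field_simps)
  qed
  have 2: "1 / (Z / \<tau>) = \<i> / K + h / (K * Z)"
    using nz by (simp add: \<tau> field_simps)
  have 3: "Z / K = - \<i> * \<tau> + \<i> * h / K"
  proof -
    have "Z = - \<i> * (K * \<tau> - h)" unfolding Z[symmetric] by (simp add: mult.assoc[symmetric])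
    then show ?thesis using nz by (simp add: field_simps)
  qed
  have 4: "h * (x / \<tau>)\<^sup>2 / (Z / \<tau>) = K * x\<^sup>2 / Z - \<i> * x\<^sup>2 / \<tau>"
  proof -
    have "K * x\<^sup>2 / Z - \<i> * x\<^sup>2 / \<tau> = x\<^sup>2 * (K * \<tau> - \<i> * Z) / (Z * \<tau>)"
      using nz by (simp add: field_simps)
    also have "K * \<tau> - \<i> * Z = h" using Z by simp
    finally show ?thesis using nz by (simp add: field_simps power2_eq_square)
  qed
  have 5: "(x / \<tau>) / (Z / \<tau>) = x / Z" using nz by simp
  have c1: "(Z / \<tau> - 1 / (Z / \<tau>)) / (6 * h) = - (\<i> / 6) * (K / h) + (\<i> / 6) / \<tau> - (\<i> / 6) * (1 / (h * K)) - 1 / (6 * K * Z)"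
    unfolding 2 unfolding 1 using nz by (simp add: field_simps)
  have c2: "(Z - 1 / Z) / (6 * K) = - (\<i> / 6) * \<tau> + (\<i> / 6) * (h / K) - 1 / (6 * K * Z)"
  proof -
    have "(Z - 1 / Z) / (6 * K) = (Z / K) / 6 - 1 / (6 * K * Z)" using nz by (simp add: field_simps)
    then show ?thesis unfolding 3 by (simp add: field_simps)
  qed
  show ?thesis unfolding 4 5 c1 c2 by (simp add: algebra_simps add_divide_distrib diff_divide_distrib)
qed

lemma ded_sum_1 [simp]: "ded_sum h (Suc 0) = 0"
  by (simp add: ded_sum_def sawtooth_def)

lemma tprod_tau_cong:
  assumes "[a = b] (mod int K)" "K > 0"
  shows "tprod x ((of_int a + w) / of_nat K) = tprod x ((of_int b + w) / of_nat K)"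
proof -
  obtain t where t: "a = b + int K * t" using assms by (metis cong_iff_lin cong_sym)
  have "(of_int a + w) / of_nat K = (of_int b + w) / of_nat K + of_int t"
    using assms(2) by (simp add: t field_simps)
  then show ?thesis by (simp only: tprod_tau_plus_int)
qed

text \<open>
  Strong induction on the denominator. After reducing \<open>H\<close> modulo \<open>K\<close>, inversion maps \<open>(H + iZ)/K\<close>
  to \<open>(-K + iZ')/H\<close> with the smaller denominator \<open>H\<close>. The multiplier of the two steps is
  \<open>i\<^sup>2 exp (2\<pi>i s(K, H))\<close>, and reciprocity converts it to \<open>i exp (-2\<pi>i s(H, K))\<close> times the exponential of the rational
  number in the preceding identity. For \<open>K = 1\<close> the
  claim is the inversion itself.
\<close>

theorem tprod_modular:
  fixes K :: nat and H hb :: int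
  assumes "K > 0" "coprime H (int K)" "[hb * H = - 1] (mod int K)" "Re Z > 0"
  shows "tprod x ((of_int H + \<i> * Z) / of_nat K) =
     \<i> * exp (- 2 * of_real pi * \<i> * of_real (ded_sum H K)) *
     exp (of_real pi * ((Z - 1 / Z) / (6 * of_nat K) + \<i> * x - x / Z - of_nat K * x\<^sup>2 / Z)) *
     tprod (x / (\<i> * Z)) ((of_int hb + \<i> / Z) / of_nat K)"
  using assms
proof (induction K arbitrary: H hb Z x rule: less_induct)
  case (less K)
  note K = less.prems(1) and cop = less.prems(2) and hb = less.prems(3) and Z = less.prems(4)
  define H0 where "H0 = H mod int K"
  have HH: "[H = H0] (mod int K)" by (simp add: H0_def cong_def)
  have H0b: "0 \<le> H0" "H0 < int K" using K by (simp_all add: H0_def)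
  have cop0: "coprime H0 (int K)" using cop HH by (metis cong_imp_coprime)
  have hb0: "[hb * H0 = - 1] (mod int K)" using hb HH by (metis cong_scalar_left cong_sym cong_trans)
  have Z0: "Z \<noteq> 0" using Z by auto
  have "tprod x ((of_int H0 + \<i> * Z) / of_nat K) =
     \<i> * exp (- 2 * of_real pi * \<i> * of_real (ded_sum H0 K)) *
     exp (of_real pi * ((Z - 1 / Z) / (6 * of_nat K) + \<i> * x - x / Z - of_nat K * x\<^sup>2 / Z)) *
     tprod (x / (\<i> * Z)) ((of_int hb + \<i> / Z) / of_nat K)"
  proof (cases "H0 = 0")
    case True
    then have K1: "K = Suc 0" using cop0 by simp
    have "Im (\<i> * Z) > 0" using Z by simp
    note S = tprod_S_transformation[OF this, of x]
    have "\<i> * (x - x / (\<i> * Z) - x\<^sup>2 / (\<i> * Z) - (\<i> * Z + 1 / (\<i> * Z)) / 6) =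
       (Z - 1 / Z) / 6 + \<i> * x - x / Z - x\<^sup>2 / Z"
      using Z0 by (simp add: field_simps)
    moreover have "- 1 / (\<i> * Z) = \<i> / Z" using Z0 by (simp add: field_simps)
    moreover have "tprod (x / (\<i> * Z)) (of_int hb + \<i> / Z) = tprod (x / (\<i> * Z)) (\<i> / Z)"
      using tprod_tau_plus_int[of _ "\<i> / Z" hb] by (simp add: add.commute)
    ultimately show ?thesis using S by (simp add: True K1 mult.assoc)
  next
    case False
    define h where "h = nat H0"
    have h: "H0 = int h" "0 < h" "h < K" using H0b False by (auto simp: h_def)
    have coph: "coprime h K" using cop0 h by simp
    obtain t where t: "hb * H0 + 1 = int K * t"
      using hb0 by (auto simp: cong_iff_dvd_diff)
    define \<tau> where "\<tau> = (of_nat h + \<i> * Z) / of_nat K"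
    have iZ: "\<i> * Z = of_nat K * \<tau> - of_nat h" using K by (simp add: \<tau>_def)
    have Im\<tau>: "Im \<tau> > 0" using Z K by (simp add: \<tau>_def)
    then have \<tau>0: "\<tau> \<noteq> 0" by auto
    have K0: "(of_nat K :: complex) \<noteq> 0" "(of_nat h :: complex) \<noteq> 0" using K h by auto
    have Z': "Re (Z / \<tau>) > 0"
    proof -
      have "Z / \<tau> = - \<i> * of_nat K + \<i> * of_nat h / \<tau>"
      proof -
        have "Z = - \<i> * (of_nat K * \<tau> - of_nat h)" unfolding iZ[symmetric] by (simp add: mult.assoc[symmetric])
        then show ?thesis using \<tau>0 by (simp add: field_simps)
      qed
      moreover have "Re (\<i> * of_nat h / \<tau>) = real h * Im \<tau> / (cmod \<tau>)\<^sup>2"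
        by (simp add: Re_divide cmod_power2)
      ultimately show ?thesis using Im\<tau> h(2) \<tau>0 by simp
    qed
    have copIH: "coprime (- int K) (int h)" using coph by (simp add: coprime_commute)
    \<comment> \<open>\<open>t = (hb h + 1)/K\<close> inverts \<open>K\<close> modulo \<open>h\<close>; with this choice the two images of the cusp agree exactly.\<close>
    have "[t * (- int K) = - 1] (mod int h)"
    proof -
      have "t * (- int K) - (- 1) = int h * (- hb)" using t h(1) by (simp add: algebra_simps)
      then show ?thesis by (metis cong_iff_dvd_diff dvd_triv_left)
    qed
    note IH = less.IH[OF h(3,2) copIH this Z', of "x / \<tau>"]
    have e1: "(of_int (- int K) + \<i> * (Z / \<tau>)) / of_nat h = - 1 / \<tau>"
    proof -
      have "of_int (- int K) + \<i> * (Z / \<tau>) = (- of_nat K * \<tau> + \<i> * Z) / \<tau>" using \<tau>0 by (simp add: field_simps)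
      also have "\<dots> = - of_nat h / \<tau>" unfolding iZ by simp
      finally show ?thesis using K0 by simp
    qed
    have e2: "(of_int t + \<i> / (Z / \<tau>)) / of_nat h = (of_int hb + \<i> / Z) / of_nat K"
    proof -
      have "of_int (hb * H0 + 1) = (of_int (int K * t) :: complex)" using t by simp
      then have tt: "of_int t = (of_int hb * of_nat h + 1) / (of_nat K :: complex)"
        using K0 by (simp add: h(1) field_simps)
      have "\<i> / (Z / \<tau>) = \<i> * \<tau> / Z" by simp
      also have "\<dots> = (\<i> * of_nat h - Z) / (of_nat K * Z)"
        unfolding \<tau>_def using K0 Z0 by (simp add: field_simps)
      finally show ?thesis unfolding tt by (simp only:) (use K0 Z0 in \<open>simp add: field_simps\<close>)
    qed
    have e3: "(x / \<tau>) / (\<i> * (Z / \<tau>)) = x / (\<i> * Z)" using \<tau>0 by simp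
    have rec: "of_real (ded_sum H0 K) = - 1 / 4 + (of_nat h / of_nat K + of_nat K / of_nat h + 1 / (of_nat h * of_nat K)) / 12
        - (of_real (ded_sum (int K) h) :: complex)"
    proof -
      have "ded_sum (int h) K = - 1 / 4 + (real h / real K + real K / real h + 1 / (real h * real K)) / 12 - ded_sum (int K) h"
        using dedekind_reciprocity[OF coph h(2) K] by simp
      then show ?thesis unfolding h(1) by (simp only: of_real_diff of_real_add of_real_divide of_real_mult of_real_of_nat_eq) simp
    qed
    let ?E1 = "\<i> * (x - x / \<tau> - x\<^sup>2 / \<tau> - (\<tau> + 1 / \<tau>) / 6)"
    let ?E2 = "(Z / \<tau> - 1 / (Z / \<tau>)) / (6 * of_nat h) + \<i> * (x / \<tau>) - (x / \<tau>) / (Z / \<tau>) - of_nat h * (x / \<tau>)\<^sup>2 / (Z / \<tau>)"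
    let ?E3 = "(Z - 1 / Z) / (6 * of_nat K) + \<i> * x - x / Z - of_nat K * x\<^sup>2 / Z"
    let ?T = "tprod (x / (\<i> * Z)) ((of_int hb + \<i> / Z) / of_nat K)"
    let ?s = "of_real (ded_sum (int K) h) :: complex"
    have key: "?E1 + ?E2 = - (\<i> / 6) * (of_nat h / of_nat K + of_nat K / of_nat h + 1 / (of_nat h * of_nat K)) + ?E3"
      by (rule tprod_modular_exponent_identity) (use iZ \<tau>0 Z0 K0 in auto)
    have i: "\<i> = exp (of_real pi * \<i> / 2)"
      using cis_conv_exp[of "pi / 2"] by (simp add: mult_ac complex_eq_iff)
    have "tprod x \<tau> = \<i> * exp (of_real pi * ?E1) * tprod (x / \<tau>) (- 1 / \<tau>)"
      using tprod_S_transformation[OF Im\<tau>, of x] by (simp only: mult.assoc)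
    also have "tprod (x / \<tau>) (- 1 / \<tau>) = \<i> * exp (- 2 * of_real pi * \<i> * of_real (ded_sum (- int K) h)) * exp (of_real pi * ?E2) * ?T"
      using IH unfolding e1 e2 e3 .
    also have "\<i> * exp (of_real pi * ?E1) * \<dots> =
       \<i> * (\<i> * exp (of_real pi * ?E1) * exp (- 2 * of_real pi * \<i> * of_real (ded_sum (- int K) h)) * exp (of_real pi * ?E2)) * ?T"
      by (simp only: mult_ac)
    also have "\<i> * exp (of_real pi * ?E1) * exp (- 2 * of_real pi * \<i> * of_real (ded_sum (- int K) h)) * exp (of_real pi * ?E2)
       = exp (of_real pi * (\<i> / 2 + 2 * \<i> * ?s + (?E1 + ?E2)))"
      by (subst i) (simp only: mult_exp_exp ded_sum_minus, simp add: algebra_simps)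
    also have "\<dots> = exp (- 2 * of_real pi * \<i> * of_real (ded_sum H0 K)) * exp (of_real pi * ?E3)"
      unfolding key rec mult_exp_exp by (intro arg_cong[where f = exp]) (simp add: algebra_simps add_divide_distrib)
    finally show ?thesis unfolding \<tau>_def by (simp only: h(1) of_int_of_nat_eq mult.assoc)
  qed
  moreover have "ded_sum H K = ded_sum H0 K" using HH by (rule ded_sum_periodic)
  moreover have "tprod x ((of_int H + \<i> * Z) / of_nat K) = tprod x ((of_int H0 + \<i> * Z) / of_nat K)"
    using HH K by (rule tprod_tau_cong)
  ultimately show ?case by simp
qed

section \<open>A single factor of the product near a cusp\<close>

lemma tprod_minus_multiple_tau:
  assumes "Im \<tau> > 0"
  shows "tprod (u - of_nat l * \<tau>) \<tau> =
    (- 1) ^ l * e2pi (of_nat l * u - of_nat l * (of_nat l + 1) / 2 * \<tau>) * tprod u \<tau>"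
proof (induction l)
  case (Suc l)
  define v where "v = u - of_nat (Suc l) * \<tau>"
  have "tprod (v + \<tau>) \<tau> = - e2pi (- v) * tprod v \<tau>" by (rule tprod_plus_tau[OF assms])
  moreover have "v + \<tau> = u - of_nat l * \<tau>" by (simp add: v_def algebra_simps)
  ultimately have "tprod v \<tau> = - e2pi v * tprod (u - of_nat l * \<tau>) \<tau>" by (simp add: e2pi_minus)
  also have "\<dots> = (- 1) ^ Suc l * (e2pi v * e2pi (of_nat l * u - of_nat l * (of_nat l + 1) / 2 * \<tau>)) * tprod u \<tau>"
    unfolding Suc.IH by simp
  also have "e2pi v * e2pi (of_nat l * u - of_nat l * (of_nat l + 1) / 2 * \<tau>) =
      e2pi (of_nat (Suc l) * u - of_nat (Suc l) * (of_nat (Suc l) + 1) / 2 * \<tau>)"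
    unfolding e2pi_add[symmetric] v_def by (intro arg_cong[where f = e2pi]) (simp add: field_simps)
  finally show ?case by (simp only: v_def)
qed simp

text \<open>
  Specialisation of the transformation to \<open>x = r\<tau>\<close> with modulus \<open>m\<tau>\<close>, for \<open>\<tau> = h/k + iz\<close>. The
  transformed point is \<open>ls tt + s - lam tt\<close>. Removing the integral multiple \<open>lam tt\<close> moves it to the
  fundamental strip, and the resulting exponent consists of a phase, a multiple of \<open>z\<close> and
  a multiple of \<open>1/z\<close>: these are \<open>D\<close>, \<open>\<Omega>\<close> and \<open>\<Delta>\<close>.
\<close>

lemma theta_exponent_identity:
  fixes m r h k g hb lam z :: complex
  assumes nz: "m \<noteq> 0" "k \<noteq> 0" "g \<noteq> 0" "z \<noteq> 0"
  defines "Z \<equiv> m * k * z / g" and "x \<equiv> r * (h / k + \<i> * z)"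
    and "tt \<equiv> hb * g / k + \<i> * g\<^sup>2 / (m * k\<^sup>2 * z)"
    and "ls \<equiv> lam - r * h / g" and "s \<equiv> (r * g + r * hb * (m * h)) / (m * k)"
  shows "x / (\<i> * Z) = ls * tt + s - lam * tt"
    and "(Z - 1 / Z) / (6 * (k / g)) + \<i> * x - x / Z - (k / g) * x\<^sup>2 / Z +
          2 * \<i> * (lam * (ls * tt + s) - lam * (lam + 1) / 2 * tt) =
        \<i> * (r * h / k - r * g / (m * k) + 2 * (r * g) * ls / (m * k) + hb * g / k * (lam\<^sup>2 - lam)) +
         ((2 * m - 12 * r + 12 * r\<^sup>2 / m) * z +
          (- (2 * g\<^sup>2 / m + 12 * g\<^sup>2 / m * (ls\<^sup>2 - ls))) / (k\<^sup>2 * z)) / 12"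
proof -
  have "x / (\<i> * Z) = - (r * h * g) * \<i> / (m * k\<^sup>2 * z) + r * g / (m * k)"
    unfolding x_def Z_def using nz by (simp add: field_simps power2_eq_square)
  also have "\<dots> = ls * tt + s - lam * tt"
    unfolding ls_def tt_def s_def using nz by (simp add: field_simps power2_eq_square)
  finally show "x / (\<i> * Z) = ls * tt + s - lam * tt" .
  have 1: "(Z - 1 / Z) / (6 * (k / g)) = m * z / 6 - g\<^sup>2 / (6 * m * k\<^sup>2 * z)"
    unfolding Z_def using nz by (simp add: field_simps power2_eq_square)
  have 2: "x / Z = g * r * h / (m * k\<^sup>2 * z) + \<i> * r * g / (m * k)"
    unfolding x_def Z_def using nz by (simp add: field_simps power2_eq_square)
  have 3: "(k / g) * x\<^sup>2 / Z = r\<^sup>2 * h\<^sup>2 / (m * k\<^sup>2 * z) + 2 * \<i> * r\<^sup>2 * h / (m * k) - r\<^sup>2 * z / m"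
    unfolding x_def Z_def using nz by (simp add: field_simps power2_eq_square)
  have 4: "2 * \<i> * (lam * (ls * tt + s) - lam * (lam + 1) / 2 * tt) =
     2 * \<i> * lam * s + \<i> * lam * (lam - 1 - 2 * r * h / g) * tt"
    unfolding ls_def using nz by (simp add: field_simps)
  have 5: "\<i> * lam * (lam - 1 - 2 * r * h / g) * tt =
      \<i> * lam * (lam - 1) * hb * g / k - 2 * \<i> * lam * r * h * hb / k -
      (g\<^sup>2 * lam * (lam - 1) - 2 * g * lam * r * h) / (m * k\<^sup>2 * z)"
    unfolding tt_def using nz by (simp add: field_simps power2_eq_square)
  have 6: "2 * \<i> * lam * s = 2 * \<i> * lam * r * g / (m * k) + 2 * \<i> * lam * r * hb * h / k"
    unfolding s_def using nz by (simp add: field_simps)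
  have 7: "(- (2 * g\<^sup>2 / m + 12 * g\<^sup>2 / m * (ls\<^sup>2 - ls))) / (k\<^sup>2 * z) =
     - (2 * g\<^sup>2 + 12 * g\<^sup>2 * (lam\<^sup>2 - lam) - 24 * g * lam * r * h + 12 * r\<^sup>2 * h\<^sup>2 + 12 * g * r * h) / (m * k\<^sup>2 * z)"
    unfolding ls_def using nz by (simp add: field_simps power2_eq_square)
  have 8: "2 * (r * g) * ls / (m * k) = 2 * r * g * lam / (m * k) - 2 * r\<^sup>2 * h / (m * k)"
    unfolding ls_def using nz by (simp add: field_simps power2_eq_square)
  show "(Z - 1 / Z) / (6 * (k / g)) + \<i> * x - x / Z - (k / g) * x\<^sup>2 / Z +
          2 * \<i> * (lam * (ls * tt + s) - lam * (lam + 1) / 2 * tt) =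
        \<i> * (r * h / k - r * g / (m * k) + 2 * (r * g) * ls / (m * k) + hb * g / k * (lam\<^sup>2 - lam)) +
         ((2 * m - 12 * r + 12 * r\<^sup>2 / m) * z +
          (- (2 * g\<^sup>2 / m + 12 * g\<^sup>2 / m * (ls\<^sup>2 - ls))) / (k\<^sup>2 * z)) / 12"
    unfolding 4 5 6 7 8 1 2 3 unfolding x_def using nz
    by (simp add: power2_eq_square algebra_simps add_divide_distrib diff_divide_distrib)
qed

text \<open>
  The image of \<open>m(h/k + iz)\<close> under a modular substitution that moves its rational part to infinity.
\<close>

definition cusp_tau :: "nat \<Rightarrow> nat \<Rightarrow> int \<Rightarrow> complex \<Rightarrow> complex" where
  "cusp_tau m k hb z = of_int hb * of_nat (gcd m k) / of_nat k + \<i> * (of_nat (gcd m k))\<^sup>2 / (of_nat m * (of_nat k)\<^sup>2 * z)"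

text \<open>
  The real part that is left of the transformed point when its multiple of \<open>cusp_tau\<close> is removed.
  For \<open>\<lambda>\<^sup>* = 0\<close> this is the argument that occurs in \<open>\<Pi>\<close>.
\<close>

definition cusp_shift :: "nat \<Rightarrow> nat \<Rightarrow> nat \<Rightarrow> nat \<Rightarrow> int \<Rightarrow> real" where
  "cusp_shift m r h k hb = (real (r * gcd m k) + real r * of_int hb * real (m * h)) / real (m * k)"

definition D_exponent :: "nat \<Rightarrow> nat \<Rightarrow> nat \<Rightarrow> nat \<Rightarrow> int \<Rightarrow> real" where
  "D_exponent m r h k hb = real (r * h) / real k
           - real (r * gcd m k) / real (m * k)
           + 2 * real (r * gcd m k) * lam_star m r h k / real (m * k)
           + of_int hb * real (gcd m k) / real k
             * of_int ((lam m r h k)\<^sup>2 - lam m r h k)"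

definition Omega_term :: "nat \<Rightarrow> nat \<Rightarrow> real" where
  "Omega_term m r = 2 * real m - 12 * real r + 12 * (real r)\<^sup>2 / real m"

definition Delta_term :: "nat \<Rightarrow> nat \<Rightarrow> nat \<Rightarrow> nat \<Rightarrow> real" where
  "Delta_term m r h k = - (2 * (real (gcd m k))\<^sup>2 / real m
           + 12 * (real (gcd m k))\<^sup>2 / real m * ((lam_star m r h k)\<^sup>2 - lam_star m r h k))"

lemma exp_pi_split:
  assumes "A + 2 * \<i> * Y = \<i> * B + W / (12 :: complex)"
  shows "exp (of_real pi * A) * exp (2 * of_real pi * \<i> * Y) = exp (of_real pi * \<i> * B) * exp (of_real pi / 12 * W)"
proof -
  have "exp (of_real pi * A) * exp (2 * of_real pi * \<i> * Y) = exp (of_real pi * (A + 2 * \<i> * Y))"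
    unfolding mult_exp_exp by (simp add: algebra_simps)
  also have "\<dots> = exp (of_real pi * \<i> * B) * exp (of_real pi / 12 * W)"
    unfolding assms mult_exp_exp by (simp add: algebra_simps)
  finally show ?thesis .
qed

text \<open>
  With \<open>g = gcd(m, k)\<close>, the modulus \<open>m(h/k + iz)\<close> is \<open>(H + iZ)/K\<close> for \<open>H = mh/g\<close>, \<open>K = k/g\<close> in
  lowest terms and \<open>Z = mkz/g\<close>, so the transformation at the cusp \<open>H/K\<close> applies.
\<close>

lemma theta_prod_near_cusp:
  fixes m r h k :: nat and hb :: int and z :: complex
  assumes mr: "0 < r" "r < m" and hk: "0 < k" "coprime h k"
    and hb: "[hb * int (m * h div gcd m k) = - 1] (mod int (k div gcd m k))"
    and z: "Re z > 0"
  shows "theta_prod m r (e2pi (of_nat h / of_nat k + \<i> * z)) =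
    \<i> * (- 1) powi lam m r h k *
    exp (- 2 * of_real pi * \<i> * of_real (dedekind_sum (m * h div gcd m k) (k div gcd m k))) *
    exp (of_real pi * \<i> * of_real (D_exponent m r h k hb)) *
    exp (of_real pi / 12 * (of_real (Omega_term m r) * z + of_real (Delta_term m r h k) / ((of_nat k)\<^sup>2 * z))) *
    tprod (of_real (lam_star m r h k) * cusp_tau m k hb z + of_real (cusp_shift m r h k hb)) (cusp_tau m k hb z)"
proof -
  define g where "g = gcd m k"
  define K where "K = k div g"
  define H where "H = m * h div g"
  define Z where "Z = of_nat m * of_nat k * z / of_nat g"
  define x where "x = of_nat r * (of_nat h / of_nat k + \<i> * z)"
  define tt where "tt = cusp_tau m k hb z"
  define l where "l = nat (lam m r h k)"
  define ls where "ls = lam_star m r h k"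
  define s where "s = cusp_shift m r h k hb"
  define u where "u = of_real ls * tt + of_real s"
  have g: "g > 0" "g dvd m" "g dvd k" using hk mr by (auto simp: g_def)
  have nz: "(of_nat m :: complex) \<noteq> 0" "(of_nat k :: complex) \<noteq> 0" "(of_nat g :: complex) \<noteq> 0" "z \<noteq> 0"
    using mr hk g z by auto
  have lam0: "lam m r h k \<ge> 0" unfolding lam_def by (rule order_trans[OF _ ceiling_mono[of 0]]) auto
  have l: "of_nat l = (of_int (lam m r h k) :: complex)" using lam0 by (simp add: l_def)
  have KH: "of_nat K = (of_nat k / of_nat g :: complex)" "of_nat H = (of_nat m * of_nat h / of_nat g :: complex)"
    unfolding K_def H_def using g by (auto simp: of_nat_div dvd_mult2)
  have K: "K > 0" unfolding K_def using g hk by (simp add: div_greater_zero_iff dvd_imp_le)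
  have cop: "coprime (int H) (int K)"
  proof -
    have 1: "coprime (m div g) (k div g)" unfolding g_def using hk mr by (simp add: div_gcd_coprime)
    have "k div g dvd k" using g(3) by (metis dvd_div_mult_self dvd_triv_left)
    then have 2: "coprime h (k div g)" using hk(2) coprime_divisors dvd_refl by blast
    have "H = m div g * h" using g(2) by (simp add: H_def dvd_div_mult)
    then show ?thesis using 1 2 by (simp add: K_def)
  qed
  have ReZ: "Re Z > 0" using z mr hk g by (simp add: Z_def Re_divide_of_nat)
  have hb': "[hb * int H = - 1] (mod int K)" using hb by (simp add: H_def K_def g_def)
  have "theta_prod m r (e2pi (of_nat h / of_nat k + \<i> * z)) = tprod x (of_nat m * (of_nat h / of_nat k + \<i> * z))"
    unfolding x_def by (rule theta_prod_eq_tprod) (use z mr in auto)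
  also have "of_nat m * (of_nat h / of_nat k + \<i> * z) = (of_int (int H) + \<i> * Z) / of_nat K"
    using nz by (simp add: KH Z_def field_simps)
  also have "tprod x \<dots> =  \<i> * exp (- 2 * of_real pi * \<i> * of_real (ded_sum (int H) K)) *
     exp (of_real pi * ((Z - 1 / Z) / (6 * of_nat K) + \<i> * x - x / Z - of_nat K * x\<^sup>2 / Z)) *
     tprod (x / (\<i> * Z)) ((of_int hb + \<i> / Z) / of_nat K)"
    by (rule tprod_modular[OF K cop hb' ReZ])
  also have "(of_int hb + \<i> / Z) / of_nat K = tt"
    unfolding KH tt_def cusp_tau_def Z_def g_def[symmetric] using nz by (simp add: field_simps power2_eq_square)
  also have "x / (\<i> * Z) = u - of_nat l * tt"
    using theta_exponent_identity(1)[OF nz, of "of_nat r" "of_nat h" "of_nat l" "of_int hb"]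
    unfolding u_def x_def Z_def tt_def cusp_tau_def ls_def lam_star_def s_def cusp_shift_def g_def[symmetric] l by simp
  also have "tprod (u - of_nat l * tt) tt =
    (- 1) ^ l * e2pi (of_nat l * u - of_nat l * (of_nat l + 1) / 2 * tt) * tprod u tt"
  proof (rule tprod_minus_multiple_tau)
    have "tt = (of_int hb + \<i> / Z) / of_nat K"
      unfolding KH tt_def cusp_tau_def Z_def g_def[symmetric] using nz by (simp add: field_simps power2_eq_square)
    moreover have "Im (\<i> / Z) > 0" using ReZ
      by (cases "Z = 0") (auto simp: Im_divide cmod_power2[symmetric] intro!: divide_pos_pos)
    ultimately show "Im tt > 0" using K by (simp add: Im_divide_of_nat)
  qed
  also have "(- 1) ^ l = (- 1 :: complex) powi lam m r h k"
    using lam0 by (simp add: power_int_def l_def)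
  also have "\<i> * exp (- 2 * of_real pi * \<i> * of_real (ded_sum (int H) K)) *
     exp (of_real pi * ((Z - 1 / Z) / (6 * of_nat K) + \<i> * x - x / Z - of_nat K * x\<^sup>2 / Z)) *
     ((- 1) powi lam m r h k * e2pi (of_nat l * u - of_nat l * (of_nat l + 1) / 2 * tt) * tprod u tt) =
     \<i> * (- 1) powi lam m r h k * exp (- 2 * of_real pi * \<i> * of_real (ded_sum (int H) K)) *
     (exp (of_real pi * ((Z - 1 / Z) / (6 * of_nat K) + \<i> * x - x / Z - of_nat K * x\<^sup>2 / Z)) *
      e2pi (of_nat l * u - of_nat l * (of_nat l + 1) / 2 * tt)) * tprod u tt"
    by (simp only: mult_ac)
  also have "exp (of_real pi * ((Z - 1 / Z) / (6 * of_nat K) + \<i> * x - x / Z - of_nat K * x\<^sup>2 / Z)) *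
      e2pi (of_nat l * u - of_nat l * (of_nat l + 1) / 2 * tt) =
     exp (of_real pi * \<i> * of_real (D_exponent m r h k hb)) *
     exp (of_real pi / 12 * (of_real (Omega_term m r) * z + of_real (Delta_term m r h k) / ((of_nat k)\<^sup>2 * z)))"
  proof -
    have ls': "complex_of_real ls = of_nat l - of_nat r * of_nat h / of_nat g"
      by (simp add: ls_def lam_star_def l g_def)
    have "(Z - 1 / Z) / (6 * of_nat K) + \<i> * x - x / Z - of_nat K * x\<^sup>2 / Z +
          2 * \<i> * (of_nat l * u - of_nat l * (of_nat l + 1) / 2 * tt) =
       \<i> * of_real (D_exponent m r h k hb) + (of_real (Omega_term m r) * z + of_real (Delta_term m r h k) / ((of_nat k)\<^sup>2 * z)) / 12"
      using theta_exponent_identity(2)[OF nz, of "of_nat r" "of_nat h" "of_nat l" "of_int hb"]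
      unfolding D_exponent_def Omega_term_def Delta_term_def ls_def[symmetric] g_def[symmetric]
        u_def x_def Z_def tt_def cusp_tau_def s_def cusp_shift_def KH
      by (simp add: ls' l)
    then show ?thesis unfolding e2pi_def by (rule exp_pi_split)
  qed
  finally show ?thesis
    unfolding u_def tt_def ls_def s_def dedekind_sum_eq H_def K_def g_def by (simp only: mult.assoc)
qed

section \<open>The Farey dissection\<close>

text \<open>
  Neighbours \<open>a/b < c/d\<close> in the Farey sequence of order \<open>N\<close>, characterised by determinant 1 and
  \<open>b + d > N\<close>; the condition \<open>c \<le> d\<close> restricts them to the unit interval.
\<close>

definition farey_pairs :: "nat \<Rightarrow> (nat \<times> nat \<times> nat \<times> nat) set" where
  "farey_pairs N = {(a, b, c, d). 0 < b \<and> 0 < d \<and> b \<le> N \<and> d \<le> N \<and> N < b + d \<and> c * b = a * d + 1 \<and> c \<le> d}"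

lemma farey_pairsD:
  assumes "(a, b, c, d) \<in> farey_pairs N"
  shows "0 < b" "0 < d" "b \<le> N" "d \<le> N" "N < b + d" "c * b = a * d + 1" "c \<le> d" "a < b" "0 < c"
    "coprime a b" "coprime c d"
proof -
  show *: "0 < b" "0 < d" "b \<le> N" "d \<le> N" "N < b + d" "c * b = a * d + 1" "c \<le> d"
    using assms by (auto simp: farey_pairs_def)
  have "a * d < d * b" using *(6,7) mult_le_mono1[of c d b] by linarith
  then show "a < b" by (simp add: mult.commute)
  show "0 < c" using *(6) by (cases c) auto
  show "coprime a b"
  proof (rule coprimeI)
    fix e assume "e dvd a" "e dvd b"
    then have "e dvd a * d + 1" "e dvd a * d" using *(6) by (metis dvd_mult, simp)
    then show "is_unit e" using dvd_add_right_iff by blast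
  qed
  show "coprime c d"
  proof (rule coprimeI)
    fix e assume "e dvd c" "e dvd d"
    then have "e dvd a * d + 1" "e dvd a * d" using *(6) by (metis dvd_mult2, simp)
    then show "is_unit e" using dvd_add_right_iff by blast
  qed
qed

lemma finite_farey_pairs: "finite (farey_pairs N)"
proof (rule finite_subset)
  show "farey_pairs N \<subseteq> {..N} \<times> {..N} \<times> {..N} \<times> {..N}"
  proof
    fix p assume p: "p \<in> farey_pairs N"
    obtain a b c d where [simp]: "p = (a, b, c, d)" by (cases p) auto
    show "p \<in> {..N} \<times> {..N} \<times> {..N} \<times> {..N}" using farey_pairsD[OF p[simplified]] by simp
  qed
qed auto

text \<open>
  Passing to order \<open>N + 1\<close> inserts the mediant between exactly those neighbours whose denominators
  add up to \<open>N + 1\<close>.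
\<close>

lemma farey_pairs_Suc:
  assumes "N \<ge> 1"
  defines "S0 \<equiv> {(a, b, c, d) \<in> farey_pairs N. b + d = Suc N}"
  shows "farey_pairs (Suc N) = (farey_pairs N - S0) \<union>
    ((\<lambda>(a, b, c, d). (a, b, a + c, b + d)) ` S0 \<union> (\<lambda>(a, b, c, d). (a + c, b + d, c, d)) ` S0)"
proof (intro equalityI subsetI)
  fix p assume p: "p \<in> farey_pairs (Suc N)"
  obtain a b c d where [simp]: "p = (a, b, c, d)" by (cases p) auto
  note P = farey_pairsD[OF p[simplified]]
  consider "b \<le> N" "d \<le> N" | "b \<le> N" "d = Suc N" | "b = Suc N" "d \<le> N" | "b = Suc N" "d = Suc N"
    using P(3,4) by linarith
  then show "p \<in> (farey_pairs N - S0) \<union>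
    ((\<lambda>(a, b, c, d). (a, b, a + c, b + d)) ` S0 \<union> (\<lambda>(a, b, c, d). (a + c, b + d, c, d)) ` S0)"
  proof cases
    case 1
    then show ?thesis using P by (auto simp: farey_pairs_def S0_def)
  next
    case 2
    have "a * b < c * b" using P(1,6,8) 2 mult_le_mono2[of b d a] by linarith
    then have ac: "a < c" by simp
    obtain e where e: "d = b + e" "0 < e" using 2 by (metis less_add_eq_less less_iff_Suc_add less_Suc_eq_le add_Suc_right zero_less_Suc)
    obtain f where f: "c = a + f" using ac less_imp_add_positive by blast
    have fe: "f * b = a * e + 1" using P(6) by (simp add: e f algebra_simps)
    have "f \<le> e"
    proof (rule ccontr)
      assume "\<not> f \<le> e"
      then have "(e + 1) * b \<le> a * e + 1" using fe mult_le_mono1[of "e + 1" f b] by linarith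
      moreover have "a * e + e \<le> b * e" using mult_le_mono1[of "a + 1" b e] P(8) by (simp add: algebra_simps)
      moreover have "(e + 1) * b = b * e + b" by (simp add: algebra_simps)
      ultimately have "b + e \<le> 1" by linarith
      then show False using 2 e assms(1) by simp
    qed
    then have "(a, b, f, e) \<in> S0" using P(1,3,6) 2 e fe by (auto simp: S0_def farey_pairs_def)
    moreover have "p = (\<lambda>(a, b, c, d). (a, b, a + c, b + d)) (a, b, f, e)" by (simp add: e f)
    ultimately show ?thesis by blast
  next
    case 3
    have "c \<le> a"
    proof (rule ccontr)
      assume "\<not> c \<le> a"
      then have "a * d \<le> (c - 1) * d" by (intro mult_le_mono1) linarith
      also have "(c - 1) * d = c * d - d" by (simp add: diff_mult_distrib)
      finally have "c * b + d \<le> c * d + 1" using P(6,9) mult_le_mono1[of 1 c d] by (simp; linarith)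
      moreover have "c * (d + 1) \<le> c * b" using 3 by (intro mult_le_mono2) simp
      ultimately have "c + d \<le> 1" by simp
      then show False using P(2,9) by simp
    qed
    then obtain e where e: "a = e + c" by (metis le_add_diff_inverse2)
    obtain f where f: "b = f + d" "0 < f" using 3 by (metis add.commute less_Suc_eq_le less_imp_add_positive)
    have fe: "c * f = e * d + 1" using P(6) by (simp add: e f algebra_simps)
    have "(e, f, c, d) \<in> S0" using P(2,4,7) 3 f fe by (auto simp: S0_def farey_pairs_def)
    moreover have "p = (\<lambda>(a, b, c, d). (a + c, b + d, c, d)) (e, f, c, d)" by (simp add: e f)
    ultimately show ?thesis by blast
  next
    case 4
    have "Suc N dvd c * Suc N - a * Suc N" by (intro dvd_diff_nat dvd_triv_right)
    moreover have "c * Suc N - a * Suc N = 1" using P(6) 4 by simp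
    ultimately have "Suc N dvd 1" by (simp only:)
    then have False using assms(1) by simp
    then show ?thesis ..
  qed
next
  fix p assume "p \<in> (farey_pairs N - S0) \<union>
    ((\<lambda>(a, b, c, d). (a, b, a + c, b + d)) ` S0 \<union> (\<lambda>(a, b, c, d). (a + c, b + d, c, d)) ` S0)"
  then consider "p \<in> farey_pairs N - S0" | a b c d where "(a, b, c, d) \<in> S0" "p = (a, b, a + c, b + d)"
    | a b c d where "(a, b, c, d) \<in> S0" "p = (a + c, b + d, c, d)" by auto
  then show "p \<in> farey_pairs (Suc N)"
  proof cases
    case 1
    then show ?thesis by (auto simp: farey_pairs_def S0_def)
  next
    case (2 a b c d)
    then have "(a, b, c, d) \<in> farey_pairs N" and s: "b + d = Suc N" by (auto simp: S0_def)
    note P = farey_pairsD[OF this(1)]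
    have "(a + c) * b = a * (b + d) + 1" using P(6) by (simp add: algebra_simps)
    then show ?thesis unfolding 2(2) using P s by (auto simp: farey_pairs_def)
  next
    case (3 a b c d)
    then have "(a, b, c, d) \<in> farey_pairs N" and s: "b + d = Suc N" by (auto simp: S0_def)
    note P = farey_pairsD[OF this(1)]
    have "c * (b + d) = (a + c) * d + 1" using P(6) by (simp add: algebra_simps)
    then show ?thesis unfolding 3(2) using P s by (auto simp: farey_pairs_def)
  qed
qed

text \<open>
  Neighbours tile the unit interval. By induction on \<open>N\<close>, since inserting a mediant does not change
  the sum of the two increments.
\<close>

lemma farey_telescope:
  fixes \<Phi> :: "real \<Rightarrow> 'a :: real_vector"
  assumes "N \<ge> 1"
  shows "(\<Sum>(a, b, c, d)\<in>farey_pairs N. \<Phi> (real c / real d) - \<Phi> (real a / real b)) = \<Phi> 1 - \<Phi> 0"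
  using assms
proof (induction N rule: dec_induct)
  case base
  have "p = (0, 1, 1, 1)" if p: "p \<in> farey_pairs 1" for p
  proof -
    obtain a b c d where [simp]: "p = (a, b, c, d)" by (cases p) auto
    note P = farey_pairsD[OF p[simplified \<open>p = _\<close>]]
    have "b = 1" "d = 1" using P(1-4) by linarith+
    then show ?thesis using P(6,7) by simp
  qed
  moreover have "(0, 1, 1, 1) \<in> farey_pairs 1" by (simp add: farey_pairs_def)
  ultimately have "farey_pairs 1 = {(0, 1, 1, 1)}" by blast
  then show ?case by simp
next
  case (step N)
  define S0 where "S0 = {(a, b, c, d) \<in> farey_pairs N. b + d = Suc N}"
  define G where "G = (\<lambda>(a, b, c, d). \<Phi> (real c / real d) - \<Phi> (real a / real b))"
  define l r :: "nat \<times> nat \<times> nat \<times> nat \<Rightarrow> nat \<times> nat \<times> nat \<times> nat" where "l = (\<lambda>(a, b, c, d). (a, b, a + c, b + d))"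
    and "r = (\<lambda>(a, b, c, d). (a + c, b + d, c, d))"
  have sub: "S0 \<subseteq> farey_pairs N" by (auto simp: S0_def)
  have fin: "finite S0" using sub finite_farey_pairs finite_subset by blast
  have "sum G (farey_pairs (Suc N)) = sum G ((farey_pairs N - S0) \<union> (l ` S0 \<union> r ` S0))"
    using farey_pairs_Suc[OF step.hyps(1)] by (simp add: S0_def l_def r_def)
  also have "\<dots> = sum G (farey_pairs N - S0) + (sum G (l ` S0) + sum G (r ` S0))"
  proof -
    have "(farey_pairs N - S0) \<inter> (l ` S0 \<union> r ` S0) = {}"
    proof -
      have "p \<notin> farey_pairs N" if "p \<in> l ` S0 \<union> r ` S0" for p
        using that by (auto simp: l_def r_def S0_def farey_pairs_def)
      then show ?thesis by blast
    qed
    moreover have "l ` S0 \<inter> r ` S0 = {}"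
    proof -
      have False if "(a, b, c, d) \<in> l ` S0" "(a, b, c, d) \<in> r ` S0" for a b c d
      proof -
        have "b \<le> N" using that(1) by (auto simp: l_def S0_def farey_pairs_def)
        moreover have "b = Suc N" using that(2) by (auto simp: r_def S0_def farey_pairs_def)
        ultimately show False by simp
      qed
      then show ?thesis by (intro equals0I) (metis IntE prod_cases4)
    qed
    ultimately show ?thesis using fin finite_farey_pairs by (simp add: sum.union_disjoint)
  qed
  also have "sum G (l ` S0) = (\<Sum>p\<in>S0. G (l p))"
    by (rule sum.reindex_cong[of l]) (auto simp: l_def inj_on_def)
  also have "sum G (r ` S0) = (\<Sum>p\<in>S0. G (r p))"
    by (rule sum.reindex_cong[of r]) (auto simp: r_def inj_on_def)
  also have "(\<Sum>p\<in>S0. G (l p)) + (\<Sum>p\<in>S0. G (r p)) = sum G S0"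
    unfolding sum.distrib[symmetric] by (intro sum.cong refl) (auto simp: G_def l_def r_def)
  also have "sum G (farey_pairs N - S0) + sum G S0 = sum G (farey_pairs N)"
    using sub finite_farey_pairs by (metis sum.subset_diff)
  finally show ?case using step.IH by (simp add: G_def)
qed

lemma unique_in_window:
  fixes d d' N b :: nat
  assumes "int b dvd (int d - int d')" "d \<le> N" "d' \<le> N" "N < b + d" "N < b + d'"
  shows "d = d'"
proof (rule ccontr)
  assume "d \<noteq> d'"
  then have "int b \<le> \<bar>int d - int d'\<bar>" using assms(1) zdvd_imp_le[of "int b" "\<bar>int d - int d'\<bar>"] by auto
  then show False using assms by linarith
qed

lemma exists_in_window:
  fixes x :: int and b N :: nat
  assumes "0 < b" "b \<le> N"
  obtains d :: nat where "d \<le> N" "N < b + d" "0 < d" "int b dvd (int d - x)"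
proof -
  define y where "y = (int N - x) mod int b"
  have y: "0 \<le> y" "y < int b" using assms by (simp_all add: y_def)
  have "int b dvd (int N - x) - y" unfolding y_def by (simp add: dvd_minus_mod)
  then have "int b dvd int (nat (int N - y)) - x"
    using y assms by (simp add: algebra_simps)
  then show thesis using y assms by (intro that[of "nat (int N - y)"]) auto
qed

definition farey_fractions :: "nat \<Rightarrow> (nat \<times> nat) set" where
  "farey_fractions N = {(h, k). 1 \<le> k \<and> k \<le> N \<and> h < k \<and> coprime h k}"

lemma finite_farey_fractions: "finite (farey_fractions N)"
  by (rule finite_subset[of _ "{..N} \<times> {..N}"]) (auto simp: farey_fractions_def)

text \<open>
  The right neighbour of \<open>a/b\<close> has a denominator \<open>d\<close> with \<open>ad \<equiv> -1\<close> modulo \<open>b\<close> in the window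
  \<open>N - b < d \<le> N\<close>, which contains exactly one representative.
\<close>

lemma bij_farey_left:
  "bij_betw (\<lambda>(a, b, c, d). (a, b)) (farey_pairs N) (farey_fractions N)"
proof (rule bij_betw_imageI)
  show "inj_on (\<lambda>(a, b, c, d). (a, b)) (farey_pairs N)"
  proof (rule inj_onI)
    fix p p' assume *: "p \<in> farey_pairs N" "p' \<in> farey_pairs N"
      "(case p of (a, b, c, d) \<Rightarrow> (a, b)) = (case p' of (a, b, c, d) \<Rightarrow> (a, b))"
    obtain a b c d where p1: "p = (a, b, c, d)" by (cases p) auto
    obtain c' d' where p2: "p' = (a, b, c', d')" using *(3) p1 by (cases p') auto
    have p: "(a, b, c, d) \<in> farey_pairs N" "(a, b, c', d') \<in> farey_pairs N" using * p1 p2 by auto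
    note P = farey_pairsD[OF p(1)] and P' = farey_pairsD[OF p(2)]
    have "int c * int b = int a * int d + 1" "int c' * int b = int a * int d' + 1"
      using P(6) P'(6) by (simp_all flip: of_nat_mult of_nat_add add: of_nat_eq_iff)
    then have "int a * (int d - int d') = int b * (int c - int c')" by (simp add: algebra_simps)
    then have "int b dvd int a * (int d - int d')" by simp
    then have "int b dvd (int d - int d')"
      using P(10) by (simp add: coprime_commute coprime_dvd_mult_right_iff)
    then have d: "d = d'" using unique_in_window P(4,5) P'(4,5) by blast
    then have "c * b = c' * b" using P(6) P'(6) by simp
    then show "p = p'" using P(1) d p1 p2 by auto
  qed
  show "(\<lambda>(a, b, c, d). (a, b)) ` farey_pairs N = farey_fractions N"
  proof (intro equalityI subsetI)
    fix p assume "p \<in> (\<lambda>(a, b, c, d). (a, b)) ` farey_pairs N"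
    then show "p \<in> farey_fractions N"
      using farey_pairsD(1,3,8,10) by (fastforce simp: farey_fractions_def)
  next
    fix p assume p: "p \<in> farey_fractions N"
    obtain a b where [simp]: "p = (a, b)" by (cases p)
    have ab: "1 \<le> b" "b \<le> N" "a < b" "coprime a b" using p by (auto simp: farey_fractions_def)
    obtain x where "[int a * x = 1] (mod int b)" using cong_solve_coprime_int[of "int a" "int b"] ab(4) by auto
    then have x: "int b dvd int a * x - 1" by (simp add: cong_iff_dvd_diff)
    obtain d where d: "d \<le> N" "N < b + d" "0 < d" "int b dvd (int d - (- x))"
      using exists_in_window[of b N "- x"] ab by auto
    have "int a * int d + 1 = int a * (int d - (- x)) - (int a * x - 1)" by (simp add: algebra_simps)
    then have "int b dvd int a * int d + 1" using x d(4) by (metis dvd_diff dvd_mult)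
    then have "int b dvd int (a * d + 1)" by (simp add: algebra_simps)
    then have "b dvd a * d + 1" by (simp only: int_dvd_int_iff)
    then obtain c where c: "a * d + 1 = c * b" by (metis dvdE mult.commute)
    have "c * b \<le> d * b"
    proof -
      have "a * d + d \<le> b * d" using ab mult_le_mono1[of "a + 1" b d] by (simp add: algebra_simps)
      then have "c * b \<le> b * d" using c d(3) by linarith
      then show ?thesis by (metis mult.commute)
    qed
    then have "(a, b, c, d) \<in> farey_pairs N" using ab c d by (auto simp: farey_pairs_def)
    then show "p \<in> (\<lambda>(a, b, c, d). (a, b)) ` farey_pairs N" by force
  qed
qed

text \<open>
  The same for left neighbours. Reduction of the numerator identifies \<open>1/1\<close> with \<open>0/1\<close>, as the
  periodicity of the integrand requires.
\<close>

lemma bij_farey_right: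
  "bij_betw (\<lambda>(a, b, c, d). (c mod d, d)) (farey_pairs N) (farey_fractions N)"
proof (rule bij_betw_imageI)
  show "inj_on (\<lambda>(a, b, c, d). (c mod d, d)) (farey_pairs N)"
  proof (rule inj_onI)
    fix p p' assume *: "p \<in> farey_pairs N" "p' \<in> farey_pairs N"
      "(case p of (a, b, c, d) \<Rightarrow> (c mod d, d)) = (case p' of (a, b, c, d) \<Rightarrow> (c mod d, d))"
    obtain a b c d where p1: "p = (a, b, c, d)" by (cases p) auto
    obtain a' b' c' where p2: "p' = (a', b', c', d)" using *(3) p1 by (cases p') auto
    have p: "(a, b, c, d) \<in> farey_pairs N" "(a', b', c', d) \<in> farey_pairs N"
      and m: "c mod d = c' mod d" using * p1 p2 by auto
    note P = farey_pairsD[OF p(1)] and P' = farey_pairsD[OF p(2)]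
    have cc: "c = c'"
      using m P(7,9) P'(7,9) by (cases "c = d"; cases "c' = d") auto
    have "int c * int b = int a * int d + 1" "int c * int b' = int a' * int d + 1"
      using P(6) P'(6) cc by (simp_all flip: of_nat_mult of_nat_add add: of_nat_eq_iff)
    then have "int c * (int b - int b') = int d * (int a - int a')" by (simp add: algebra_simps)
    then have "int d dvd int c * (int b - int b')" by simp
    then have "int d dvd (int b - int b')"
      using P(11) by (simp add: coprime_commute coprime_dvd_mult_right_iff)
    then have b: "b = b'" using unique_in_window[of d b b' N] P(3,5) P'(3,5) by (simp add: add.commute)
    then have "a * d = a' * d" using P(6) P'(6) unfolding cc b by linarith
    then have "a = a'" using P(2) by (metis mult_right_cancel less_not_refl)
    then show "p = p'" using b cc p1 p2 by simp
  qed
  show "(\<lambda>(a, b, c, d). (c mod d, d)) ` farey_pairs N = farey_fractions N"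
  proof (intro equalityI subsetI)
    fix p assume "p \<in> (\<lambda>(a, b, c, d). (c mod d, d)) ` farey_pairs N"
    then obtain a b c d where p: "(a, b, c, d) \<in> farey_pairs N" "p = (c mod d, d)" by auto
    note P = farey_pairsD[OF p(1)]
    have "coprime (c mod d) d" using P(2,11) by (simp add: coprime_mod_left_iff)
    then show "p \<in> farey_fractions N" using P p(2) by (auto simp: farey_fractions_def)
  next
    fix p assume p: "p \<in> farey_fractions N"
    obtain h d where [simp]: "p = (h, d)" by (cases p)
    have hd: "1 \<le> d" "d \<le> N" "h < d" "coprime h d" using p by (auto simp: farey_fractions_def)
    define c where "c = (if h = 0 then 1 else h)"
    have c: "0 < c" "c \<le> d" "c mod d = h" "coprime c d"
      using hd by (auto simp: c_def)
    obtain x where "[int c * x = 1] (mod int d)" using cong_solve_coprime_int[of "int c" "int d"] c(4) by auto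
    then have x: "int d dvd int c * x - 1" by (simp add: cong_iff_dvd_diff)
    obtain b where b: "b \<le> N" "N < d + b" "0 < b" "int d dvd (int b - x)"
      using exists_in_window[of d N x] hd by auto
    have "int c * int b - 1 = int c * (int b - x) + (int c * x - 1)" by (simp add: algebra_simps)
    then have "int d dvd int c * int b - 1" using x b(4) by (metis dvd_add dvd_mult)
    moreover have cb: "1 \<le> c * b" using c b by simp
    ultimately have "int d dvd int (c * b - 1)" by (simp add: of_nat_diff algebra_simps)
    then have "d dvd c * b - 1" by (simp only: int_dvd_int_iff)
    then obtain a where a: "c * b - 1 = a * d" by (metis dvdE mult.commute)
    then have "c * b = a * d + 1" using cb by linarith
    then have "(a, b, c, d) \<in> farey_pairs N" using c hd b by (auto simp: farey_pairs_def)
    then show "p \<in> (\<lambda>(a, b, c, d). (c mod d, d)) ` farey_pairs N" using c(3) by force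
  qed
qed

text \<open>
  The arcs end at the mediants. A mediant of \<open>a/b\<close> and \<open>c/d\<close> has distance \<open>1/(b(b + d))\<close> from
  \<open>a/b\<close>, and \<open>N < b + d \<le> 2N\<close>. The function \<open>\<Phi>\<close> plays the role of a primitive of a function of
  period 1, and \<open>D\<close> is the integral over one period.
\<close>

lemma farey_dissection:
  assumes "N \<ge> 1"
  obtains \<theta> \<theta>' :: "nat \<times> nat \<Rightarrow> real" where
    "\<And>h k. (h, k) \<in> farey_fractions N \<Longrightarrow> 1 / (2 * real k * real N) \<le> \<theta> (h, k) \<and> \<theta> (h, k) \<le> 1 / (real k * real N)"
    "\<And>h k. (h, k) \<in> farey_fractions N \<Longrightarrow> 1 / (2 * real k * real N) \<le> \<theta>' (h, k) \<and> \<theta>' (h, k) \<le> 1 / (real k * real N)"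
    "\<And>(\<Phi> :: real \<Rightarrow> complex) D. (\<And>x. \<Phi> (x + 1) = \<Phi> x + D) \<Longrightarrow>
      (\<Sum>(h, k)\<in>farey_fractions N. \<Phi> (real h / real k + \<theta>' (h, k)) - \<Phi> (real h / real k - \<theta> (h, k))) = D"
proof -
  let ?P = "farey_pairs N" and ?F = "farey_fractions N"
  define l r :: "nat \<times> nat \<times> nat \<times> nat \<Rightarrow> nat \<times> nat" where "l = (\<lambda>(a, b, c, d). (a, b) )"
    and "r = (\<lambda>(a, b, c, d). (c mod d, d) )"
  define w v :: "nat \<times> nat \<times> nat \<times> nat \<Rightarrow> real"
    where "w = (\<lambda>(a, b, c, d). 1 / (real b * real (b + d)))"
      and "v = (\<lambda>(a, b, c, d). 1 / (real d * real (b + d)))"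
  define \<theta> \<theta>' where "\<theta> = (\<lambda>x. v (the_inv_into ?P r x))" and "\<theta>' = (\<lambda>x. w (the_inv_into ?P l x))"
  have l: "bij_betw l ?P ?F" unfolding l_def by (rule bij_farey_left)
  have r: "bij_betw r ?P ?F" unfolding r_def by (rule bij_farey_right)
  have \<theta>: "\<theta> (r p) = v p" if "p \<in> ?P" for p
    using that bij_betw_imp_inj_on[OF r] by (simp add: \<theta>_def the_inv_into_f_f)
  have \<theta>': "\<theta>' (l p) = w p" if "p \<in> ?P" for p
    using that bij_betw_imp_inj_on[OF l] by (simp add: \<theta>'_def the_inv_into_f_f)
  have bound: "1 / (2 * real k * real N) \<le> 1 / (real k * real s) \<and> 1 / (real k * real s) \<le> 1 / (real k * real N)"
    if "0 < k" "N < s" "s \<le> 2 * N" for k s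
  proof
    have "real s \<le> 2 * real N" using that by linarith
    then have "real k * real s \<le> real k * (2 * real N)" using that by (intro mult_left_mono) auto
    then show "1 / (2 * real k * real N) \<le> 1 / (real k * real s)"
      using that assms by (intro divide_left_mono mult_pos_pos) (auto simp: mult_ac)
    show "1 / (real k * real s) \<le> 1 / (real k * real N)"
      using that assms by (intro divide_left_mono mult_left_mono mult_pos_pos) auto
  qed
  \<comment> \<open>The neighbour \<open>1/1\<close> is replaced by \<open>0/1\<close> below, where the periodicity of \<open>\<Phi>\<close> enters.\<close>
  show thesis
  proof (rule that[of \<theta> \<theta>'])
    fix h k assume "(h, k) \<in> ?F"
    then obtain p where p: "p \<in> ?P" "r p = (h, k)" using bij_betw_imp_surj_on[OF r] by (metis imageE)
    obtain a b c d where [simp]: "p = (a, b, c, d)" by (cases p) auto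
    have "k = d" using p(2) by (simp add: r_def)
    then show "1 / (2 * real k * real N) \<le> \<theta> (h, k) \<and> \<theta> (h, k) \<le> 1 / (real k * real N)"
      using \<theta>[OF p(1)] bound[of d "b + d"] farey_pairsD[OF p(1)[simplified]] unfolding p(2) by (simp add: v_def)
  next
    fix h k assume "(h, k) \<in> ?F"
    then obtain p where p: "p \<in> ?P" "l p = (h, k)" using bij_betw_imp_surj_on[OF l] by (metis imageE)
    obtain a b c d where [simp]: "p = (a, b, c, d)" by (cases p) auto
    have "k = b" using p(2) by (simp add: l_def)
    then show "1 / (2 * real k * real N) \<le> \<theta>' (h, k) \<and> \<theta>' (h, k) \<le> 1 / (real k * real N)"
      using \<theta>'[OF p(1)] bound[of b "b + d"] farey_pairsD[OF p(1)[simplified]] unfolding p(2) by (simp add: w_def)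
  next
    fix \<Phi> :: "real \<Rightarrow> complex" and D
    assume per: "\<And>x. \<Phi> (x + 1) = \<Phi> x + D"
    define gl where "gl = (\<lambda>(h, k). \<Phi> (real h / real k + \<theta>' (h, k)) - \<Phi> (real h / real k))"
    define gr where "gr = (\<lambda>(h, k). \<Phi> (real h / real k) - \<Phi> (real h / real k - \<theta> (h, k)))"
    have "(\<Sum>(h, k)\<in>?F. \<Phi> (real h / real k + \<theta>' (h, k)) - \<Phi> (real h / real k - \<theta> (h, k))) =
        (\<Sum>x\<in>?F. gl x) + (\<Sum>x\<in>?F. gr x)"
      unfolding sum.distrib[symmetric] by (intro sum.cong refl) (auto simp: gl_def gr_def)
    also have "(\<Sum>x\<in>?F. gl x) = (\<Sum>p\<in>?P. gl (l p))" by (rule sum.reindex_bij_betw[OF l, symmetric])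
    also have "(\<Sum>x\<in>?F. gr x) = (\<Sum>p\<in>?P. gr (r p))" by (rule sum.reindex_bij_betw[OF r, symmetric])
    also have "(\<Sum>p\<in>?P. gl (l p)) + (\<Sum>p\<in>?P. gr (r p)) =
       (\<Sum>(a, b, c, d)\<in>?P. \<Phi> (real c / real d) - \<Phi> (real a / real b))"
      unfolding sum.distrib[symmetric]
    proof (intro sum.cong refl)
      fix p assume p: "p \<in> ?P"
      obtain a b c d where [simp]: "p = (a, b, c, d)" by (cases p) auto
      note P = farey_pairsD[OF p[simplified]]
      have "real c * real b = real a * real d + 1" using P(6) by (metis of_nat_1 of_nat_add of_nat_mult)
      then have e: "real a * real (b + d) + 1 = real (a + c) * real b" "real c * real (b + d) - 1 = real (a + c) * real d"
        by (simp_all add: algebra_simps)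
      have "real a / real b + w p = (real a * real (b + d) + 1) / (real b * real (b + d))"
        "real c / real d - v p = (real c * real (b + d) - 1) / (real d * real (b + d))"
        using P(1,2) by (simp_all only: w_def v_def \<open>p = _\<close> prod.case) (simp_all add: add_divide_distrib diff_divide_distrib)
      then have med: "real a / real b + w p = real (a + c) / real (b + d)" "real c / real d - v p = real (a + c) / real (b + d)"
        unfolding e using P(1,2) by simp_all
      have "gl (l p) = \<Phi> (real (a + c) / real (b + d)) - \<Phi> (real a / real b)"
        using \<theta>'[OF p] med(1) by (simp add: gl_def l_def)
      moreover have "gr (r p) = \<Phi> (real c / real d) - \<Phi> (real (a + c) / real (b + d))"
      proof (cases "c = d")
        case True
        have "gr (r p) = (\<Phi> 0 + D) - (\<Phi> (- v p) + D)"
          using \<theta>[OF p] True by (simp add: gr_def r_def)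
        moreover have "\<Phi> 0 + D = \<Phi> (real c / real d)" using per[of 0] True P(2) by simp
        moreover have "\<Phi> (- v p) + D = \<Phi> (real c / real d - v p)"
          using per[of "- v p"] True P(2) by (simp add: add.commute)
        ultimately show ?thesis by (simp only: med(2))
      next
        case False
        then have "c mod d = c" using P(7) by simp
        then show ?thesis using \<theta>[OF p] med(2) by (simp add: gr_def r_def)
      qed
      ultimately show "gl (l p) + gr (r p) = (case p of (a, b, c, d) \<Rightarrow> \<Phi> (real c / real d) - \<Phi> (real a / real b))"
        by simp
    qed
    also have "\<dots> = D" using farey_telescope[OF assms, of \<Phi>] per[of 0] by simp
    finally show "(\<Sum>(h, k)\<in>?F. \<Phi> (real h / real k + \<theta>' (h, k)) - \<Phi> (real h / real k - \<theta> (h, k))) = D" .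
  qed
qed

section \<open>The integral over an arc and the Bessel function\<close>

lemma higher_deriv_exp_mult: "(deriv ^^ k) (\<lambda>z. exp (a * z)) = (\<lambda>z. a ^ k * exp (a * z :: complex))"
proof (induction k)
  case (Suc k)
  have "deriv (\<lambda>z. a ^ k * exp (a * z)) z = a ^ Suc k * exp (a * z)" for z
    by (rule DERIV_imp_deriv) (auto intro!: derivative_eq_intros)
  then show ?case using Suc by auto
qed simp

text \<open>
  The series of \<open>exp (b/z)\<close> converges uniformly on the circle; the term with \<open>z\<^sup>-\<^sup>j\<^sup>-\<^sup>1\<close> picks the \<open>j\<close>-th
  derivative of \<open>exp (az)\<close> at 0.
\<close>

lemma contour_integral_circle_exp:
  fixes a b :: complex
  shows "(\<lambda>j. 2 * of_real pi * \<i> * (a ^ j * b ^ Suc j / (fact j * fact (Suc j)))) sums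
     contour_integral (circlepath 0 1) (\<lambda>z. exp (a * z + b / z))"
proof -
  define f where "f = (\<lambda>n z. exp (a * z) * ((b / z) ^ n / fact n))"
  define c where "c = (\<lambda>n. contour_integral (circlepath 0 1) (f n))"
  have int: "f n contour_integrable_on circlepath 0 1" for n
    unfolding f_def by (intro contour_integrable_continuous_circlepath continuous_intros) auto
  have ul: "uniform_limit (sphere 0 1) (\<lambda>N z. \<Sum>n<N. f n z) (\<lambda>z. \<Sum>n. f n z) sequentially"
  proof (rule Weierstrass_m_test)
    fix n z assume "z \<in> sphere (0::complex) 1"
    then have z: "norm z = 1" by simp
    have "norm (f n z) = norm (exp (a * z)) * (norm b ^ n / fact n)"
      using z by (simp add: f_def norm_mult norm_divide norm_power)
    also have "\<dots> \<le> exp (norm a) * (norm b ^ n / fact n)"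
      using norm_exp[of "a * z"] z by (intro mult_right_mono) (auto simp: norm_mult)
    finally show "norm (f n z) \<le> exp (norm a) * (norm b ^ n / fact n)" .
  next
    show "summable (\<lambda>n. exp (norm a) * (norm b ^ n / fact n))"
      using summable_exp[of "norm b"] by (intro summable_mult) (simp add: field_simps)
  qed
  have lim: "(\<Sum>n. f n z) = exp (a * z + b / z)" for z
  proof -
    have "(\<lambda>n. (b / z) ^ n / fact n) sums exp (b / z)"
      using exp_converges[of "b / z"] by (simp add: scaleR_conv_of_real divide_inverse mult.commute)
    then have "f' sums (exp (a * z) * exp (b / z))" if "f' = (\<lambda>n. f n z)" for f'
      unfolding that f_def by (rule sums_mult)
    then show ?thesis by (simp add: exp_add sums_iff)
  qed
  have "(\<lambda>N. contour_integral (circlepath 0 1) (\<lambda>z. \<Sum>n<N. f n z)) \<longlonglongrightarrow>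
      contour_integral (circlepath 0 1) (\<lambda>z. \<Sum>n. f n z)"
    by (rule contour_integral_uniform_limit_circlepath[OF _ ul]) (auto intro!: always_eventually contour_integrable_sum int)
  moreover have "contour_integral (circlepath 0 1) (\<lambda>z. \<Sum>n<N. f n z) = (\<Sum>n<N. c n)" for N
    unfolding c_def by (intro contour_integral_sum int) auto
  ultimately have c: "c sums contour_integral (circlepath 0 1) (\<lambda>z. exp (a * z + b / z))"
    by (simp add: sums_def lim)
  \<comment> \<open>The term without a pole integrates to 0.\<close>
  have c0: "c 0 = 0"
  proof -
    have "((\<lambda>z. exp (a * z)) has_contour_integral 0) (circlepath 0 1)"
      by (rule Cauchy_theorem_disc_simple[of _ 0 2]) (auto intro!: holomorphic_intros)
    then show ?thesis by (simp add: c_def f_def contour_integral_unique)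
  qed
  have cS: "c (Suc j) = 2 * of_real pi * \<i> * (a ^ j * b ^ Suc j / (fact j * fact (Suc j)))" for j
  proof -
    have "((\<lambda>u. exp (a * u) / (u - 0) ^ Suc j) has_contour_integral (2 * pi * \<i> / fact j * (deriv ^^ j) (\<lambda>z. exp (a * z)) 0)) (circlepath 0 1)"
      by (rule Cauchy_has_contour_integral_higher_derivative_circlepath) (auto intro!: holomorphic_intros continuous_intros)
    from has_contour_integral_lmul[OF this, of "b ^ Suc j / fact (Suc j)"]
    have "((\<lambda>u. b ^ Suc j / fact (Suc j) * (exp (a * u) / u ^ Suc j)) has_contour_integral
       b ^ Suc j / fact (Suc j) * (2 * pi * \<i> / fact j * a ^ j)) (circlepath 0 1)"
      by (simp add: higher_deriv_exp_mult del: power_Suc fact_Suc)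
    moreover have "(\<lambda>u. b ^ Suc j / fact (Suc j) * (exp (a * u) / u ^ Suc j)) = f (Suc j)"
      by (rule ext) (simp add: f_def power_divide mult_ac del: power_Suc fact_Suc)
    ultimately have "c (Suc j) = b ^ Suc j / fact (Suc j) * (2 * pi * \<i> / fact j * a ^ j)"
      unfolding c_def using contour_integral_unique by metis
    then show ?thesis by (simp add: mult_ac del: power_Suc fact_Suc)
  qed
  have "(\<lambda>j. c (Suc j)) sums contour_integral (circlepath 0 1) (\<lambda>z. exp (a * z + b / z))"
    using c c0 by (simp add: sums_Suc_iff)
  then show ?thesis by (simp only: cS)
qed

text \<open>
  The series of the Bessel function of order \<open>-1\<close> starts effectively at its second term, because the
  reciprocal Gamma function vanishes at 0. This shift matches it with the residue series.
\<close>

lemma contour_integral_circle_bessel: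
  fixes a b :: real
  assumes "a > 0" "b > 0"
  shows "contour_integral (circlepath 0 1) (\<lambda>z. exp (of_real a * z + of_real b / z)) =
    2 * of_real pi * \<i> * of_real (sqrt (b / a) * bessel_I (- 1) (2 * sqrt (a * b)))"
proof -
  let ?C = "contour_integral (circlepath 0 1) (\<lambda>z. exp (of_real a * z + of_real b / z))"
  define s where "s = (\<lambda>j. a ^ j * b ^ Suc j / (fact j * fact (Suc j)))"
  have "(\<lambda>j. 2 * of_real pi * \<i> * complex_of_real (s j)) sums ?C"
    using contour_integral_circle_exp[of "of_real a" "of_real b"] by (simp add: s_def del: fact_Suc power_Suc)
  from sums_mult[OF this, of "1 / (2 * of_real pi * \<i>)"]
  have 1: "(\<lambda>j. complex_of_real (s j)) sums (?C / (2 * of_real pi * \<i>))" by simp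
  then have s: "s sums Re (?C / (2 * of_real pi * \<i>))" using sums_Re by fastforce
  then have "(\<lambda>j. complex_of_real (s j)) sums of_real (Re (?C / (2 * of_real pi * \<i>)))"
    by (rule sums_of_real)
  with 1 have "?C / (2 * of_real pi * \<i>) = of_real (Re (?C / (2 * of_real pi * \<i>)))"
    by (rule sums_unique2)
  then have C: "?C = 2 * of_real pi * \<i> * of_real (Re (?C / (2 * of_real pi * \<i>)))"
    by (simp add: field_simps)
  define x where "x = sqrt (a * b)"
  have x: "x > 0" "x\<^sup>2 = a * b" using assms by (simp_all add: x_def)
  define t where "t = (\<lambda>k::nat. rGamma (real k + (- 1) + 1) / fact k * x powr (2 * real k + (- 1)))"
  have t0: "t 0 = 0" by (simp add: t_def)
  have tS: "t (Suc j) = x / b * s j" for j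
  proof -
    have "x powr (2 * real (Suc j) + (- 1)) = x powr (real (2 * j + 1))" by simp
    also have "\<dots> = x ^ (2 * j + 1)" using x(1) by (rule powr_realpow)
    also have "\<dots> = (x\<^sup>2) ^ j * x" by (simp add: power_mult power_add)
    finally have p: "x powr (2 * real (Suc j) + (- 1)) = (a * b) ^ j * x" by (simp add: x(2))
    have "rGamma (real (Suc j) + (- 1) + 1) = 1 / fact j"
      using Gamma_fact[of j, where 'a = real] by (simp add: rGamma_inverse_Gamma add.commute inverse_eq_divide)
    then show ?thesis using assms p by (simp add: t_def s_def power_mult_distrib field_simps del: fact_Suc)
  qed
  have "(\<lambda>j. t (Suc j)) sums (x / b * Re (?C / (2 * of_real pi * \<i>)))"
    unfolding tS by (rule sums_mult[OF s])
  then have "t sums (x / b * Re (?C / (2 * of_real pi * \<i>)))" using t0 by (simp add: sums_Suc_iff)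
  moreover have "bessel_I (- 1) (2 * x) = (\<Sum>k. t k)" by (simp add: bessel_I_def t_def)
  ultimately have "bessel_I (- 1) (2 * x) = x / b * Re (?C / (2 * of_real pi * \<i>))"
    using sums_unique by metis
  moreover have "sqrt (b / a) * (x / b) = 1"
    using assms by (simp add: x_def real_sqrt_divide real_sqrt_mult)
  ultimately have "sqrt (b / a) * bessel_I (- 1) (2 * x) = Re (?C / (2 * of_real pi * \<i>))"
    by (simp add: mult.assoc[symmetric])
  then show ?thesis using C unfolding x_def by simp
qed

lemma contour_integral_rectpath_eq_circle:
  assumes "f holomorphic_on (- {0})" "Re p < 0" "Im p < 0" "Re q > 0" "Im q > 0"
  shows "contour_integral (rectpath p q) f = contour_integral (circlepath 0 1) f"
proof -
  have box: "0 \<in> box p q" using assms by (simp add: in_box_complex_iff)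
  have "contour_integral (rectpath p q) f = 2 * pi * \<i> * (\<Sum>z\<in>{0}. winding_number (rectpath p q) z * residue f z)"
  proof (rule Residue_theorem)
    show "f holomorphic_on UNIV - {0}" using assms(1) by (simp add: Compl_eq_Diff_UNIV)
    show "path_image (rectpath p q) \<subseteq> UNIV - {0}"
      using path_image_rectpath_cbox_minus_box[of p q] box assms by auto
  qed auto
  moreover have "contour_integral (circlepath 0 1) f = 2 * pi * \<i> * (\<Sum>z\<in>{0}. winding_number (circlepath 0 1) z * residue f z)"
    by (rule Residue_theorem[of UNIV]) (use assms(1) in \<open>auto simp: Compl_eq_Diff_UNIV\<close>)
  ultimately show ?thesis using winding_number_rectpath[OF box] by (simp add: winding_number_circlepath)
qed

text \<open>
  The arc is the right side of a rectangle around 0. On the left side both \<open>Re z\<close> and \<open>Re (1/z)\<close>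
  are negative and the integrand is at most 1 in absolute value. On the horizontal sides, which have
  length \<open>2\<rho>\<close>, it is at most \<open>exp B\<close>.
\<close>

lemma integral_exp_near_cusp:
  fixes a b \<rho> \<theta> \<theta>' B :: real
  assumes ab: "a > 0" "b > 0" and \<rho>: "\<rho> > 0" and \<theta>: "\<theta> > 0" "\<theta>' > 0"
    and B: "a * \<rho> + b * \<rho> / \<theta>\<^sup>2 \<le> B" "a * \<rho> + b * \<rho> / \<theta>'\<^sup>2 \<le> B"
  shows "norm (integral {-\<theta>..\<theta>'} (\<lambda>x. exp (of_real a * Complex \<rho> (- x) + of_real b / Complex \<rho> (- x))) -
     of_real (2 * pi * (sqrt (b / a) * bessel_I (- 1) (2 * sqrt (a * b))))) \<le> \<theta> + \<theta>' + 4 * \<rho> * exp B"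
proof -
  define f where "f = (\<lambda>z. exp (of_real a * z + of_real b / z) :: complex)"
  define p q where "p = Complex (- \<rho>) (- \<theta>')" and "q = Complex \<rho> \<theta>"
  define p' q' where "p' = Complex \<rho> (- \<theta>')" and "q' = Complex (- \<rho>) \<theta>"
  have hol: "f holomorphic_on (- {0})" unfolding f_def by (intro holomorphic_intros) auto
  have nf: "norm (f z) = exp (a * Re z + b * (Re z / ((Re z)\<^sup>2 + (Im z)\<^sup>2)))" for z
    by (simp add: f_def Re_divide)
  have seg: "0 \<notin> closed_segment p p'" "0 \<notin> closed_segment p' q" "0 \<notin> closed_segment q q'" "0 \<notin> closed_segment q' p"
    using \<rho> \<theta> by (auto simp: p_def q_def p'_def q'_def closed_segment_same_Re closed_segment_same_Im)
  have ci: "f contour_integrable_on linepath u v" if "0 \<notin> closed_segment u v" for u v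
    by (intro contour_integrable_continuous_linepath holomorphic_on_imp_continuous_on holomorphic_on_subset[OF hol])
      (use that in auto)
  note ci = ci[OF seg(1)] ci[OF seg(2)] ci[OF seg(3)] ci[OF seg(4)]
  have "contour_integral (rectpath p q) f = contour_integral (linepath p p') f + (contour_integral (linepath p' q) f
     + (contour_integral (linepath q q') f + contour_integral (linepath q' p) f))"
    using ci by (simp add: rectpath_def Let_def p_def q_def p'_def q'_def contour_integrable_joinI)
  also have "contour_integral (rectpath p q) f = contour_integral (circlepath 0 1) f"
    by (rule contour_integral_rectpath_eq_circle[OF hol]) (use \<rho> \<theta> in \<open>auto simp: p_def q_def\<close>)
  also have "\<dots> = 2 * of_real pi * \<i> * of_real (sqrt (b / a) * bessel_I (- 1) (2 * sqrt (a * b)))"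
    unfolding f_def by (rule contour_integral_circle_bessel[OF ab])
  also have "contour_integral (linepath p' q) f = \<i> * integral {-\<theta>'..\<theta>} (\<lambda>y. f (Complex \<rho> y))"
    by (rule contour_integral_linepath_same_Re) (use \<theta> in \<open>auto simp: p'_def q_def\<close>)
  \<comment> \<open>The arc is parametrised by \<open>x = - Im z\<close>, against the direction of the contour.\<close>
  also have "integral {-\<theta>'..\<theta>} (\<lambda>y. f (Complex \<rho> y)) = integral {-\<theta>..\<theta>'} (\<lambda>x. f (Complex \<rho> (- x)))"
    using Henstock_Kurzweil_Integration.integral_reflect_real[of \<theta> "- \<theta>'" "\<lambda>y. f (Complex \<rho> y)"]
    by (simp only: minus_minus)
  finally have "\<i> * (integral {-\<theta>..\<theta>'} (\<lambda>x. f (Complex \<rho> (- x))) - of_real (2 * pi * (sqrt (b / a) * bessel_I (- 1) (2 * sqrt (a * b))))) =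
     - (contour_integral (linepath p p') f + contour_integral (linepath q q') f + contour_integral (linepath q' p) f)"
    (is "\<i> * ?X = _")
    by (simp add: algebra_simps)
  then have "norm ?X = norm (contour_integral (linepath p p') f + contour_integral (linepath q q') f + contour_integral (linepath q' p) f)"
    by (metis norm_minus_cancel norm_mult norm_ii mult_1)
  also have "\<dots> \<le> norm (contour_integral (linepath p p') f) + norm (contour_integral (linepath q q') f) + norm (contour_integral (linepath q' p) f)"
    by (meson add_mono norm_triangle_ineq order_refl order_trans)
  also have "\<dots> \<le> 2 * \<rho> * exp B + 2 * \<rho> * exp B + (\<theta> + \<theta>')"
  proof (intro add_mono)
    have hor: "norm (f z) \<le> exp B" if "\<bar>Re z\<bar> \<le> \<rho>" "\<bar>Im z\<bar> = t" "t > 0" "a * \<rho> + b * \<rho> / t\<^sup>2 \<le> B" for z t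
    proof -
      have "Re z / ((Re z)\<^sup>2 + (Im z)\<^sup>2) \<le> \<rho> / ((Re z)\<^sup>2 + (Im z)\<^sup>2)"
        using that(1) by (intro divide_right_mono) auto
      also have "\<dots> \<le> \<rho> / t\<^sup>2"
      proof -
        have "(Im z)\<^sup>2 = t\<^sup>2" using that(2) by (metis power2_abs)
        moreover have "t\<^sup>2 > 0" using that(3) by simp
        ultimately have "0 < ((Re z)\<^sup>2 + (Im z)\<^sup>2) * t\<^sup>2" "t\<^sup>2 \<le> (Re z)\<^sup>2 + (Im z)\<^sup>2"
          by (simp_all add: add_nonneg_pos)
        then show ?thesis using \<rho> by (intro divide_left_mono) auto
      qed
      finally have "b * (Re z / ((Re z)\<^sup>2 + (Im z)\<^sup>2)) \<le> b * (\<rho> / t\<^sup>2)" using ab by (intro mult_left_mono) auto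
      moreover have "a * Re z \<le> a * \<rho>" using that(1) ab by (intro mult_left_mono) auto
      ultimately show ?thesis using that(4) unfolding nf by simp
    qed
    have "norm (contour_integral (linepath p p') f) \<le> exp B * norm (p' - p)"
    proof (rule contour_integral_bound_linepath[OF ci(1)])
      fix x assume "x \<in> closed_segment p p'"
      then show "norm (f x) \<le> exp B" using \<rho> \<theta> B(2)
        by (intro hor[of x \<theta>']) (auto simp: p_def p'_def closed_segment_same_Im closed_segment_eq_real_ivl)
    qed simp
    also have "p' - p = of_real (2 * \<rho>)" by (simp add: p_def p'_def complex_eq_iff)
    finally show "norm (contour_integral (linepath p p') f) \<le> 2 * \<rho> * exp B" using \<rho> by (simp add: mult_ac)
    have "norm (contour_integral (linepath q q') f) \<le> exp B * norm (q' - q)"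
    proof (rule contour_integral_bound_linepath[OF ci(3)])
      fix x assume "x \<in> closed_segment q q'"
      then show "norm (f x) \<le> exp B" using \<rho> \<theta> B(1)
        by (intro hor[of x \<theta>]) (auto simp: q_def q'_def closed_segment_same_Im closed_segment_eq_real_ivl)
    qed simp
    also have "q' - q = of_real (- 2 * \<rho>)" by (simp add: q_def q'_def complex_eq_iff)
    finally show "norm (contour_integral (linepath q q') f) \<le> 2 * \<rho> * exp B" using \<rho> by (simp add: mult_ac)
    have "norm (contour_integral (linepath q' p) f) \<le> 1 * norm (p - q')"
    proof (rule contour_integral_bound_linepath[OF ci(4)])
      fix x assume "x \<in> closed_segment q' p"
      then have "Re x = - \<rho>" by (auto simp: q'_def p_def closed_segment_same_Re)
      moreover have "0 \<le> b * \<rho> / (\<rho>\<^sup>2 + (Im x)\<^sup>2)" "0 \<le> a * \<rho>" using \<rho> ab by auto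
      then have "- (a * \<rho>) \<le> b * \<rho> / (\<rho>\<^sup>2 + (Im x)\<^sup>2)" by linarith
      ultimately show "norm (f x) \<le> 1" unfolding nf by simp
    qed simp
    also have "p - q' = - (of_real (\<theta> + \<theta>') * \<i>)" by (simp add: p_def q'_def complex_eq_iff)
    also have "1 * norm (- (of_real (\<theta> + \<theta>') * \<i>)) = \<theta> + \<theta>'"
      using \<theta> by (simp only: norm_minus_cancel norm_mult norm_of_real norm_ii) simp
    finally show "norm (contour_integral (linepath q' p) f) \<le> \<theta> + \<theta>'" .
  qed
  finally show ?thesis unfolding f_def by (simp add: algebra_simps)
qed

section \<open>Uniform estimates for products close to 1\<close>

text \<open>
  \<open>F = 1 + O(t)\<close> uniformly on \<open>I\<close>. The index runs over all cusps and all points of their arcs, so the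
  implied constant may not depend on them.
\<close>

definition near_one :: "'i set \<Rightarrow> ('i \<Rightarrow> real) \<Rightarrow> ('i \<Rightarrow> complex) \<Rightarrow> bool" where
  "near_one I t F \<longleftrightarrow> (\<exists>K\<ge>0. \<forall>i\<in>I. norm (F i - 1) \<le> K * t i)"

lemma near_one_1 [simp]: "near_one I t (\<lambda>_. 1)"
  unfolding near_one_def by (auto intro!: exI[of _ 0])

lemma near_one_mult:
  assumes "near_one I t F" "near_one I t G" and t: "\<And>i. i \<in> I \<Longrightarrow> 0 \<le> t i \<and> t i \<le> 1"
  shows "near_one I t (\<lambda>i. F i * G i)"
proof -
  obtain K L where K: "K \<ge> 0" "\<And>i. i \<in> I \<Longrightarrow> norm (F i - 1) \<le> K * t i"
    and L: "L \<ge> 0" "\<And>i. i \<in> I \<Longrightarrow> norm (G i - 1) \<le> L * t i"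
    using assms(1,2) unfolding near_one_def by blast
  have "norm (F i * G i - 1) \<le> (K * (1 + L) + L) * t i" if i: "i \<in> I" for i
  proof -
    have "F i * G i - 1 = (F i - 1) * G i + (G i - 1)" by (simp add: algebra_simps)
    then have "norm (F i * G i - 1) \<le> norm (F i - 1) * norm (G i) + norm (G i - 1)"
      by (metis norm_mult norm_triangle_ineq)
    also have "\<dots> \<le> (K * t i) * (1 + L) + L * t i"
    proof (intro add_mono mult_mono K(2) L(2) i)
      have "norm (G i) \<le> norm (G i - 1) + norm (1 :: complex)"
        by (metis diff_add_cancel norm_triangle_ineq)
      moreover have "L * t i \<le> L" using L(1) t[OF i] by (simp add: mult_left_le)
      ultimately show "norm (G i) \<le> 1 + L" using L(2)[OF i] by simp
    qed (use K(1) t[OF i] in auto)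
    finally show ?thesis by (simp add: algebra_simps)
  qed
  moreover have "K * (1 + L) + L \<ge> 0" using K(1) L(1) by simp
  ultimately show ?thesis unfolding near_one_def by blast
qed

lemma near_one_power:
  assumes "near_one I t F" and t: "\<And>i. i \<in> I \<Longrightarrow> 0 \<le> t i \<and> t i \<le> 1"
  shows "near_one I t (\<lambda>i. F i ^ n)"
  by (induction n) (use near_one_mult[OF assms(1) _ t] in auto)

lemma near_one_inverse:
  assumes "near_one I t F" and \<kappa>: "\<kappa> > 0" "\<And>i. i \<in> I \<Longrightarrow> norm (F i) \<ge> \<kappa>"
  shows "near_one I t (\<lambda>i. inverse (F i))"
proof -
  obtain K where K: "K \<ge> 0" "\<And>i. i \<in> I \<Longrightarrow> norm (F i - 1) \<le> K * t i"
    using assms(1) unfolding near_one_def by blast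
  have "norm (inverse (F i) - 1) \<le> (K / \<kappa>) * t i" if i: "i \<in> I" for i
  proof -
    have F: "F i \<noteq> 0" using \<kappa>(1) \<kappa>(2)[OF i] by auto
    have "norm (inverse (F i) - 1) = norm ((1 - F i) / F i)" using F by (simp add: field_simps)
    also have "\<dots> = norm (F i - 1) / norm (F i)" by (simp add: norm_divide norm_minus_commute)
    also have "\<dots> \<le> (K * t i) / \<kappa>" using order_trans[OF norm_ge_zero K(2)[OF i]] K(2)[OF i] \<kappa>(1) \<kappa>(2)[OF i] by (intro frac_le) auto
    finally show ?thesis by simp
  qed
  moreover have "K / \<kappa> \<ge> 0" using K(1) \<kappa>(1) by simp
  ultimately show ?thesis unfolding near_one_def by blast
qed

lemma near_one_powi:
  assumes "near_one I t F" and "\<kappa> > 0" "\<And>i. i \<in> I \<Longrightarrow> norm (F i) \<ge> \<kappa>"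
    and t: "\<And>i. i \<in> I \<Longrightarrow> 0 \<le> t i \<and> t i \<le> 1"
  shows "near_one I t (\<lambda>i. F i powi n)"
  unfolding power_int_def
  by (cases "n \<ge> 0") (simp_all add: near_one_power near_one_inverse[OF assms(1-3)] assms(1) t)

lemma near_one_prod:
  assumes "\<And>j. j \<in> A \<Longrightarrow> near_one I t (F j)" and t: "\<And>i. i \<in> I \<Longrightarrow> 0 \<le> t i \<and> t i \<le> 1"
  shows "near_one I t (\<lambda>i. \<Prod>j\<in>A. F j i)"
  using assms(1)
proof (induction A rule: infinite_finite_induct)
  case (insert j A)
  then show ?case using near_one_mult[of I t "F j" "\<lambda>i. \<Prod>j\<in>A. F j i"] t by simp
qed auto

lemma qpoch_lower_bound:
  assumes c: "0 \<le> c" "c < 1" and "norm a \<le> c" "norm q \<le> c"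
  shows "norm (qpoch a q) \<ge> norm (qpoch (of_real c) (of_real c))"
proof -
  have q: "norm q < 1" using assms by linarith
  have "norm (\<Prod>k<n. 1 - of_real c * of_real c ^ k :: complex) \<le> norm (\<Prod>k<n. 1 - a * q ^ k)" for n
    unfolding prod_norm[symmetric]
  proof (intro prod_mono conjI)
    fix k
    have "norm a * norm q ^ k \<le> c * c ^ k" using assms by (intro mult_mono power_mono) auto
    moreover have "c * c ^ k \<le> 1" using c power_le_one[of c "Suc k"] by simp
    moreover have "norm (1 - of_real c * of_real c ^ k :: complex) = \<bar>1 - c * c ^ k\<bar>"
      by (metis norm_of_real of_real_1 of_real_diff of_real_mult of_real_power)
    moreover have "1 - norm (a * q ^ k) \<le> norm (1 - a * q ^ k)"
      using norm_triangle_ineq2[of 1 "a * q ^ k"] by simp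
    ultimately show "norm (1 - of_real c * of_real c ^ k :: complex) \<le> norm (1 - a * q ^ k)"
      by (simp add: norm_mult norm_power)
  qed auto
  moreover have "(\<lambda>n. norm (\<Prod>k<n. 1 - of_real c * of_real c ^ k :: complex)) \<longlonglongrightarrow> norm (qpoch (of_real c) (of_real c))"
    by (intro tendsto_norm qpoch_tendsto) (use c in auto)
  moreover have "(\<lambda>n. norm (\<Prod>k<n. 1 - a * q ^ k)) \<longlonglongrightarrow> norm (qpoch a q)"
    by (intro tendsto_norm qpoch_tendsto q)
  ultimately show ?thesis by (meson LIMSEQ_le)
qed

text \<open>
  If \<open>a\<close> and \<open>q\<close> stay in a disc of radius \<open>c < 1\<close>, then \<open>(a; q)\<^sub>\<infinity>\<close> is \<open>1 + O(a)\<close> and is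
  bounded away from 0 by \<open>(c; c)\<^sub>\<infinity>\<close>, which permits negative exponents.
\<close>

lemma near_one_qpoch:
  assumes c: "0 \<le> c" "c < 1"
    and A: "\<And>i. i \<in> I \<Longrightarrow> norm (A i) \<le> c \<and> norm (A i) \<le> t i" and q: "\<And>i. i \<in> I \<Longrightarrow> norm (q i) \<le> c"
    and t: "\<And>i. i \<in> I \<Longrightarrow> 0 \<le> t i \<and> t i \<le> 1"
  shows "near_one I t (\<lambda>i. qpoch (A i) (q i) powi n)"
proof (rule near_one_powi[OF _ _ _ t])
  have "norm (of_real c :: complex) < 1" using c by simp
  then show "norm (qpoch (of_real c) (of_real c)) > 0" using qpoch_nonzero by simp
  show "norm (qpoch (A i) (q i)) \<ge> norm (qpoch (of_real c) (of_real c))" if "i \<in> I" for i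
    using A[OF that] q[OF that] c by (intro qpoch_lower_bound) auto
  have "norm (qpoch (A i) (q i) - 1) \<le> (exp (1 / (1 - c)) / (1 - c)) * t i" if i: "i \<in> I" for i
  proof -
    define x where "x = norm (A i) / (1 - c)"
    have x: "0 \<le> x" "x \<le> 1 / (1 - c)" using A[OF i] c by (auto simp: x_def intro!: divide_right_mono)
    have "norm (qpoch (A i) (q i) - 1) \<le> exp x - 1"
      unfolding x_def using q[OF i] c by (intro norm_qpoch_minus_1_le) auto
    also have "\<dots> \<le> x * exp x"
    proof -
      have "(1 - x) * exp x \<le> exp (- x) * exp x" using exp_ge_add_one_self[of "- x"] by (intro mult_right_mono) auto
      also have "\<dots> = 1" by (simp add: exp_minus)
      finally show ?thesis by (simp add: algebra_simps)
    qed
    also have "\<dots> \<le> (t i / (1 - c)) * exp (1 / (1 - c))"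
      using x A[OF i] c t[OF i] unfolding x_def by (intro mult_mono divide_right_mono) auto
    finally show ?thesis by (simp add: mult_ac)
  qed
  moreover have "exp (1 / (1 - c)) / (1 - c) \<ge> 0" using c by simp
  ultimately show "near_one I t (\<lambda>i. qpoch (A i) (q i))" unfolding near_one_def by blast
qed

section \<open>A factor near a cusp, uniformly in the cusp\<close>

lemma lam_star_bounds: "0 \<le> lam_star m r h k" "lam_star m r h k < 1"
  unfolding lam_star_def lam_def by linarith+

lemma lam_star_times_gcd:
  assumes "k > 0"
  shows "lam_star m r h k * real (gcd m k) = of_int (lam m r h k * int (gcd m k) - int (r * h))"
proof -
  have "real (gcd m k) \<noteq> 0" using assms by simp
  then show ?thesis by (simp add: lam_star_def left_diff_distrib)
qed

lemma lam_star_eq_0_imp_dvd: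
  assumes "k > 0" "lam_star m r h k = 0"
  shows "gcd m k dvd r * h"
proof -
  have "lam m r h k * int (gcd m k) - int (r * h) = 0"
    using lam_star_times_gcd[OF assms(1), of m r h] assms(2) by (simp del: of_int_diff of_int_mult)
  then have "int (gcd m k) dvd int (r * h)" by (metis dvd_triv_right eq_iff_diff_eq_0)
  then show ?thesis by (simp only: int_dvd_int_iff)
qed

text \<open>
  \<open>\<lambda>\<^sup>*\<close> is a multiple of \<open>1/gcd(m, k)\<close>, so it cannot be closer to 0 or 1 than that without being 0.
\<close>

lemma Upsilon_lam_star_gcd_ge_1:
  assumes "k > 0"
  shows "Upsilon (lam_star m r h k) * real (gcd m k) \<ge> 1"
proof -
  let ?l = "lam_star m r h k" and ?g = "real (gcd m k)"
  have g: "?g \<ge> 1" using assms by (simp add: Suc_le_eq)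
  show ?thesis
  proof (cases "?l = 0")
    case True
    then show ?thesis using g by (simp add: Upsilon_def)
  next
    case False
    define N where "N = lam m r h k * int (gcd m k) - int (r * h)"
    have N: "?l * ?g = of_int N" using lam_star_times_gcd[OF assms] by (simp add: N_def)
    have "?l > 0" using False lam_star_bounds(1)[of m r h k] by linarith
    then have "of_int N > (0::real)" using g unfolding N[symmetric] by (intro mult_pos_pos) linarith+
    then have "N \<ge> 1" by simp
    then have 1: "?l * ?g \<ge> 1" using N by simp
    have "(1 - ?l) * ?g > 0" using g lam_star_bounds(2)[of m r h k] by (intro mult_pos_pos) linarith+
    moreover have e: "(1 - ?l) * ?g = of_int (int (gcd m k) - N)" using N by (simp add: algebra_simps)
    ultimately have "int (gcd m k) - N \<ge> 1" by (simp only: of_int_0_less_iff)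
    then have "(1 - ?l) * ?g \<ge> 1" unfolding e by (metis of_int_1 of_int_le_iff)
    then show ?thesis using 1 False by (simp add: Upsilon_def)
  qed
qed

lemma Upsilon_le:
  assumes "0 \<le> x" "x < 1"
  shows "Upsilon x \<le> (if x = 0 then 1 else x)" "Upsilon x \<le> 1 - x" "0 \<le> Upsilon x"
  using assms by (auto simp: Upsilon_def)

text \<open>
  Although the shift is written with the denominator \<open>mk\<close>, it lies in \<open>(1/m)\<int>\<close>: by the congruence for
  \<open>hb\<close> the factor \<open>k\<close> cancels. It is not an integer, for otherwise \<open>m\<close> would divide \<open>r\<close>. Hence the
  factors of \<open>\<Pi>\<close> take finitely many values, all nonzero.
\<close>

lemma cusp_shift_cases:
  assumes "0 < r" "r < m" "0 < k" "coprime h k" "lam_star m r h k = 0"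
    and hb: "[hb * int (m * h div gcd m k) = - 1] (mod int (k div gcd m k))"
  shows "\<exists>p\<in>{1..<m}. e2pi (of_real (cusp_shift m r h k hb)) = e2pi (of_nat p / of_nat m)"
proof -
  define g where "g = gcd m k"
  have g0: "g > 0" using assms by (simp add: g_def)
  obtain m' where m': "m = g * m'" unfolding g_def by (metis dvdE gcd_dvd1)
  obtain k' where k': "k = g * k'" unfolding g_def by (metis dvdE gcd_dvd2)
  have "g dvd r * h" using lam_star_eq_0_imp_dvd[OF assms(3,5)] by (simp add: g_def)
  moreover have "coprime g h" using assms(4) k' by (simp add: coprime_commute)
  ultimately have "g dvd r" by (metis coprime_dvd_mult_left_iff)
  then obtain r' where r': "r = g * r'" by blast
  have "m * h div g = m' * h" "k div g = k'" using g0 by (simp_all add: m' k' mult.assoc)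
  then have "[hb * int (m' * h) = - 1] (mod int k')" using hb by (simp add: g_def)
  then obtain t where t: "hb * int (m' * h) + 1 = int k' * t" by (auto simp: cong_iff_dvd_diff)
  have s: "cusp_shift m r h k hb = of_int (int r * t) / real m"
  proof -
    have "real_of_int (hb * int (m' * h) + 1) = real_of_int (int k' * t)" using t by simp
    then have t': "real_of_int hb * (real m' * real h) + 1 = real k' * real_of_int t" by simp
    have "real (r * gcd m k) + real r * of_int hb * real (m * h) = real r * real g * (real_of_int hb * (real m' * real h) + 1)"
      unfolding g_def[symmetric] by (simp add: m' algebra_simps)
    also have "\<dots> = real r * of_int t * real k" unfolding t' by (simp add: k')
    finally show ?thesis using assms(3) by (simp add: cusp_shift_def)
  qed
  define p where "p = nat (int r * t mod int m)"
  have m0: "m > 0" using assms by simp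
  have p: "int p = int r * t mod int m" using m0 by (simp add: p_def)
  have "p < m" using p m0 by (metis of_nat_less_iff pos_mod_bound of_nat_0_less_iff)
  moreover have "p \<noteq> 0"
  proof
    assume "p = 0"
    then have "int m dvd int r * t" using p by auto
    then have "int g * int m' dvd int g * (int r' * t)" by (simp add: m' r' mult.assoc)
    then have "int m' dvd int r' * t" using g0 by simp
    moreover have "coprime (int m') t"
    proof (rule coprimeI)
      fix e assume e: "e dvd int m'" "e dvd t"
      then have "e dvd int k' * t" "e dvd hb * int (m' * h)" by (simp_all add: dvd_mult)
      then have "e dvd (hb * int (m' * h) + 1) - hb * int (m' * h)" unfolding t by (rule dvd_diff)
      then show "is_unit e" by simp
    qed
    ultimately have "int m' dvd int r'" by (metis coprime_dvd_mult_left_iff)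
    then have "m dvd r" by (simp add: m' r')
    then show False using assms(1,2) by (auto dest: dvd_imp_le)
  qed
  moreover have "e2pi (of_real (cusp_shift m r h k hb)) = e2pi (of_nat p / of_nat m)"
  proof -
    have "real_of_int (int r * t) = real p + real m * real_of_int (int r * t div int m)"
      using p by (metis (no_types, opaque_lifting) mod_mult_div_eq of_int_add of_int_mult of_int_of_nat_eq)
    then have "cusp_shift m r h k hb = real p / real m + of_int (int r * t div int m)"
      unfolding s using m0 by (simp add: field_simps)
    then have "complex_of_real (cusp_shift m r h k hb) = of_nat p / of_nat m + of_int (int r * t div int m)"
      by simp
    then show ?thesis by (simp only: e2pi_add e2pi_of_int mult_1_right)
  qed
  ultimately show ?thesis by auto
qed

text \<open>
  The constant term of the transformed theta product; \<open>\<Pi>\<close> is the product of the powers of these.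
\<close>

definition cusp_const :: "nat \<Rightarrow> nat \<Rightarrow> nat \<Rightarrow> nat \<Rightarrow> int \<Rightarrow> complex" where
  "cusp_const m r h k hb = (if lam_star m r h k = 0 then 1 - e2pi (of_real (cusp_shift m r h k hb)) else 1)"

lemma cusp_const_bounded:
  fixes n :: int
  assumes "0 < r" "r < m"
  shows "\<exists>B. \<forall>h k hb. 0 < k \<longrightarrow> coprime h k \<longrightarrow> [hb * int (m * h div gcd m k) = - 1] (mod int (k div gcd m k)) \<longrightarrow>
     norm (cusp_const m r h k hb powi n) \<le> B"
proof -
  define V where "V = insert 1 ((\<lambda>p. (1 - e2pi (of_nat p / of_nat m)) powi n) ` {1..<m})"
  have "finite V" by (simp add: V_def)
  moreover have "cusp_const m r h k hb powi n \<in> V"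
    if hyp: "0 < k" "coprime h k" "[hb * int (m * h div gcd m k) = - 1] (mod int (k div gcd m k))" for h k hb
  proof (cases "lam_star m r h k = 0")
    case True
    then obtain p where "p \<in> {1..<m}" "e2pi (of_real (cusp_shift m r h k hb)) = e2pi (of_nat p / of_nat m)"
      using cusp_shift_cases[OF assms hyp(1,2) True hyp(3)] by blast
    then show ?thesis using True by (auto simp: V_def cusp_const_def)
  qed (simp add: V_def cusp_const_def)
  ultimately show ?thesis by (intro exI[of _ "Max (norm ` V)"]) simp
qed

lemma Im_cusp_tau: "Im (cusp_tau m k hb z) = (real (gcd m k))\<^sup>2 / real m * (Re (1 / z) / (real k)\<^sup>2)"
proof -
  have "cusp_tau m k hb z = of_real (of_int hb * real (gcd m k) / real k) +
     \<i> * (of_real ((real (gcd m k))\<^sup>2 / real m / (real k)\<^sup>2) * (1 / z))"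
    by (simp add: cusp_tau_def)
  moreover have "Im (of_real x + \<i> * (of_real y * w)) = y * Re w" for x y w by simp
  ultimately have "Im (cusp_tau m k hb z) = (real (gcd m k))\<^sup>2 / real m / (real k)\<^sup>2 * Re (1 / z)" by (simp only:)
  then show ?thesis by simp
qed

text \<open>
  All cusps together with the local parameters at which the transformed variables are bounded
  away from 1 in absolute value. The bound \<open>1/2\<close> is what the Farey arcs at height \<open>1/N\<^sup>2\<close> satisfy.
\<close>

definition cusp_configs :: "(nat \<times> nat \<times> complex) set" where
  "cusp_configs = {(h, k, z). 0 < k \<and> h < k \<and> coprime h k \<and> Re (1 / z) / (real k)\<^sup>2 \<ge> 1 / 2}"

text \<open>
  After the constant term has been removed, the theta product is \<open>(A; q)\<^sub>\<infinity> (A'; q)\<^sub>\<infinity>\<close>, where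
  \<open>A\<close> and \<open>A'\<close> have the sizes \<open>|q|\<close> to the power \<open>\<lambda>\<^sup>*\<close> (or 1 if \<open>\<lambda>\<^sup>* = 0\<close>) and to the power
  \<open>1 - \<lambda>\<^sup>*\<close>. Both exponents are at least \<open>\<Upsilon>(\<lambda>\<^sup>*)\<close>. The bound \<open>\<Upsilon>(\<lambda>\<^sup>*) gcd(m, k) \<ge> 1\<close> gives
  \<open>|A|, |A'|, |q| \<le> exp (-\<pi>/m)\<close> for all cusps.
\<close>

lemma tprod_over_const_near_one:
  fixes n :: int
  assumes "0 < r" "r < m" and hb: "hbar_choice hb"
    and t: "\<And>i. i \<in> cusp_configs \<Longrightarrow> 0 \<le> t i \<and> t i \<le> 1"
    and Ut: "\<And>h k z. (h, k, z) \<in> cusp_configs \<Longrightarrow>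
       exp (- 2 * pi * (Upsilon (lam_star m r h k) * (real (gcd m k))\<^sup>2 / real m) * (Re (1 / z) / (real k)\<^sup>2)) \<le> t (h, k, z)"
  shows "\<exists>R. near_one cusp_configs t R \<and> (\<forall>h k z. (h, k, z) \<in> cusp_configs \<longrightarrow>
     tprod (of_real (lam_star m r h k) * cusp_tau m k (hb m h k) z + of_real (cusp_shift m r h k (hb m h k)))
       (cusp_tau m k (hb m h k) z) powi n = cusp_const m r h k (hb m h k) powi n * R (h, k, z))"
proof -
  define c where "c = exp (- pi / real m)"
  have c: "0 \<le> c" "c < 1" using assms by (simp_all add: c_def)
  define tt where "tt = (\<lambda>(h, k, z). cusp_tau m k (hb m h k) z)"
  define s where "s = (\<lambda>(h, k, z::complex). complex_of_real (cusp_shift m r h k (hb m h k)))"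
  define ls where "ls = (\<lambda>(h, k, z::complex). lam_star m r h k)"
  define A where "A = (\<lambda>i. if ls i = 0 then e2pi (tt i + s i) else e2pi (of_real (ls i) * tt i + s i))"
  define A' where "A' = (\<lambda>i. e2pi (tt i - (of_real (ls i) * tt i + s i)))"
  define X where "X = (\<lambda>(h::nat, k, z). Re (1 / z) / (real k)\<^sup>2)"
  define G where "G = (\<lambda>(h::nat, k, z::complex). (real (gcd m k))\<^sup>2 / real m)"
  have Imtt: "Im (tt i) = G i * X i" for i
    by (cases i) (simp add: tt_def G_def X_def Im_cusp_tau)
  have Ims: "Im (s i) = 0" for i by (cases i) (simp add: s_def)
  have ls: "0 \<le> ls i" "ls i < 1" for i by (cases i, simp add: ls_def lam_star_bounds)+
  have X: "X i \<ge> 1 / 2" and G: "G i \<ge> 0" and UG: "Upsilon (ls i) * G i \<ge> 1 / real m" and G1: "G i \<ge> 1 / real m"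
    and Ut': "exp (- 2 * pi * (Upsilon (ls i) * G i) * X i) \<le> t i"
    if i: "i \<in> cusp_configs" for i
  proof -
    obtain h k z where [simp]: "i = (h, k, z)" by (cases i)
    have k: "k > 0" using i by (auto simp: cusp_configs_def)
    show "X i \<ge> 1 / 2" using i by (auto simp: cusp_configs_def X_def)
    show "G i \<ge> 0" by (simp add: G_def)
    have g: "real (gcd m k) \<ge> 1" using k by (simp add: Suc_le_eq)
    have "1 * 1 \<le> (Upsilon (lam_star m r h k) * real (gcd m k)) * real (gcd m k)"
      using Upsilon_lam_star_gcd_ge_1[OF k, of m r h] g by (intro mult_mono) auto
    then have "1 / real m \<le> ((Upsilon (lam_star m r h k) * real (gcd m k)) * real (gcd m k)) / real m"
      by (intro divide_right_mono) auto
    then show "Upsilon (ls i) * G i \<ge> 1 / real m" by (simp add: ls_def G_def power2_eq_square mult_ac)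
    have "1 \<le> (real (gcd m k))\<^sup>2" using g by (simp add: one_le_power)
    then show "G i \<ge> 1 / real m" by (simp add: G_def divide_right_mono)
    show "exp (- 2 * pi * (Upsilon (ls i) * G i) * X i) \<le> t i"
      using Ut[of h k z] i by (simp add: ls_def G_def X_def)
  qed
  have key: "exp (- 2 * pi * (a * (G i * X i))) \<le> c \<and> exp (- 2 * pi * (a * (G i * X i))) \<le> t i"
    if i: "i \<in> cusp_configs" and a: "Upsilon (ls i) \<le> a" for i a
  proof -
    have "Upsilon (ls i) * (G i * X i) \<le> a * (G i * X i)"
      using a X[OF i] G[OF i] by (intro mult_right_mono) auto
    then have "exp (- 2 * pi * (a * (G i * X i))) \<le> exp (- 2 * pi * (Upsilon (ls i) * (G i * X i)))" by simp
    moreover have "exp (- 2 * pi * (Upsilon (ls i) * (G i * X i))) \<le> t i" using Ut'[OF i] by (simp add: mult.assoc)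
    moreover have "1 / real m * (1 / 2) \<le> (Upsilon (ls i) * G i) * X i"
      using UG[OF i] X[OF i] by (intro mult_mono) (auto intro: order_trans[rotated])
    then have "pi * (1 / real m) \<le> pi * (2 * (Upsilon (ls i) * (G i * X i)))"
      by (intro mult_left_mono) (auto simp: mult.assoc)
    then have "exp (- 2 * pi * (Upsilon (ls i) * (G i * X i))) \<le> c" by (simp add: c_def mult_ac)
    ultimately show ?thesis by linarith
  qed
  have nA: "norm (A i) \<le> c \<and> norm (A i) \<le> t i" if i: "i \<in> cusp_configs" for i
    using key[OF i, of "if ls i = 0 then 1 else ls i"] Upsilon_le(1)[OF ls[of i]]
    by (auto simp: A_def norm_e2pi Ims Imtt mult_ac)
  have nA': "norm (A' i) \<le> c \<and> norm (A' i) \<le> t i" if i: "i \<in> cusp_configs" for i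
  proof -
    have "Im (tt i - (of_real (ls i) * tt i + s i)) = (1 - ls i) * (G i * X i)"
      by (simp add: Ims Imtt algebra_simps)
    then show ?thesis using key[OF i Upsilon_le(2)[OF ls]] by (simp add: A'_def norm_e2pi mult_ac)
  qed
  have nq: "norm (e2pi (tt i)) \<le> c" if i: "i \<in> cusp_configs" for i
  proof -
    have "1 / real m * (1 / 2) \<le> G i * X i"
      using G1[OF i] X[OF i] by (intro mult_mono) (auto intro: order_trans[rotated])
    then have "pi * (1 / real m) \<le> pi * (2 * (G i * X i))" by (intro mult_left_mono) auto
    then show ?thesis by (simp add: norm_e2pi Imtt c_def mult_ac)
  qed
  define R where "R = (\<lambda>i. qpoch (A i) (e2pi (tt i)) powi n * qpoch (A' i) (e2pi (tt i)) powi n)"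
  have "near_one cusp_configs t R" unfolding R_def
    by (intro near_one_mult near_one_qpoch[OF c] nA nA' nq t)
  moreover have "tprod (of_real (ls i) * tt i + s i) (tt i) powi n =
      (if ls i = 0 then 1 - e2pi (s i) else 1) powi n * R i" if i: "i \<in> cusp_configs" for i
  proof -
    have q1: "norm (e2pi (tt i)) < 1" using nq[OF i] c by linarith
    have "qpoch (e2pi (of_real (ls i) * tt i + s i)) (e2pi (tt i)) =
       (if ls i = 0 then 1 - e2pi (s i) else 1) * qpoch (A i) (e2pi (tt i))"
      using qpoch_rec[OF q1, of "e2pi (s i)"] by (simp add: A_def e2pi_add mult.commute)
    then have "tprod (of_real (ls i) * tt i + s i) (tt i) = (if ls i = 0 then 1 - e2pi (s i) else 1) *
       (qpoch (A i) (e2pi (tt i)) * qpoch (A' i) (e2pi (tt i)))"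
      unfolding tprod_def A'_def by (simp only: mult.assoc)
    then show ?thesis by (simp only: R_def power_int_mult_distrib)
  qed
  then have "tprod (of_real (lam_star m r h k) * cusp_tau m k (hb m h k) z + of_real (cusp_shift m r h k (hb m h k)))
       (cusp_tau m k (hb m h k) z) powi n = cusp_const m r h k (hb m h k) powi n * R (h, k, z)"
    if "(h, k, z) \<in> cusp_configs" for h k z
    using that unfolding ls_def tt_def s_def cusp_const_def by fastforce
  ultimately show ?thesis by blast
qed

section \<open>The whole product near a cusp\<close>

lemma power_int_sum:
  fixes x :: "'a :: field"
  assumes "x \<noteq> 0"
  shows "x powi (\<Sum>j\<in>A. f j) = (\<Prod>j\<in>A. x powi f j)"
  by (induction A rule: infinite_finite_induct) (simp_all add: power_int_add assms)

lemma Omega_eq: "Omega J m r \<delta> = (\<Sum>j=1..J. of_int (\<delta> j) * Omega_term (m j) (r j))"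
  by (simp add: Omega_def Omega_term_def)

lemma Delta_eq: "Delta J m r \<delta> h k = (\<Sum>j=1..J. of_int (\<delta> j) * Delta_term (m j) (r j) h k)"
  unfolding Delta_def Delta_term_def sum_negf[symmetric] mult_minus_right ..

lemma D_factor_eq: "D_factor J m r \<delta> hb h k =
  exp (of_real pi * \<i> * of_real (\<Sum>j=1..J. of_int (\<delta> j) * D_exponent (m j) (r j) h k (hb (m j) h k)))"
  by (simp add: D_factor_def D_exponent_def)

lemma Pi_factor_eq: "Pi_factor J m r \<delta> hb h k = (\<Prod>j=1..J. cusp_const (m j) (r j) h k (hb (m j) h k) powi \<delta> j)"
proof -
  have "(\<Prod>j=1..J. cusp_const (m j) (r j) h k (hb (m j) h k) powi \<delta> j) =
    (\<Prod>j\<in>{1..J}. if lam_star (m j) (r j) h k = 0 then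
       (1 - e2pi (of_real (cusp_shift (m j) (r j) h k (hb (m j) h k)))) powi \<delta> j else 1)"
    by (intro prod.cong refl) (simp add: cusp_const_def)
  also have "\<dots> = Pi_factor J m r \<delta> hb h k"
    unfolding Pi_factor_def e2pi_def cusp_shift_def by (subst prod.inter_filter) auto
  finally show ?thesis by simp
qed

lemma product_near_cusp:
  fixes J :: nat and m r :: "nat \<Rightarrow> nat" and \<delta> :: "nat \<Rightarrow> int"
  assumes mr: "\<And>j. j \<in> {1..J} \<Longrightarrow> 1 \<le> r j \<and> r j < m j"
    and hb: "hbar_choice hb" and hk: "h < k" "coprime h k" and z: "Re z > 0"
  shows "(\<Prod>j=1..J. theta_prod (m j) (r j) (e2pi (of_nat h / of_nat k + \<i> * z)) powi \<delta> j) =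
    \<i> powi (\<Sum>j=1..J. \<delta> j) *
    ((- 1) powi (\<Sum>j=1..J. \<delta> j * lam (m j) (r j) h k) * (omega J m \<delta> h k)\<^sup>2 * D_factor J m r \<delta> hb h k) *
    exp (of_real pi / 12 * (of_real (Omega J m r \<delta>) * z + of_real (Delta J m r \<delta> h k) / ((of_nat k)\<^sup>2 * z))) *
    (\<Prod>j=1..J. tprod (of_real (lam_star (m j) (r j) h k) * cusp_tau (m j) k (hb (m j) h k) z +
         of_real (cusp_shift (m j) (r j) h k (hb (m j) h k))) (cusp_tau (m j) k (hb (m j) h k) z) powi \<delta> j)"
proof -
  define T where "T = (\<lambda>j. tprod (of_real (lam_star (m j) (r j) h k) * cusp_tau (m j) k (hb (m j) h k) z +
         of_real (cusp_shift (m j) (r j) h k (hb (m j) h k))) (cusp_tau (m j) k (hb (m j) h k) z) powi \<delta> j)"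
  define s where "s = (\<lambda>j. complex_of_real (dedekind_sum (m j * h div gcd (m j) k) (k div gcd (m j) k)))"
  define d where "d = (\<lambda>j. complex_of_real (D_exponent (m j) (r j) h k (hb (m j) h k)))"
  define w where "w = (\<lambda>j. of_real (Omega_term (m j) (r j)) * z + of_real (Delta_term (m j) (r j) h k) / ((of_nat k)\<^sup>2 * z))"
  have "(\<Prod>j=1..J. theta_prod (m j) (r j) (e2pi (of_nat h / of_nat k + \<i> * z)) powi \<delta> j) =
    (\<Prod>j=1..J. \<i> powi \<delta> j * (- 1) powi (\<delta> j * lam (m j) (r j) h k) *
      exp (of_int (\<delta> j) * (- 2 * of_real pi * \<i> * s j)) * exp (of_int (\<delta> j) * (of_real pi * \<i> * d j)) *
      exp (of_int (\<delta> j) * (of_real pi / 12 * w j)) * T j)"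
  proof (intro prod.cong refl)
    fix j assume j: "j \<in> {1..J}"
    have cong: "[hb (m j) h k * int (m j * h div gcd (m j) k) = - 1] (mod int (k div gcd (m j) k))"
      using hb hk mr[OF j] unfolding hbar_choice_def by auto
    have eq: "theta_prod (m j) (r j) (e2pi (of_nat h / of_nat k + \<i> * z)) =
      \<i> * (- 1) powi lam (m j) (r j) h k * exp (- 2 * of_real pi * \<i> * s j) * exp (of_real pi * \<i> * d j) *
      exp (of_real pi / 12 * w j) * tprod (of_real (lam_star (m j) (r j) h k) * cusp_tau (m j) k (hb (m j) h k) z +
         of_real (cusp_shift (m j) (r j) h k (hb (m j) h k))) (cusp_tau (m j) k (hb (m j) h k) z)"
      unfolding s_def d_def w_def by (rule theta_prod_near_cusp[OF _ _ _ hk(2) cong z]) (use mr[OF j] hk in auto)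
    have sg: "((- 1) powi lam (m j) (r j) h k) powi \<delta> j = (- 1 :: complex) powi (\<delta> j * lam (m j) (r j) h k)"
      by (simp only: power_int_mult[symmetric] mult.commute)
    show "theta_prod (m j) (r j) (e2pi (of_nat h / of_nat k + \<i> * z)) powi \<delta> j =
      \<i> powi \<delta> j * (- 1) powi (\<delta> j * lam (m j) (r j) h k) *
      exp (of_int (\<delta> j) * (- 2 * of_real pi * \<i> * s j)) * exp (of_int (\<delta> j) * (of_real pi * \<i> * d j)) *
      exp (of_int (\<delta> j) * (of_real pi / 12 * w j)) * T j"
      unfolding eq power_int_mult_distrib sg exp_power_int T_def ..
  qed
  also have "\<dots> = (\<Prod>j=1..J. \<i> powi \<delta> j) * (\<Prod>j=1..J. (- 1) powi (\<delta> j * lam (m j) (r j) h k)) *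
      (\<Prod>j=1..J. exp (of_int (\<delta> j) * (- 2 * of_real pi * \<i> * s j))) * (\<Prod>j=1..J. exp (of_int (\<delta> j) * (of_real pi * \<i> * d j))) *
      (\<Prod>j=1..J. exp (of_int (\<delta> j) * (of_real pi / 12 * w j))) * (\<Prod>j=1..J. T j)"
    by (simp only: prod.distrib)
  also have "(\<Prod>j=1..J. \<i> powi \<delta> j) = \<i> powi (\<Sum>j=1..J. \<delta> j)" by (simp add: power_int_sum)
  also have "(\<Prod>j=1..J. (- 1) powi (\<delta> j * lam (m j) (r j) h k)) = (- 1 :: complex) powi (\<Sum>j=1..J. \<delta> j * lam (m j) (r j) h k)"
    by (simp add: power_int_sum)
  also have "(\<Prod>j=1..J. exp (of_int (\<delta> j) * (- 2 * of_real pi * \<i> * s j))) = (omega J m \<delta> h k)\<^sup>2"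
  proof -
    have "(omega J m \<delta> h k)\<^sup>2 = exp (2 * (- of_real pi * \<i> * of_real
       (\<Sum>j=1..J. of_int (\<delta> j) * dedekind_sum (m j * h div gcd (m j) k) (k div gcd (m j) k))))"
      unfolding omega_def by (simp only: exp_double)
    also have "2 * (- of_real pi * \<i> * of_real
       (\<Sum>j=1..J. of_int (\<delta> j) * dedekind_sum (m j * h div gcd (m j) k) (k div gcd (m j) k))) =
      (\<Sum>j=1..J. of_int (\<delta> j) * (- 2 * of_real pi * \<i> * s j))"
      unfolding of_real_sum sum_distrib_left by (intro sum.cong refl) (simp add: s_def)
    finally show ?thesis by (simp add: exp_sum)
  qed
  also have "(\<Prod>j=1..J. exp (of_int (\<delta> j) * (of_real pi * \<i> * d j))) = D_factor J m r \<delta> hb h k"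
  proof -
    have "of_real pi * \<i> * of_real (\<Sum>j=1..J. of_int (\<delta> j) * D_exponent (m j) (r j) h k (hb (m j) h k)) =
      (\<Sum>j=1..J. of_int (\<delta> j) * (of_real pi * \<i> * d j))"
      unfolding of_real_sum sum_distrib_left by (intro sum.cong refl) (simp add: d_def)
    then show ?thesis unfolding D_factor_eq by (simp add: exp_sum)
  qed
  also have "(\<Prod>j=1..J. exp (of_int (\<delta> j) * (of_real pi / 12 * w j))) =
     exp (of_real pi / 12 * (of_real (Omega J m r \<delta>) * z + of_real (Delta J m r \<delta> h k) / ((of_nat k)\<^sup>2 * z)))"
  proof -
    have "(\<Sum>j=1..J. of_int (\<delta> j) * (of_real pi / 12 * w j)) = of_real pi / 12 *
       ((\<Sum>j=1..J. of_real (of_int (\<delta> j) * Omega_term (m j) (r j)) * z) +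
        (\<Sum>j=1..J. of_real (of_int (\<delta> j) * Delta_term (m j) (r j) h k) / ((of_nat k)\<^sup>2 * z)))"
      unfolding sum.distrib[symmetric] sum_distrib_left
      by (intro sum.cong refl) (simp add: w_def algebra_simps add_divide_distrib)
    also have "\<dots> = of_real pi / 12 * (of_real (Omega J m r \<delta>) * z + of_real (Delta J m r \<delta> h k) / ((of_nat k)\<^sup>2 * z))"
      unfolding Omega_eq Delta_eq of_real_sum sum_distrib_right sum_divide_distrib ..
    finally show ?thesis by (simp only: exp_sum[symmetric] finite_atLeastAtMost)
  qed
  finally show ?thesis unfolding T_def by (simp only: mult.assoc)
qed

text \<open>
  The error term must be the same for all choices of \<open>\<hbar>\<close>. This holds because \<open>\<hbar>\<close> is determined modulo
  \<open>k/gcd(m, k)\<close>, and the next three lemmas show that \<open>D\<close> and \<open>\<Pi>\<close> see only its class.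
\<close>

lemma hbar_choice_unique:
  assumes "hbar_choice hb" "hbar_choice hb'" "0 < m" "h < k" "coprime h k"
  shows "[hb m h k = hb' m h k] (mod int (k div gcd m k))"
proof -
  let ?a = "int (m * h div gcd m k)" and ?k = "int (k div gcd m k)"
  have 1: "[hb m h k * ?a = - 1] (mod ?k)" "[hb' m h k * ?a = - 1] (mod ?k)"
    using assms unfolding hbar_choice_def by auto
  have "coprime ?a ?k"
  proof (rule coprimeI)
    fix e assume e: "e dvd ?a" "e dvd ?k"
    have "?k dvd hb m h k * ?a + 1" using 1(1) by (simp add: cong_iff_dvd_diff)
    then have "e dvd hb m h k * ?a + 1" "e dvd hb m h k * ?a" using e dvd_trans by (blast, simp)
    then have "e dvd (hb m h k * ?a + 1) - hb m h k * ?a" by (rule dvd_diff)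
    then show "is_unit e" by simp
  qed
  moreover have "[hb m h k * ?a = hb' m h k * ?a] (mod ?k)" using 1 cong_trans cong_sym by blast
  ultimately show ?thesis using cong_mult_rcancel by blast
qed

lemma cusp_const_hbar_unique:
  assumes "hbar_choice hb" "hbar_choice hb'" "0 < m" "h < k" "coprime h k"
  shows "cusp_const m r h k (hb m h k) = cusp_const m r h k (hb' m h k)"
proof (cases "lam_star m r h k = 0")
  case True
  define g where "g = gcd m k"
  have k: "k > 0" using assms by simp
  have g0: "g > 0" using k by (simp add: g_def)
  obtain k' where k': "k = k' * g" unfolding g_def by (metis dvdE gcd_dvd2 mult.commute)
  have kg: "k div g = k'" using k' g0 by simp
  obtain t where t: "hb m h k = hb' m h k + int k' * t"
    using hbar_choice_unique[OF assms] unfolding g_def[symmetric] kg by (metis cong_iff_lin cong_sym)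
  obtain p where p: "r * h = g * p" using lam_star_eq_0_imp_dvd[OF k True] by (auto simp: g_def)
  have "real (r * h) = real g * real p" using p by (metis of_nat_mult)
  then have rh: "real r * real h = real g * real p" by simp
  have "real r * real_of_int (hb m h k) * real (m * h) = real r * real_of_int (hb' m h k) * real (m * h) +
     (real r * real h) * (real m * real k' * real_of_int t)"
    by (simp add: t algebra_simps)
  also have "\<dots> = real r * real_of_int (hb' m h k) * real (m * h) + real (m * k) * real_of_int (int p * t)"
    unfolding rh by (simp add: k')
  finally have "cusp_shift m r h k (hb m h k) = cusp_shift m r h k (hb' m h k) + real_of_int (int p * t)"
    using k assms(3) by (simp add: cusp_shift_def add_divide_distrib)
  then have "complex_of_real (cusp_shift m r h k (hb m h k)) = of_real (cusp_shift m r h k (hb' m h k)) + of_int (int p * t)"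
    by simp
  then show ?thesis unfolding cusp_const_def by (simp only: e2pi_add e2pi_of_int mult_1_right)
qed (simp add: cusp_const_def)

text \<open>
  Changing \<open>\<hbar>\<close> by \<open>t k/gcd(m, k)\<close> changes the exponent by \<open>t (\<lambda>\<^sup>2 - \<lambda>)\<close>, an even number.
\<close>

lemma D_exponent_hbar_unique:
  assumes "hbar_choice hb" "hbar_choice hb'" "0 < m" "h < k" "coprime h k"
  shows "\<exists>N::int. D_exponent m r h k (hb m h k) = D_exponent m r h k (hb' m h k) + 2 * of_int N"
proof -
  define g where "g = gcd m k"
  have k: "k > 0" using assms by simp
  have g0: "g > 0" using k by (simp add: g_def)
  obtain k' where k': "k = k' * g" unfolding g_def by (metis dvdE gcd_dvd2 mult.commute)
  have kg: "k div g = k'" using k' g0 by simp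
  have k'0: "k' > 0" using k k' by (cases k') auto
  obtain t where t: "hb m h k = hb' m h k + int k' * t"
    using hbar_choice_unique[OF assms] unfolding g_def[symmetric] kg by (metis cong_iff_lin cong_sym)
  let ?l = "lam m r h k"
  have "even (?l\<^sup>2 - ?l)" by simp
  then obtain e where e: "?l\<^sup>2 - ?l = 2 * e" by blast
  have "real_of_int (hb m h k) * real g / real k = real_of_int (hb' m h k) * real g / real k + real_of_int t"
  proof -
    have rk: "real k = real k' * real g" using k' by (metis of_nat_mult)
    show ?thesis unfolding rk t using g0 k'0 by (simp add: field_simps)
  qed
  then have "real_of_int (hb m h k) * real g / real k * of_int (2 * e) =
    real_of_int (hb' m h k) * real g / real k * of_int (2 * e) + 2 * of_int (t * e)"
    by (simp add: algebra_simps)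
  then have "D_exponent m r h k (hb m h k) = D_exponent m r h k (hb' m h k) + 2 * of_int (t * e)"
    unfolding D_exponent_def g_def[symmetric] e by linarith
  then show ?thesis by blast
qed

lemma D_Pi_hbar_unique:
  assumes "hbar_choice hb" "hbar_choice hb'" "h < k" "coprime h k"
    and m: "\<And>j. j \<in> {1..J} \<Longrightarrow> 0 < m j"
  shows "D_factor J m r \<delta> hb h k = D_factor J m r \<delta> hb' h k"
    and "Pi_factor J m r \<delta> hb h k = Pi_factor J m r \<delta> hb' h k"
proof -
  show "Pi_factor J m r \<delta> hb h k = Pi_factor J m r \<delta> hb' h k"
    unfolding Pi_factor_eq using cusp_const_hbar_unique[OF assms(1,2) m assms(3,4)] by (intro prod.cong refl) metis
  have "\<forall>j\<in>{1..J}. \<exists>N::int. D_exponent (m j) (r j) h k (hb (m j) h k) = D_exponent (m j) (r j) h k (hb' (m j) h k) + 2 * of_int N"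
    using D_exponent_hbar_unique[OF assms(1,2) m assms(3,4)] by blast
  then obtain N :: "nat \<Rightarrow> int" where N: "\<And>j. j \<in> {1..J} \<Longrightarrow>
      D_exponent (m j) (r j) h k (hb (m j) h k) = D_exponent (m j) (r j) h k (hb' (m j) h k) + 2 * of_int (N j)"
    by metis
  define M where "M = (\<Sum>j=1..J. \<delta> j * N j)"
  have "(\<Sum>j=1..J. of_int (\<delta> j) * D_exponent (m j) (r j) h k (hb (m j) h k)) =
     (\<Sum>j=1..J. of_int (\<delta> j) * D_exponent (m j) (r j) h k (hb' (m j) h k) + 2 * of_int (\<delta> j * N j))"
    by (intro sum.cong refl) (simp add: N algebra_simps)
  also have "\<dots> = (\<Sum>j=1..J. of_int (\<delta> j) * D_exponent (m j) (r j) h k (hb' (m j) h k)) + 2 * of_int M"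
    by (simp add: sum.distrib M_def sum_distrib_left)
  finally have e: "(\<Sum>j=1..J. of_int (\<delta> j) * D_exponent (m j) (r j) h k (hb (m j) h k)) =
     (\<Sum>j=1..J. of_int (\<delta> j) * D_exponent (m j) (r j) h k (hb' (m j) h k)) + 2 * of_int M" .
  have "of_real pi * \<i> * of_real (x + 2 * of_int M) = of_real pi * \<i> * of_real x + 2 * of_real pi * \<i> * of_int M" for x
    by (simp add: algebra_simps)
  moreover have "exp (2 * of_real pi * \<i> * of_int M) = 1" using e2pi_of_int[of M] by (simp add: e2pi_def)
  ultimately show "D_factor J m r \<delta> hb h k = D_factor J m r \<delta> hb' h k"
    unfolding D_factor_eq e by (simp only: exp_add mult_1_right)
qed

section \<open>Coefficients as integrals over a period\<close>

text \<open>
  A primitive of \<open>F(e(\<tau>)) e(-n\<tau>)\<close> on the half plane, found term by term: all frequencies except 0 have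
  periodic primitives, and the frequency 0 contributes \<open>g(n) \<tau>\<close>. The terms of positive frequency
  are collected as \<open>e(\<tau>) H(e(\<tau>))\<close> and are integrated through a primitive of \<open>H\<close> in the disc.
\<close>

lemma coefficient_primitive:
  fixes g :: "nat \<Rightarrow> complex" and F :: "complex \<Rightarrow> complex"
  assumes F: "\<And>q. norm q < 1 \<Longrightarrow> (\<lambda>n. g n * q ^ n) sums F q"
  obtains \<Phi> where "\<And>\<tau>. Im \<tau> > 0 \<Longrightarrow> (\<Phi> has_field_derivative (F (e2pi \<tau>) * e2pi (- of_nat n * \<tau>))) (at \<tau>)"
    "\<And>\<tau>. \<Phi> (\<tau> + 1) = \<Phi> \<tau> + g n"
proof -
  define H where "H = (\<lambda>q. \<Sum>l. g (l + Suc n) * q ^ l)"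
  have H: "(\<lambda>l. g (l + Suc n) * q ^ l) sums H q" "F q = (\<Sum>l<Suc n. g l * q ^ l) + q ^ Suc n * H q"
    if q: "norm q < 1" for q
  proof -
    show S: "(\<lambda>l. g (l + Suc n) * q ^ l) sums H q"
    proof (cases "q = 0")
      case True
      have "(\<lambda>l. g (l + Suc n) * q ^ l) sums (\<Sum>l\<in>{0}. g (l + Suc n) * q ^ l)"
        by (rule sums_finite) (use True in auto)
      then show ?thesis by (simp add: H_def sums_iff)
    next
      case False
      have "summable (\<lambda>l. g (l + Suc n) * q ^ (l + Suc n))"
        using F[OF q] sums_summable summable_ignore_initial_segment by blast
      then have "summable (\<lambda>l. inverse (q ^ Suc n) * (g (l + Suc n) * q ^ (l + Suc n)))" by (rule summable_mult)
      moreover have "inverse (q ^ Suc n) * (g (l + Suc n) * q ^ (l + Suc n)) = g (l + Suc n) * q ^ l" for l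
        using False by (simp add: power_add field_simps)
      ultimately have "summable (\<lambda>l. g (l + Suc n) * q ^ l)" by (simp only:)
      then show ?thesis unfolding H_def by (rule summable_sums)
    qed
    have "(\<lambda>l. g (l + Suc n) * q ^ (l + Suc n)) sums (F q - (\<Sum>l<Suc n. g l * q ^ l))"
      using F[OF q] by (subst sums_iff_shift) simp
    moreover have "(\<lambda>l. q ^ Suc n * (g (l + Suc n) * q ^ l)) sums (q ^ Suc n * H q)" by (rule sums_mult[OF S])
    moreover have "q ^ Suc n * (g (l + Suc n) * q ^ l) = g (l + Suc n) * q ^ (l + Suc n)" for l
      by (simp add: power_add mult_ac)
    ultimately show "F q = (\<Sum>l<Suc n. g l * q ^ l) + q ^ Suc n * H q"
      using sums_unique2 by (metis (no_types, lifting) add_diff_cancel_left' diff_add_cancel sums_cong add.commute)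
  qed
  have "H holomorphic_on ball 0 1"
    by (rule power_series_holomorphic[of _ _ "\<lambda>l. g (l + Suc n)"]) (use H(1) in auto)
  then obtain K where K': "\<And>q. q \<in> ball 0 1 \<Longrightarrow> (K has_field_derivative H q) (at q within ball 0 1)"
    using holomorphic_convex_primitive'[of "ball 0 1" H] by auto
  have K: "(K has_field_derivative H q) (at q)" if "norm q < 1" for q
    using K'[of q] that by (simp add: at_within_open[of q "ball 0 1"])
  define \<Phi> where "\<Phi> = (\<lambda>\<tau>. (\<Sum>l<n. g l / (2 * of_real pi * \<i> * (of_nat l - of_nat n)) * e2pi ((of_nat l - of_nat n) * \<tau>)) + g n * \<tau> +
     K (e2pi \<tau>) / (2 * of_real pi * \<i>))"
  show thesis
  proof (rule that[of \<Phi>])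
    fix \<tau> :: complex assume "Im \<tau> > 0"
    then have q: "norm (e2pi \<tau>) < 1" by (rule norm_e2pi_less_1)
    have de: "((\<lambda>\<tau>. e2pi (c * \<tau>)) has_field_derivative (2 * of_real pi * \<i> * c * e2pi (c * \<tau>))) (at \<tau>)" for c
      unfolding e2pi_def by (auto intro!: derivative_eq_intros)
    have 1: "((\<lambda>\<tau>. g l / (2 * of_real pi * \<i> * (of_nat l - of_nat n)) * e2pi ((of_nat l - of_nat n) * \<tau>)) has_field_derivative
        (g l * e2pi ((of_nat l - of_nat n) * \<tau>))) (at \<tau>)" if "l < n" for l
    proof -
      have nz: "(of_nat l - of_nat n :: complex) \<noteq> 0" using that by simp
      show ?thesis
        by (rule derivative_eq_intros de refl)+ (use nz in \<open>simp add: field_simps\<close>)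
    qed
    have dq: "(e2pi has_field_derivative (2 * of_real pi * \<i> * e2pi \<tau>)) (at \<tau>)" using de[of 1] by simp
    have 2: "((\<lambda>\<tau>. K (e2pi \<tau>) / (2 * of_real pi * \<i>)) has_field_derivative (H (e2pi \<tau>) * e2pi \<tau>)) (at \<tau>)"
    proof -
      have c: "x * (c * y) / c = x * y" if "c \<noteq> 0" for x y c :: complex using that by simp
      have "H (e2pi \<tau>) * (2 * of_real pi * \<i> * e2pi \<tau>) / (2 * of_real pi * \<i>) = H (e2pi \<tau>) * e2pi \<tau>"
        by (rule c) simp
      then show ?thesis using DERIV_cdivide[OF DERIV_chain2[OF K[OF q] dq], of "2 * of_real pi * \<i>"] by (simp only:)
    qed
    have "(\<Phi> has_field_derivative ((\<Sum>l<n. g l * e2pi ((of_nat l - of_nat n) * \<tau>)) + g n * 1 + H (e2pi \<tau>) * e2pi \<tau>)) (at \<tau>)"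
      unfolding \<Phi>_def by (intro DERIV_add DERIV_sum DERIV_cmult DERIV_ident 2) (use 1 in auto)
    moreover have "(\<Sum>l<n. g l * e2pi ((of_nat l - of_nat n) * \<tau>)) + g n * 1 + H (e2pi \<tau>) * e2pi \<tau> = F (e2pi \<tau>) * e2pi (- of_nat n * \<tau>)"
    proof -
      have e: "e2pi \<tau> ^ l * e2pi (- of_nat n * \<tau>) = e2pi ((of_nat l - of_nat n) * \<tau>)" for l
        unfolding e2pi_mult_nat[symmetric] e2pi_add[symmetric] by (simp add: algebra_simps)
      have "F (e2pi \<tau>) * e2pi (- of_nat n * \<tau>) = (\<Sum>l<Suc n. g l * (e2pi \<tau> ^ l * e2pi (- of_nat n * \<tau>))) +
          (e2pi \<tau> ^ Suc n * e2pi (- of_nat n * \<tau>)) * H (e2pi \<tau>)"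
        unfolding H(2)[OF q] distrib_right sum_distrib_right by (simp only: mult_ac)
      then show ?thesis unfolding e by (simp add: mult.commute)
    qed
    ultimately show "(\<Phi> has_field_derivative (F (e2pi \<tau>) * e2pi (- of_nat n * \<tau>))) (at \<tau>)" by simp
  next
    fix \<tau>
    have "e2pi ((of_nat l - of_nat n) * (\<tau> + 1)) = e2pi ((of_nat l - of_nat n) * \<tau>)" for l
    proof -
      have "(of_nat l - of_nat n) * (\<tau> + 1) = (of_nat l - of_nat n) * \<tau> + of_int (int l - int n)" by (simp add: algebra_simps)
      then show ?thesis by (simp only: e2pi_add e2pi_of_int mult_1_right)
    qed
    then show "\<Phi> (\<tau> + 1) = \<Phi> \<tau> + g n" by (simp add: \<Phi>_def e2pi_add algebra_simps)
  qed
qed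

section \<open>Dependence on residue classes only\<close>

lemma gcd_lam_star_cong:
  assumes "m dvd L" "[k = l] (mod L)" "[h = \<kappa>] (mod l)" "l > 0"
  shows "gcd m k = gcd m l" and "lam_star m r h k = lam_star m r \<kappa> l"
proof -
  have "[k = l] (mod m)" using assms(1,2) cong_dvd_modulus_nat by blast
  then show g: "gcd m k = gcd m l" by (metis cong_gcd_eq gcd.commute)
  obtain l' where l': "l = gcd m l * l'" by (metis dvdE gcd_dvd2)
  have g0: "real (gcd m l) \<noteq> 0" using assms(4) by simp
  obtain t where t: "int h = int \<kappa> + int l * t" using assms(3) by (metis cong_iff_lin cong_int_iff cong_sym)
  have "real h = real_of_int (int h)" by simp
  also have "\<dots> = real \<kappa> + real l * of_int t" unfolding t by simp
  finally have h: "real h = real \<kappa> + real l * of_int t" .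
  have ll: "real l = real (gcd m l) * real l'" using l' by (metis of_nat_mult)
  have e: "real (r * h) / real (gcd m l) = real (r * \<kappa>) / real (gcd m l) + of_int (int r * int l' * t)"
    unfolding of_nat_mult h using g0 by (subst ll) (simp add: field_simps)
  show "lam_star m r h k = lam_star m r \<kappa> l"
    unfolding lam_star_def lam_def g e ceiling_add_of_int of_int_add by linarith
qed

lemma Delta_cong:
  assumes "[k = l] (mod lcm_mod J m)" "[h = \<kappa>] (mod l)" "l > 0"
  shows "Delta J m r \<delta> h k = Delta J m r \<delta> \<kappa> l"
proof -
  have "Delta_term (m j) (r j) h k = Delta_term (m j) (r j) \<kappa> l" if "j \<in> {1..J}" for j
  proof -
    have "m j dvd lcm_mod J m" unfolding lcm_mod_def using that by (intro dvd_Lcm) auto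
    from gcd_lam_star_cong[OF this assms] show ?thesis by (simp add: Delta_term_def)
  qed
  then show ?thesis unfolding Delta_eq by simp
qed

text \<open>
  The representative of \<open>k\<close> modulo \<open>L\<close> in \<open>{1..L}\<close>; this range is the one over which the
  pairs \<open>(\<kappa>, l)\<close> of the theorem run.
\<close>

definition class_rep :: "nat \<Rightarrow> nat \<Rightarrow> nat" where
  "class_rep L k = (k - 1) mod L + 1"

lemma class_rep_props:
  assumes "L > 0" "k > 0"
  shows "1 \<le> class_rep L k" "class_rep L k \<le> L" "[k = class_rep L k] (mod L)"
proof -
  show "1 \<le> class_rep L k" by (simp add: class_rep_def)
  show "class_rep L k \<le> L" using assms by (simp add: class_rep_def Suc_leI)
  have "[(k - 1) + 1 = (k - 1) mod L + 1] (mod L)" by (intro cong_add cong_refl) (simp add: cong_def)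
  then show "[k = class_rep L k] (mod L)" using assms(2) by (simp add: class_rep_def)
qed

lemma class_rep_unique:
  assumes "1 \<le> l" "l \<le> L" "[k = l] (mod L)" "k > 0"
  shows "class_rep L k = l"
proof -
  have "[class_rep L k = l] (mod L)" using class_rep_props(3)[of L k] assms by (metis cong_sym cong_trans less_le_trans zero_less_one)
  then have "[class_rep L k - 1 = l - 1] (mod L)"
    using assms(1) by (metis cong_add_rcancel_nat class_rep_def diff_add_inverse2 le_add_diff_inverse2)
  moreover have "class_rep L k - 1 < L" "l - 1 < L" using class_rep_props(2)[of L k] class_rep_props(1)[of L k] assms by linarith+
  ultimately have "class_rep L k - 1 = l - 1" by (simp add: cong_less_modulus_unique_nat)
  then show ?thesis using class_rep_props(1)[of L k] assms by linarith
qed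

section \<open>The integrand on a Farey arc\<close>

locale theta_quotient =
  fixes J :: nat and m r :: "nat \<Rightarrow> nat" and \<delta> :: "nat \<Rightarrow> int"
  assumes J: "J \<ge> 1" and mr: "\<And>j. j \<in> {1..J} \<Longrightarrow> 1 \<le> r j \<and> r j < m j"
begin

abbreviation L where "L \<equiv> lcm_mod J m"

lemma lcm_mod_pos: "L > 0"
proof -
  have "0 \<notin> m ` {1..J}" using mr by force
  then have "L \<noteq> 0" unfolding lcm_mod_def by (simp add: Lcm_0_iff)
  then show ?thesis by simp
qed

text \<open>
  The summand of the innermost sum of the theorem.
\<close>

definition cusp_coeff :: "(nat \<Rightarrow> nat \<Rightarrow> nat \<Rightarrow> int) \<Rightarrow> nat \<Rightarrow> nat \<Rightarrow> nat \<Rightarrow> complex" where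
  "cusp_coeff hb n h k = exp (- 2 * of_real pi * \<i> * of_nat n * of_nat h / of_nat k) *
     (- 1) powi (\<Sum>j=1..J. \<delta> j * lam (m j) (r j) h k) * (omega J m \<delta> h k)\<^sup>2 *
     D_factor J m r \<delta> hb h k * Pi_factor J m r \<delta> hb h k"

lemma cusp_coeff_hbar_unique:
  assumes "hbar_choice hb" "hbar_choice hb'" "h < k" "coprime h k"
  shows "cusp_coeff hb n h k = cusp_coeff hb' n h k"
proof -
  have m: "0 < m j" if "j \<in> {1..J}" for j using mr[OF that] by simp
  have "D_factor J m r \<delta> hb h k = D_factor J m r \<delta> hb' h k" "Pi_factor J m r \<delta> hb h k = Pi_factor J m r \<delta> hb' h k"
    by (rule D_Pi_hbar_unique[OF assms], erule m)+
  then show ?thesis by (simp only: cusp_coeff_def)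
qed

lemma Pi_factor_bounded:
  assumes hb: "hbar_choice hb"
  shows "\<exists>B\<ge>0. \<forall>h k. h < k \<longrightarrow> coprime h k \<longrightarrow> norm (Pi_factor J m r \<delta> hb h k) \<le> B"
proof -
  have "\<forall>j\<in>{1..J}. \<exists>B. \<forall>h k hb. 0 < k \<longrightarrow> coprime h k \<longrightarrow> [hb * int (m j * h div gcd (m j) k) = - 1] (mod int (k div gcd (m j) k)) \<longrightarrow>
     norm (cusp_const (m j) (r j) h k hb powi \<delta> j) \<le> B"
    using cusp_const_bounded mr by (metis Suc_le_eq One_nat_def)
  then obtain B where B: "\<And>j h k hb. j \<in> {1..J} \<Longrightarrow> 0 < k \<Longrightarrow> coprime h k \<Longrightarrow>
     [hb * int (m j * h div gcd (m j) k) = - 1] (mod int (k div gcd (m j) k)) \<Longrightarrow>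
     norm (cusp_const (m j) (r j) h k hb powi \<delta> j) \<le> B j"
    by metis
  have "norm (Pi_factor J m r \<delta> hb h k) \<le> (\<Prod>j=1..J. \<bar>B j\<bar>)" if hk: "h < k" "coprime h k" for h k
    unfolding Pi_factor_eq prod_norm[symmetric]
  proof (intro prod_mono conjI)
    fix j assume j: "j \<in> {1..J}"
    have "[hb (m j) h k * int (m j * h div gcd (m j) k) = - 1] (mod int (k div gcd (m j) k))"
      using hb hk mr[OF j] unfolding hbar_choice_def by auto
    then show "norm (cusp_const (m j) (r j) h k (hb (m j) h k) powi \<delta> j) \<le> \<bar>B j\<bar>"
      using B[OF j, of k h] hk by (intro order_trans[OF _ abs_ge_self]) auto
  qed auto
  then show ?thesis by (intro exI[of _ "\<Prod>j=1..J. \<bar>B j\<bar>"]) (auto intro: prod_nonneg)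
qed

lemma norm_omega [simp]: "norm (omega J m \<delta> h k) = 1"
  unfolding omega_def by (simp add: norm_exp_eq_Re)

lemma norm_D_factor [simp]: "norm (D_factor J m r \<delta> hb h k) = 1"
  unfolding D_factor_def by (simp only: norm_exp_eq_Re) simp

lemma norm_cusp_coeff: "norm (cusp_coeff hb n h k) = norm (Pi_factor J m r \<delta> hb h k)"
proof -
  have "norm (exp (- 2 * of_real pi * \<i> * of_nat n * of_nat h / of_nat k :: complex)) = 1"
    by (simp add: norm_exp_eq_Re)
  then show ?thesis unfolding cusp_coeff_def by (simp add: norm_mult norm_power norm_power_int del: norm_exp_eq_Re)
qed

lemma norm_i_powi [simp]: "norm (\<i> powi n) = 1"
  by (simp add: norm_power_int)

end

locale theta_quotient_min = theta_quotient +
  assumes min: "\<And>\<kappa> l. 1 \<le> l \<Longrightarrow> l \<le> lcm_mod J m \<Longrightarrow> \<kappa> < l \<Longrightarrow>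
           Min ((\<lambda>j. Upsilon (lam_star (m j) (r j) \<kappa> l) * (real (gcd (m j) l))\<^sup>2 / real (m j)) ` {1..J})
             \<ge> Delta J m r \<delta> \<kappa> l / 24"
begin

text \<open>
  The minimum condition is transferred from the representatives \<open>(\<kappa>, l)\<close> to all pairs \<open>(h, k)\<close>.
\<close>

lemma Upsilon_ge_Delta:
  assumes j: "j \<in> {1..J}" and hk: "h < k"
  shows "Upsilon (lam_star (m j) (r j) h k) * (real (gcd (m j) k))\<^sup>2 / real (m j) \<ge> Delta J m r \<delta> h k / 24"
proof -
  define l where "l = class_rep L k"
  have l: "1 \<le> l" "l \<le> L" "[k = l] (mod L)" using class_rep_props[OF lcm_mod_pos, of k] hk by (auto simp: l_def)
  have c: "[h = h mod l] (mod l)" by (simp add: cong_def)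
  have l0: "l > 0" using l by simp
  have md: "m j dvd L" unfolding lcm_mod_def using j by (intro dvd_Lcm) auto
  have "Delta J m r \<delta> (h mod l) l / 24 \<le> Min ((\<lambda>j. Upsilon (lam_star (m j) (r j) (h mod l) l) * (real (gcd (m j) l))\<^sup>2 / real (m j)) ` {1..J})"
    using l l0 by (intro min) auto
  also have "\<dots> \<le> Upsilon (lam_star (m j) (r j) (h mod l) l) * (real (gcd (m j) l))\<^sup>2 / real (m j)"
    using j by (intro Min_le) auto
  finally show ?thesis
    unfolding Delta_cong[OF l(3) c l0] gcd_lam_star_cong[OF md l(3) c l0] .
qed

text \<open>
  The only unbounded part of the integrand on the arc around \<open>h/k\<close>.
\<close>

definition main_kernel :: "nat \<Rightarrow> nat \<Rightarrow> nat \<Rightarrow> complex \<Rightarrow> complex" where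
  "main_kernel n h k z = exp (of_real (2 * pi * (real n + Omega J m r \<delta> / 24)) * z +
     of_real (pi * Delta J m r \<delta> h k / (12 * (real k)\<^sup>2)) / z)"

text \<open>
  The product over all \<open>j\<close> is a constant times the kernel times \<open>R = 1 + O(t)\<close>, with
  \<open>t = exp (-(\<pi>/12) max(0, \<Delta>) Re (1/z)/k\<^sup>2)\<close>; that \<open>t\<close> is an admissible error for every factor
  is the minimum condition. The kernel has absolute value
  \<open>exp (2\<pi>n' Re z) exp ((\<pi>/12) \<Delta> Re (1/z)/k\<^sup>2)\<close>. For \<open>\<Delta> > 0\<close> its growth cancels against \<open>t\<close> in
  the error term, and for \<open>\<Delta> \<le> 0\<close> there is no growth.
\<close>

lemma integrand_near_cusp:
  assumes hb: "hbar_choice hb"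
  shows "\<exists>K\<ge>0. \<forall>n h k z. (h, k, z) \<in> cusp_configs \<longrightarrow> Re z > 0 \<longrightarrow>
    norm ((\<Prod>j=1..J. theta_prod (m j) (r j) (e2pi (of_nat h / of_nat k + \<i> * z)) powi \<delta> j) *
            e2pi (- of_nat n * (of_nat h / of_nat k + \<i> * z)) -
          (if Delta J m r \<delta> h k > 0 then \<i> powi (\<Sum>j=1..J. \<delta> j) * cusp_coeff hb n h k * main_kernel n h k z else 0))
      \<le> K * exp (2 * pi * (real n + Omega J m r \<delta> / 24) * Re z)"
proof -
  define t :: "nat \<times> nat \<times> complex \<Rightarrow> real" where
    "t = (\<lambda>(h, k, z). exp (- (pi * max 0 (Delta J m r \<delta> h k) / 12) * (Re (1 / z) / (real k)\<^sup>2)))"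
  define T where "T = (\<lambda>j h k z. tprod (of_real (lam_star (m j) (r j) h k) * cusp_tau (m j) k (hb (m j) h k) z +
         of_real (cusp_shift (m j) (r j) h k (hb (m j) h k))) (cusp_tau (m j) k (hb (m j) h k) z) powi \<delta> j)"
  have X: "Re (1 / z) / (real k)\<^sup>2 \<ge> 1 / 2" "h < k" "coprime h k" "0 < k" if "(h, k, z) \<in> cusp_configs" for h k z
    using that by (auto simp: cusp_configs_def)
  have t01: "0 \<le> t i \<and> t i \<le> 1" if "i \<in> cusp_configs" for i
  proof -
    obtain h k z where [simp]: "i = (h, k, z)" by (cases i)
    have "0 \<le> (pi * max 0 (Delta J m r \<delta> h k) / 12) * (Re (1 / z) / (real k)\<^sup>2)"
      using order_trans[OF _ X(1)[of h k z], of 0] that by (intro mult_nonneg_nonneg) auto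
    then show ?thesis by (simp add: t_def)
  qed
  have "\<forall>j\<in>{1..J}. \<exists>R. near_one cusp_configs t R \<and> (\<forall>h k z. (h, k, z) \<in> cusp_configs \<longrightarrow>
     T j h k z = cusp_const (m j) (r j) h k (hb (m j) h k) powi \<delta> j * R (h, k, z))"
  proof
    fix j assume j: "j \<in> {1..J}"
    show "\<exists>R. near_one cusp_configs t R \<and> (\<forall>h k z. (h, k, z) \<in> cusp_configs \<longrightarrow>
     T j h k z = cusp_const (m j) (r j) h k (hb (m j) h k) powi \<delta> j * R (h, k, z))"
      unfolding T_def
    proof (rule tprod_over_const_near_one[OF _ _ hb t01])
      fix h k z assume c: "(h, k, z) \<in> cusp_configs"
      let ?U = "Upsilon (lam_star (m j) (r j) h k) * (real (gcd (m j) k))\<^sup>2 / real (m j)"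
      let ?X = "Re (1 / z) / (real k)\<^sup>2"
      have "0 \<le> ?U" using Upsilon_le(3)[OF lam_star_bounds] by (intro divide_nonneg_nonneg mult_nonneg_nonneg) auto
      moreover have "max 0 x / 24 \<le> u" if "0 \<le> u" "x / 24 \<le> u" for x u :: real using that by (simp add: max_def)
      ultimately have "max 0 (Delta J m r \<delta> h k) / 24 \<le> ?U" using Upsilon_ge_Delta[OF j X(2)[OF c]] by blast
      then have "2 * pi * (max 0 (Delta J m r \<delta> h k) / 24) * ?X \<le> 2 * pi * ?U * ?X"
        using order_trans[OF _ X(1)[OF c], of 0] by (intro mult_right_mono mult_left_mono) auto
      then have "pi * max 0 (Delta J m r \<delta> h k) / 12 * ?X \<le> 2 * pi * ?U * ?X" by (simp add: mult_ac)
      then show "exp (- 2 * pi * ?U * ?X) \<le> t (h, k, z)" unfolding t_def by simp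
    qed (use mr[OF j] in auto)
  qed
  then obtain Rj where Rj: "\<And>j. j \<in> {1..J} \<Longrightarrow> near_one cusp_configs t (Rj j)"
    "\<And>j h k z. j \<in> {1..J} \<Longrightarrow> (h, k, z) \<in> cusp_configs \<Longrightarrow>
       T j h k z = cusp_const (m j) (r j) h k (hb (m j) h k) powi \<delta> j * Rj j (h, k, z)"
    by metis
  define R where "R = (\<lambda>i. \<Prod>j=1..J. Rj j i)"
  have "near_one cusp_configs t R" unfolding R_def by (rule near_one_prod[OF Rj(1) t01])
  then obtain K where K: "K \<ge> 0" "\<And>i. i \<in> cusp_configs \<Longrightarrow> norm (R i - 1) \<le> K * t i"
    unfolding near_one_def by blast
  obtain B where B: "B \<ge> 0" "\<And>h k. h < k \<Longrightarrow> coprime h k \<Longrightarrow> norm (Pi_factor J m r \<delta> hb h k) \<le> B"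
    using Pi_factor_bounded[OF hb] by blast
  have "norm ((\<Prod>j=1..J. theta_prod (m j) (r j) (e2pi (of_nat h / of_nat k + \<i> * z)) powi \<delta> j) *
            e2pi (- of_nat n * (of_nat h / of_nat k + \<i> * z)) -
          (if Delta J m r \<delta> h k > 0 then \<i> powi (\<Sum>j=1..J. \<delta> j) * cusp_coeff hb n h k * main_kernel n h k z else 0))
      \<le> B * (1 + K) * exp (2 * pi * (real n + Omega J m r \<delta> / 24) * Re z)"
    if c: "(h, k, z) \<in> cusp_configs" and z: "Re z > 0" for n h k z
  proof -
    define D where "D = Delta J m r \<delta> h k"
    define Xz where "Xz = Re (1 / z) / (real k)\<^sup>2"
    define W where "W = \<i> powi (\<Sum>j=1..J. \<delta> j) * cusp_coeff hb n h k"
    define a where "a = 2 * pi * (real n + Omega J m r \<delta> / 24)"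
    have Xz: "Xz \<ge> 0" using order_trans[OF _ X(1)[OF c], of 0] by (simp add: Xz_def)
    have "(\<Prod>j=1..J. T j h k z) = (\<Prod>j=1..J. cusp_const (m j) (r j) h k (hb (m j) h k) powi \<delta> j * Rj j (h, k, z))"
      by (intro prod.cong refl Rj(2) c)
    also have "\<dots> = Pi_factor J m r \<delta> hb h k * R (h, k, z)" by (simp only: prod.distrib Pi_factor_eq R_def)
    finally have PT: "(\<Prod>j=1..J. T j h k z) = Pi_factor J m r \<delta> hb h k * R (h, k, z)" .
    have en: "e2pi (- of_nat n * (of_nat h / of_nat k + \<i> * z)) =
       exp (- 2 * of_real pi * \<i> * of_nat n * of_nat h / of_nat k) * exp (2 * of_real pi * of_nat n * z)"
      unfolding e2pi_def mult_exp_exp by (intro arg_cong[where f = exp]) (simp add: algebra_simps)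
    have mk: "exp (2 * of_real pi * of_nat n * z) *
       exp (of_real pi / 12 * (of_real (Omega J m r \<delta>) * z + of_real (Delta J m r \<delta> h k) / ((of_nat k)\<^sup>2 * z))) = main_kernel n h k z"
      unfolding main_kernel_def mult_exp_exp by (intro arg_cong[where f = exp]) (simp add: algebra_simps)
    have prod_eq: "(\<Prod>j=1..J. theta_prod (m j) (r j) (e2pi (of_nat h / of_nat k + \<i> * z)) powi \<delta> j) =
      \<i> powi (\<Sum>j=1..J. \<delta> j) *
      ((- 1) powi (\<Sum>j=1..J. \<delta> j * lam (m j) (r j) h k) * (omega J m \<delta> h k)\<^sup>2 * D_factor J m r \<delta> hb h k) *
      exp (of_real pi / 12 * (of_real (Omega J m r \<delta>) * z + of_real (Delta J m r \<delta> h k) / ((of_nat k)\<^sup>2 * z))) *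
      (\<Prod>j=1..J. T j h k z)"
      unfolding T_def
      by (rule product_near_cusp[where J = J and m = m and r = r and \<delta> = \<delta> and hb = hb and h = h and k = k and z = z, OF _ hb X(2)[OF c] X(3)[OF c] z]) (rule mr)
    have eq: "(\<Prod>j=1..J. theta_prod (m j) (r j) (e2pi (of_nat h / of_nat k + \<i> * z)) powi \<delta> j) *
            e2pi (- of_nat n * (of_nat h / of_nat k + \<i> * z)) = W * main_kernel n h k z * R (h, k, z)"
      unfolding prod_eq en mk[symmetric] W_def cusp_coeff_def PT by (simp only: mult_ac)
    have nk: "norm (main_kernel n h k z) = exp (a * Re z) * exp (pi * D / 12 * Xz)"
    proof -
      have p: "x / (12 * q) * y = x / 12 * (y / q)" for x y q :: real by simp
      have "a * Re z + pi * D / (12 * (real k)\<^sup>2) * Re (1 / z) = a * Re z + pi * D / 12 * Xz"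
        unfolding Xz_def p ..
      moreover have "of_real y / z = of_real y * (1 / z)" for y by simp
      then have "main_kernel n h k z = exp (of_real a * z + of_real (pi * D / (12 * (real k)\<^sup>2)) * (1 / z))"
        unfolding main_kernel_def a_def D_def by (simp only:)
      moreover have "Re (of_real a * z + of_real y * w) = a * Re z + y * Re w" for y w by simp
      ultimately have "norm (main_kernel n h k z) = exp (a * Re z + pi * D / 12 * Xz)" by (simp only: norm_exp_eq_Re)
      then show ?thesis by (simp only: exp_add)
    qed
    have nW: "norm W \<le> B" using B(2)[OF X(2)[OF c] X(3)[OF c]] by (simp add: W_def norm_mult norm_cusp_coeff)
    show ?thesis
    proof (cases "D > 0")
      case True
      have "W * main_kernel n h k z * R (h, k, z) - W * main_kernel n h k z = W * (main_kernel n h k z * (R (h, k, z) - 1))"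
        by (simp add: algebra_simps)
      then have "norm (W * main_kernel n h k z * R (h, k, z) - W * main_kernel n h k z) =
         norm W * (norm (main_kernel n h k z) * norm (R (h, k, z) - 1))"
        by (simp only: norm_mult)
      also have "\<dots> \<le> B * (norm (main_kernel n h k z) * (K * t (h, k, z)))"
        using nW K(2)[OF c] B(1) by (intro mult_mono mult_left_mono) auto
      also have "norm (main_kernel n h k z) * (K * t (h, k, z)) = K * exp (a * Re z)"
      proof -
        have "t (h, k, z) = exp (- (pi * D / 12) * Xz)"
          using True by (simp add: t_def Xz_def D_def max_def)
        then have "exp (pi * D / 12 * Xz) * t (h, k, z) = 1" by (simp add: mult_exp_exp)
        then have "(exp (a * Re z) * K) * (exp (pi * D / 12 * Xz) * t (h, k, z)) = exp (a * Re z) * K" by simp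
        then show ?thesis unfolding nk by (simp only: mult_ac)
      qed
      also have "B * (K * exp (a * Re z)) \<le> B * (1 + K) * exp (a * Re z)"
        using B(1) by (simp add: algebra_simps)
      finally show ?thesis using True unfolding eq D_def a_def W_def by simp
    next
      case False
      have "norm (W * main_kernel n h k z * R (h, k, z)) = norm W * (norm (main_kernel n h k z) * norm (R (h, k, z)))"
        by (simp only: norm_mult mult.assoc)
      also have "\<dots> \<le> B * (exp (a * Re z) * (1 + K))"
      proof (intro mult_mono nW B(1))
        have "pi * D / 12 * Xz \<le> 0" using False Xz by (intro mult_nonpos_nonneg) (auto simp: divide_nonpos_pos mult_nonneg_nonpos)
        then show "norm (main_kernel n h k z) \<le> exp (a * Re z)" unfolding nk by (simp add: mult_left_le)
        have "K * t (h, k, z) \<le> K" using K(1) t01[OF c] by (simp add: mult_left_le)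
        then show "norm (R (h, k, z)) \<le> 1 + K"
          using K(2)[OF c] norm_triangle_ineq[of "R (h, k, z) - 1" 1] by simp
      qed auto
      finally show ?thesis using False unfolding eq D_def a_def by (simp add: mult_ac)
    qed
  qed
  moreover have "B * (1 + K) \<ge> 0" using B(1) K(1) by simp
  ultimately show ?thesis by blast
qed

end

section \<open>Summation over the arcs\<close>

text \<open>
  For \<open>z = \<rho> - ix\<close> with \<open>\<rho> = 1/N\<^sup>2\<close> both \<open>k\<^sup>2\<rho>\<^sup>2\<close> and \<open>k\<^sup>2x\<^sup>2\<close> are at most \<open>\<rho>\<close>, so
  \<open>Re (1/z)/k\<^sup>2 = \<rho>/(k\<^sup>2(\<rho>\<^sup>2 + x\<^sup>2)) \<ge> 1/2\<close>.
\<close>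

lemma cusp_configs_on_farey_arc:
  fixes N h k :: nat and x :: real
  assumes "(h, k) \<in> farey_fractions N" "\<bar>x\<bar> \<le> 1 / (real k * real N)"
  shows "(h, k, Complex (1 / (real N)\<^sup>2) (- x)) \<in> cusp_configs"
proof -
  have k: "1 \<le> k" "k \<le> N" "h < k" "coprime h k" using assms(1) by (auto simp: farey_fractions_def)
  define \<rho> where "\<rho> = 1 / (real N)\<^sup>2"
  have N: "real N > 0" "real k > 0" using k by auto
  have \<rho>: "\<rho> > 0" using N by (simp add: \<rho>_def)
  have kN: "(real k)\<^sup>2 \<le> (real N)\<^sup>2" using k by simp
  have "(real k)\<^sup>2 * \<rho> \<le> 1" using kN N by (simp add: \<rho>_def)
  then have 1: "(real k)\<^sup>2 * \<rho> * \<rho> \<le> \<rho>" using \<rho> by simp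
  have "x\<^sup>2 \<le> (1 / (real k * real N))\<^sup>2" using assms(2) by (metis abs_le_square_iff abs_ge_zero abs_of_nonneg order_trans)
  then have "(real k)\<^sup>2 * x\<^sup>2 \<le> (real k)\<^sup>2 * (1 / (real k * real N))\<^sup>2" by (intro mult_left_mono) auto
  also have "\<dots> = \<rho>" using N by (simp add: \<rho>_def power_divide power_mult_distrib)
  finally have le: "(\<rho>\<^sup>2 + x\<^sup>2) * (real k)\<^sup>2 \<le> 2 * \<rho>" using 1 by (simp add: power2_eq_square algebra_simps)
  have pos: "(\<rho>\<^sup>2 + x\<^sup>2) * (real k)\<^sup>2 > 0" using \<rho> N by (intro mult_pos_pos add_pos_nonneg) auto
  have "1 / 2 = \<rho> / (2 * \<rho>)" using \<rho> by simp
  also have "\<dots> \<le> \<rho> / ((\<rho>\<^sup>2 + x\<^sup>2) * (real k)\<^sup>2)"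
    using le pos \<rho> by (intro divide_left_mono) auto
  also have "\<dots> = Re (1 / Complex \<rho> (- x)) / (real k)\<^sup>2" by (simp add: Re_divide)
  finally show ?thesis using k unfolding cusp_configs_def \<rho>_def by auto
qed

context theta_quotient
begin

lemma Delta_bounded: "\<exists>M\<ge>0. \<forall>h k. h < k \<longrightarrow> Delta J m r \<delta> h k \<le> M"
proof -
  define V where "V = (\<lambda>(h, k). \<bar>Delta J m r \<delta> h k\<bar>) ` ({..L} \<times> {..L})"
  have V: "finite V" "V \<noteq> {}" by (auto simp: V_def)
  have "Delta J m r \<delta> h k \<le> Max V" if "h < k" for h k
  proof -
    define l where "l = class_rep L k"
    have l: "1 \<le> l" "l \<le> L" "[k = l] (mod L)" using class_rep_props[OF lcm_mod_pos, of k] that by (auto simp: l_def)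
    have c: "[h = h mod l] (mod l)" by (simp add: cong_def)
    have l0: "l > 0" using l by simp
    have "h mod l < l" using l0 by simp
    then have "h mod l \<le> L" using l(2) by linarith
    then have "\<bar>Delta J m r \<delta> (h mod l) l\<bar> \<in> V" unfolding V_def using l(2)
      by (intro image_eqI[of _ _ "(h mod l, l)"]) auto
    then have "\<bar>Delta J m r \<delta> (h mod l) l\<bar> \<le> Max V" using V by simp
    then show ?thesis unfolding Delta_cong[OF l(3) c l0] by linarith
  qed
  moreover have "Max V \<ge> 0" using V by (auto simp: Max_ge_iff V_def)
  ultimately show ?thesis by blast
qed

text \<open>
  The value of the integral of the kernel over the arc, up to the error of closing the contour.
\<close>

definition arc_main :: "nat \<Rightarrow> nat \<Rightarrow> nat \<Rightarrow> real" where
  "arc_main n h k = 2 * pi * (((24 * real n + Omega J m r \<delta>) / Delta J m r \<delta> h k) powr (- 1 / 2) *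
     (1 / real k * bessel_I (- 1) (pi / (6 * real k) * sqrt (Delta J m r \<delta> h k * (24 * real n + Omega J m r \<delta>)))))"

lemma arc_main_eq:
  assumes n: "24 * real n + Omega J m r \<delta> > 0" and k: "k > 0" and D: "Delta J m r \<delta> h k > 0"
  defines "a \<equiv> 2 * pi * (real n + Omega J m r \<delta> / 24)" and "b \<equiv> pi * Delta J m r \<delta> h k / (12 * (real k)\<^sup>2)"
  shows "2 * pi * (sqrt (b / a) * bessel_I (- 1) (2 * sqrt (a * b))) = arc_main n h k"
proof -
  define A where "A = 24 * real n + Omega J m r \<delta>"
  define D' where "D' = Delta J m r \<delta> h k"
  have a: "a = pi * A / 12" by (simp add: a_def A_def field_simps)
  have b: "b = pi * D' / (12 * (real k)\<^sup>2)" by (simp add: b_def D'_def)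
  have pos: "A > 0" "D' > 0" "real k > 0" using n k D by (auto simp: A_def D'_def)
  have "b / a = (D' / A) * (1 / real k)\<^sup>2" using pos by (simp add: a b field_simps power2_eq_square)
  then have "sqrt (b / a) = sqrt (D' / A) * (1 / real k)"
    using pos by (simp add: real_sqrt_mult real_sqrt_divide)
  also have "sqrt (D' / A) = (A / D') powr (- 1 / 2)"
  proof -
    have "(A / D') powr (- 1 / 2) = inverse ((A / D') powr (1 / 2))" by (simp add: powr_minus[symmetric])
    also have "(A / D') powr (1 / 2) = sqrt (A / D')" using pos by (simp add: powr_half_sqrt)
    finally show ?thesis by (simp add: real_sqrt_divide)
  qed
  finally have 1: "sqrt (b / a) = (A / D') powr (- 1 / 2) * (1 / real k)" .
  have "a * b = (pi / (12 * real k))\<^sup>2 * (D' * A)" using pos by (simp add: a b field_simps power2_eq_square)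
  then have "sqrt (a * b) = pi / (12 * real k) * sqrt (D' * A)"
    using pos by (simp add: real_sqrt_mult)
  then have 2: "2 * sqrt (a * b) = pi / (6 * real k) * sqrt (D' * A)" by simp
  show ?thesis unfolding 1 2 arc_main_def A_def[symmetric] D'_def[symmetric] by (simp only: mult_ac)
qed

lemma finite_L_pos: "finite (L_pos J m r \<delta>)"
  by (rule finite_subset[of _ "{..L} \<times> {..L}"]) (auto simp: L_pos_def)

text \<open>
  Each Farey fraction \<open>h/k\<close> with \<open>\<Delta>(h, k) > 0\<close> belongs to exactly one pair \<open>(\<kappa>, l)\<close>: \<open>l\<close> is the
  representative of \<open>k\<close> modulo \<open>L\<close>, and \<open>\<kappa> = h mod l\<close>.
\<close>

lemma regroup_sum_by_class:
  fixes u :: "real \<Rightarrow> complex" and \<beta> :: "real \<Rightarrow> nat \<Rightarrow> complex" and w :: "nat \<Rightarrow> nat \<Rightarrow> complex"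
  shows "(\<Sum>(\<kappa>, l) \<in> L_pos J m r \<delta>. u (Delta J m r \<delta> \<kappa> l) *
            (\<Sum>k \<in> {k \<in> {1..N}. [k = l] (mod L)}. \<beta> (Delta J m r \<delta> \<kappa> l) k *
              (\<Sum>h \<in> {h \<in> {0..<k}. coprime h k \<and> [h = \<kappa>] (mod l)}. w h k))) =
     (\<Sum>(h, k) \<in> {(h, k) \<in> farey_fractions N. Delta J m r \<delta> h k > 0}.
         u (Delta J m r \<delta> h k) * (\<beta> (Delta J m r \<delta> h k) k * w h k))"
proof -
  define S where "S = {(h, k) \<in> farey_fractions N. Delta J m r \<delta> h k > 0}"
  define V where "V = (\<lambda>(h, k). u (Delta J m r \<delta> h k) * (\<beta> (Delta J m r \<delta> h k) k * w h k))"
  define rep where "rep = (\<lambda>(h, k). (h mod class_rep L k, class_rep L k))"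
  have finS: "finite S" unfolding S_def by (rule finite_subset[OF _ finite_farey_fractions[of N]]) auto
  have Dr: "Delta J m r \<delta> h k = Delta J m r \<delta> (h mod class_rep L k) (class_rep L k)"
    "1 \<le> class_rep L k" "class_rep L k \<le> L" "[k = class_rep L k] (mod L)" if "k > 0" for h k
  proof -
    show l: "1 \<le> class_rep L k" "class_rep L k \<le> L" "[k = class_rep L k] (mod L)"
      using class_rep_props[OF lcm_mod_pos that] by auto
    show "Delta J m r \<delta> h k = Delta J m r \<delta> (h mod class_rep L k) (class_rep L k)"
      by (rule Delta_cong[OF l(3)]) (use l in \<open>auto simp: cong_def\<close>)
  qed
  have img: "rep ` S \<subseteq> L_pos J m r \<delta>"
  proof
    fix y assume "y \<in> rep ` S"
    then obtain h k where hk: "(h, k) \<in> S" "y = rep (h, k)" by auto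
    have "k > 0" "Delta J m r \<delta> h k > 0" using hk(1) by (auto simp: S_def farey_fractions_def)
    then show "y \<in> L_pos J m r \<delta>" using Dr(1)[of k h] Dr(2,3)[of k] unfolding hk(2) rep_def by (simp add: L_pos_def)
  qed
  have "(\<Sum>(\<kappa>, l) \<in> L_pos J m r \<delta>. u (Delta J m r \<delta> \<kappa> l) *
            (\<Sum>k \<in> {k \<in> {1..N}. [k = l] (mod L)}. \<beta> (Delta J m r \<delta> \<kappa> l) k *
              (\<Sum>h \<in> {h \<in> {0..<k}. coprime h k \<and> [h = \<kappa>] (mod l)}. w h k))) =
     (\<Sum>y \<in> L_pos J m r \<delta>. sum V {x \<in> S. rep x = y})"
  proof (intro sum.cong refl)
    fix y assume y: "y \<in> L_pos J m r \<delta>"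
    obtain \<kappa> l where [simp]: "y = (\<kappa>, l)" by (cases y)
    have l: "1 \<le> l" "l \<le> L" "\<kappa> < l" "Delta J m r \<delta> \<kappa> l > 0" using y by (auto simp: L_pos_def)
    let ?A = "{k \<in> {1..N}. [k = l] (mod L)}"
    let ?B = "\<lambda>k. {h \<in> {0..<k}. coprime h k \<and> [h = \<kappa>] (mod l)}"
    let ?D = "Delta J m r \<delta> \<kappa> l"
    have mem: "(h, k) \<in> S \<and> rep (h, k) = y \<longleftrightarrow> k \<in> ?A \<and> h \<in> ?B k" for h k
    proof
      assume *: "(h, k) \<in> S \<and> rep (h, k) = y"
      then have k: "1 \<le> k" "k \<le> N" "h < k" "coprime h k" by (auto simp: S_def farey_fractions_def)
      have "class_rep L k = l" "h mod l = \<kappa>" using * by (auto simp: rep_def)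
      then show "k \<in> ?A \<and> h \<in> ?B k" using k Dr(4)[of k] by (auto simp: cong_def)
    next
      assume *: "k \<in> ?A \<and> h \<in> ?B k"
      then have k: "1 \<le> k" "k \<le> N" "h < k" "coprime h k" "[k = l] (mod L)" "[h = \<kappa>] (mod l)" by auto
      have "class_rep L k = l" using class_rep_unique[OF l(1,2) k(5)] k(1) by simp
      moreover have "h mod l = \<kappa>" using k(6) l(3) by (simp add: cong_def)
      moreover have "Delta J m r \<delta> h k = ?D" by (rule Delta_cong[OF k(5,6)]) (use l in simp)
      ultimately show "(h, k) \<in> S \<and> rep (h, k) = y" using k l by (auto simp: S_def farey_fractions_def rep_def)
    qed
    have DS: "Delta J m r \<delta> h k = ?D" if "k \<in> ?A" "h \<in> ?B k" for h k
      by (rule Delta_cong) (use that l in auto)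
    have "(case y of (\<kappa>, l) \<Rightarrow> u (Delta J m r \<delta> \<kappa> l) *
            (\<Sum>k \<in> {k \<in> {1..N}. [k = l] (mod L)}. \<beta> (Delta J m r \<delta> \<kappa> l) k *
              (\<Sum>h \<in> {h \<in> {0..<k}. coprime h k \<and> [h = \<kappa>] (mod l)}. w h k))) =
      (\<Sum>k\<in>?A. \<Sum>h\<in>?B k. u ?D * (\<beta> ?D k * w h k))"
      by (simp add: sum_distrib_left)
    also have "\<dots> = (\<Sum>(k, h)\<in>Sigma ?A ?B. u ?D * (\<beta> ?D k * w h k))"
      by (rule sum.Sigma) auto
    also have "\<dots> = sum V {x \<in> S. rep x = y}"
    proof (rule sum.reindex_bij_witness[of _ "\<lambda>(h, k). (k, h)" "\<lambda>(k, h). (h, k)"])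
      fix p assume "p \<in> Sigma ?A ?B"
      then obtain k h where p: "p = (k, h)" "k \<in> ?A" "h \<in> ?B k" by blast
      show "(case p of (k, h) \<Rightarrow> (h, k)) \<in> {x \<in> S. rep x = y}" using mem[of h k] p by simp
      show "V (case p of (k, h) \<Rightarrow> (h, k)) = (case p of (k, h) \<Rightarrow> u ?D * (\<beta> ?D k * w h k))"
        using DS[OF p(2,3)] by (simp add: p(1) V_def)
      show "(case (case p of (k, h) \<Rightarrow> (h, k)) of (h, k) \<Rightarrow> (k, h)) = p" by (simp add: p(1))
    next
      fix p assume q: "p \<in> {x \<in> S. rep x = y}"
      obtain h k where p: "p = (h, k)" by (cases p)
      show "(case p of (h, k) \<Rightarrow> (k, h)) \<in> Sigma ?A ?B" using mem[of h k] q by (simp add: p)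
      show "(case (case p of (h, k) \<Rightarrow> (k, h)) of (k, h) \<Rightarrow> (h, k)) = p" by (simp add: p)
    qed
    finally show "(case y of (\<kappa>, l) \<Rightarrow> u (Delta J m r \<delta> \<kappa> l) *
            (\<Sum>k \<in> {k \<in> {1..N}. [k = l] (mod L)}. \<beta> (Delta J m r \<delta> \<kappa> l) k *
              (\<Sum>h \<in> {h \<in> {0..<k}. coprime h k \<and> [h = \<kappa>] (mod l)}. w h k))) = sum V {x \<in> S. rep x = y}" .
  qed
  also have "\<dots> = sum V S" by (rule sum.group[OF finS finite_L_pos img])
  finally show ?thesis unfolding V_def S_def .
qed

end

context theta_quotient_min
begin

text \<open>
  The complete main term of the arc around \<open>h/k\<close>, which is nonzero only for \<open>\<Delta> > 0\<close>.
\<close>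

definition arc_term :: "(nat \<Rightarrow> nat \<Rightarrow> nat \<Rightarrow> int) \<Rightarrow> nat \<Rightarrow> nat \<Rightarrow> nat \<Rightarrow> complex" where
  "arc_term hb n h k = (if Delta J m r \<delta> h k > 0
     then \<i> powi (\<Sum>j=1..J. \<delta> j) * cusp_coeff hb n h k * of_real (arc_main n h k) else 0)"

definition integrand :: "nat \<Rightarrow> complex \<Rightarrow> complex" where
  "integrand n \<tau> = (\<Prod>j=1..J. theta_prod (m j) (r j) (e2pi \<tau>) powi \<delta> j) * e2pi (- of_nat n * \<tau>)"

text \<open>
  The arc has length at most \<open>2/(kN)\<close> and the height of the contour is \<open>1/N\<^sup>2 \<le> 1/(kN)\<close>. So a
  bounded error in the integrand, the two horizontal sides of the rectangle and its left side all
  contribute \<open>O(1/(kN))\<close>. The two hypotheses on \<open>n\<close> and \<open>N\<close> keep \<open>exp (2\<pi>n'/N\<^sup>2)\<close> bounded.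
\<close>

lemma integral_over_farey_arc:
  assumes hb: "hbar_choice hb"
  shows "\<exists>C\<ge>0. \<forall>n N h k t t'. N \<ge> 1 \<longrightarrow> 24 * real n + Omega J m r \<delta> > 0 \<longrightarrow>
      2 * pi * (real n + Omega J m r \<delta> / 24) \<le> 4 * (real N)\<^sup>2 \<longrightarrow> (h, k) \<in> farey_fractions N \<longrightarrow>
      1 / (2 * real k * real N) \<le> t \<and> t \<le> 1 / (real k * real N) \<longrightarrow>
      1 / (2 * real k * real N) \<le> t' \<and> t' \<le> 1 / (real k * real N) \<longrightarrow>
      continuous_on {-t..t'} (\<lambda>x. integrand n (of_nat h / of_nat k + \<i> * Complex (1 / (real N)\<^sup>2) (- x))) \<longrightarrow>
      norm (integral {-t..t'} (\<lambda>x. integrand n (of_nat h / of_nat k + \<i> * Complex (1 / (real N)\<^sup>2) (- x))) -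
            arc_term hb n h k) \<le> C * (1 / (real k * real N))"
proof -
  obtain K where K: "K \<ge> 0" "\<And>n h k z. (h, k, z) \<in> cusp_configs \<Longrightarrow> Re z > 0 \<Longrightarrow>
    norm (integrand n (of_nat h / of_nat k + \<i> * z) -
          (if Delta J m r \<delta> h k > 0 then \<i> powi (\<Sum>j=1..J. \<delta> j) * cusp_coeff hb n h k * main_kernel n h k z else 0))
      \<le> K * exp (2 * pi * (real n + Omega J m r \<delta> / 24) * Re z)"
    using integrand_near_cusp[OF hb] unfolding integrand_def by blast
  obtain B where B: "B \<ge> 0" "\<And>h k. h < k \<Longrightarrow> coprime h k \<Longrightarrow> norm (Pi_factor J m r \<delta> hb h k) \<le> B"
    using Pi_factor_bounded[OF hb] by blast
  obtain M where M: "M \<ge> 0" "\<And>h k. h < k \<Longrightarrow> Delta J m r \<delta> h k \<le> M" using Delta_bounded by blast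
  define C where "C = 2 * K * exp 4 + B * (2 + 4 * exp (4 + pi * M / 3))"
  have C0: "C \<ge> 0" using K(1) B(1) by (simp add: C_def)
  have "norm (integral {-t..t'} (\<lambda>x. integrand n (of_nat h / of_nat k + \<i> * Complex (1 / (real N)\<^sup>2) (- x))) -
            arc_term hb n h k) \<le> C * (1 / (real k * real N))"
    if N: "N \<ge> 1" and pos: "24 * real n + Omega J m r \<delta> > 0"
      and aN: "2 * pi * (real n + Omega J m r \<delta> / 24) \<le> 4 * (real N)\<^sup>2" and hk: "(h, k) \<in> farey_fractions N"
      and tb: "1 / (2 * real k * real N) \<le> t \<and> t \<le> 1 / (real k * real N)"
        "1 / (2 * real k * real N) \<le> t' \<and> t' \<le> 1 / (real k * real N)"
      and cont: "continuous_on {-t..t'} (\<lambda>x. integrand n (of_nat h / of_nat k + \<i> * Complex (1 / (real N)\<^sup>2) (- x)))"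
    for n N h k t t'
  proof -
    define a where "a = 2 * pi * (real n + Omega J m r \<delta> / 24)"
    define \<rho> where "\<rho> = 1 / (real N)\<^sup>2"
    have a0: "a > 0" using pos by (simp add: a_def)
    have \<rho>0: "\<rho> > 0" using N by (simp add: \<rho>_def)
    have a\<rho>: "a * \<rho> \<le> 4" using aN N by (simp add: a_def \<rho>_def divide_simps)
    have k: "1 \<le> k" "k \<le> N" "h < k" "coprime h k" using hk by (auto simp: farey_fractions_def)
    define E where "E = 1 / (real k * real N)"
    have E0: "E > 0" using k by (simp add: E_def)
    have "1 / (2 * real k * real N) = E / 2" by (simp add: E_def)
    then have t: "E / 2 \<le> t" "t \<le> E" "E / 2 \<le> t'" "t' \<le> E"
      using tb by (auto simp: E_def)
    have t0: "t > 0" "t' > 0" using t E0 by linarith+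
    have \<rho>E: "\<rho> \<le> E"
      unfolding \<rho>_def E_def power2_eq_square using k by (intro divide_left_mono mult_right_mono mult_pos_pos) auto
    define z where "z = (\<lambda>x. Complex \<rho> (- x))"
    define G where "G = (\<lambda>x. integrand n (of_nat h / of_nat k + \<i> * z x))"
    have G_cont: "continuous_on {-t..t'} G" using cont by (simp add: G_def z_def \<rho>_def)
    have conf: "(h, k, z x) \<in> cusp_configs" if "x \<in> {-t..t'}" for x
      unfolding z_def \<rho>_def by (rule cusp_configs_on_farey_arc[OF hk]) (use that t in \<open>auto simp: E_def abs_le_iff\<close>)
    define W where "W = \<i> powi (\<Sum>j=1..J. \<delta> j) * cusp_coeff hb n h k"
    have nW: "norm W \<le> B" using B(2)[OF k(3,4)] by (simp add: W_def norm_mult norm_cusp_coeff)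
    define Mx where "Mx = (\<lambda>x. if Delta J m r \<delta> h k > 0 then W * main_kernel n h k (z x) else 0)"
    have zx0: "z x \<noteq> 0" for x using \<rho>0 by (simp add: z_def complex_eq_iff)
    have z_cont: "continuous_on {-t..t'} z" unfolding z_def Complex_eq by (intro continuous_intros)
    have mk_cont: "continuous_on {-t..t'} (\<lambda>x. main_kernel n h k (z x))"
      unfolding main_kernel_def by (intro continuous_intros z_cont) (use zx0 in auto)
    have Mx_cont: "continuous_on {-t..t'} Mx"
      unfolding Mx_def by (cases "Delta J m r \<delta> h k > 0") (simp_all add: mk_cont continuous_on_mult_left)
    have pt: "norm (G x - Mx x) \<le> K * exp 4" if x: "x \<in> {-t..t'}" for x
    proof -
      have "norm (G x - Mx x) \<le> K * exp (a * Re (z x))"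
        using K(2)[OF conf[OF x], of n] \<rho>0 unfolding G_def Mx_def W_def a_def by (simp add: z_def)
      also have "\<dots> \<le> K * exp 4" using K(1) a\<rho> by (intro mult_left_mono) (auto simp: z_def)
      finally show ?thesis .
    qed
    have "norm (integral {-t..t'} (\<lambda>x. G x - Mx x)) \<le> K * exp 4 * (t' - (- t))"
      by (rule integral_bound[OF _ _ pt]) (use t0 G_cont Mx_cont in \<open>auto intro!: continuous_intros\<close>)
    also have "\<dots> \<le> K * exp 4 * (2 * E)" using K(1) t by (intro mult_left_mono) auto
    finally have b1: "norm (integral {-t..t'} (\<lambda>x. G x - Mx x)) \<le> 2 * K * exp 4 * E" by simp
    have split: "integral {-t..t'} (\<lambda>x. G x - Mx x) = integral {-t..t'} G - integral {-t..t'} Mx"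
      by (intro integral_diff integrable_continuous_interval G_cont Mx_cont)
    have b2: "norm (integral {-t..t'} Mx - arc_term hb n h k) \<le> B * (2 + 4 * exp (4 + pi * M / 3)) * E"
    proof (cases "Delta J m r \<delta> h k > 0")
      case False
      then show ?thesis using B(1) E0 by (simp add: Mx_def arc_term_def)
    next
      case True
      define b where "b = pi * Delta J m r \<delta> h k / (12 * (real k)\<^sup>2)"
      have b0: "b > 0" using True k by (simp add: b_def)
      \<comment> \<open>Each part of the arc has at least the length \<open>1/(2kN)\<close>, so \<open>b\<rho>/s\<^sup>2 \<le> \<pi>\<Delta>/3\<close> uniformly in \<open>k\<close> and \<open>N\<close>.\<close>
      have bb: "a * \<rho> + b * \<rho> / s\<^sup>2 \<le> 4 + pi * M / 3" if s: "E / 2 \<le> s" for s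
      proof -
        have "(E / 2)\<^sup>2 \<le> s\<^sup>2" using s E0 by (intro power_mono) auto
        then have "b * \<rho> / s\<^sup>2 \<le> b * \<rho> / (E / 2)\<^sup>2"
          using b0 \<rho>0 E0 s by (intro divide_left_mono mult_pos_pos) auto
        also have "\<dots> = pi * Delta J m r \<delta> h k / 3"
          using k N by (simp add: b_def \<rho>_def E_def field_simps power2_eq_square)
        also have "\<dots> \<le> pi * M / 3" using M(2)[OF k(3)] by simp
        finally show ?thesis using add_mono[OF a\<rho>] by blast
      qed
      have mk: "main_kernel n h k (z x) = exp (of_real a * Complex \<rho> (- x) + of_real b / Complex \<rho> (- x))" for x
        by (simp only: main_kernel_def a_def b_def z_def)
      have am: "2 * pi * (sqrt (b / a) * bessel_I (- 1) (2 * sqrt (a * b))) = arc_main n h k"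
        unfolding a_def b_def by (rule arc_main_eq[OF pos _ True]) (use k in simp)
      have "norm (integral {-t..t'} (\<lambda>x. main_kernel n h k (z x)) - of_real (arc_main n h k))
          \<le> t + t' + 4 * \<rho> * exp (4 + pi * M / 3)"
        unfolding mk am[symmetric]
        by (rule integral_exp_near_cusp[OF a0 b0 \<rho>0 t0 bb bb]) (use t in auto)
      also have "\<dots> \<le> E + E + 4 * E * exp (4 + pi * M / 3)"
        using t \<rho>E by (intro add_mono mult_right_mono) auto
      finally have n1: "norm (integral {-t..t'} (\<lambda>x. main_kernel n h k (z x)) - of_real (arc_main n h k))
          \<le> (2 + 4 * exp (4 + pi * M / 3)) * E" by (simp add: algebra_simps)
      have "integral {-t..t'} Mx - arc_term hb n h k = W * (integral {-t..t'} (\<lambda>x. main_kernel n h k (z x)) - of_real (arc_main n h k))"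
        using True by (simp add: Mx_def arc_term_def W_def algebra_simps)
      then have "norm (integral {-t..t'} Mx - arc_term hb n h k) = norm W * norm (integral {-t..t'} (\<lambda>x. main_kernel n h k (z x)) - of_real (arc_main n h k))"
        by (simp only: norm_mult)
      also have "\<dots> \<le> B * ((2 + 4 * exp (4 + pi * M / 3)) * E)"
        by (rule mult_mono[OF nW n1 B(1)]) simp
      finally show ?thesis by (simp only: mult.assoc)
    qed
    have "integral {-t..t'} G - arc_term hb n h k =
       integral {-t..t'} (\<lambda>x. G x - Mx x) + (integral {-t..t'} Mx - arc_term hb n h k)"
      unfolding split by simp
    then have "norm (integral {-t..t'} G - arc_term hb n h k) \<le>
       2 * K * exp 4 * E + B * (2 + 4 * exp (4 + pi * M / 3)) * E"
      using norm_triangle_mono[OF b1 b2] by (simp only:)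
    also have "\<dots> = C * E" by (simp add: C_def algebra_simps)
    finally show ?thesis unfolding G_def z_def \<rho>_def E_def .
  qed
  then show ?thesis using C0 by blast
qed

text \<open>
  At most \<open>k\<close> fractions have the denominator \<open>k\<close>, so the errors \<open>O(1/(kN))\<close> of the arcs add up to
  \<open>O(1)\<close>.
\<close>

lemma coefficient_minus_arc_terms_bounded:
  assumes hb: "hbar_choice hb"
    and g: "\<And>q :: complex. norm q < 1 \<Longrightarrow>
           (\<lambda>n. g n * q ^ n) sums (\<Prod>j=1..J. theta_prod (m j) (r j) q powi \<delta> j)"
  shows "\<exists>C\<ge>0. \<forall>n N. N \<ge> 1 \<longrightarrow> 24 * real n + Omega J m r \<delta> > 0 \<longrightarrow>
      2 * pi * (real n + Omega J m r \<delta> / 24) \<le> 4 * (real N)\<^sup>2 \<longrightarrow>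
      norm (g n - (\<Sum>(h, k)\<in>farey_fractions N. arc_term hb n h k)) \<le> C"
proof -
  obtain C where C0: "C \<ge> 0" and C: "\<And>n N h k t t'. N \<ge> 1 \<Longrightarrow> 24 * real n + Omega J m r \<delta> > 0 \<Longrightarrow>
      2 * pi * (real n + Omega J m r \<delta> / 24) \<le> 4 * (real N)\<^sup>2 \<Longrightarrow> (h, k) \<in> farey_fractions N \<Longrightarrow>
      1 / (2 * real k * real N) \<le> t \<and> t \<le> 1 / (real k * real N) \<Longrightarrow>
      1 / (2 * real k * real N) \<le> t' \<and> t' \<le> 1 / (real k * real N) \<Longrightarrow>
      continuous_on {-t..t'} (\<lambda>x. integrand n (of_nat h / of_nat k + \<i> * Complex (1 / (real N)\<^sup>2) (- x))) \<Longrightarrow>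
      norm (integral {-t..t'} (\<lambda>x. integrand n (of_nat h / of_nat k + \<i> * Complex (1 / (real N)\<^sup>2) (- x))) -
            arc_term hb n h k) \<le> C * (1 / (real k * real N))"
    using integral_over_farey_arc[OF hb] by blast
  have "norm (g n - (\<Sum>(h, k)\<in>farey_fractions N. arc_term hb n h k)) \<le> C"
    if N: "N \<ge> 1" and pos: "24 * real n + Omega J m r \<delta> > 0"
      and aN: "2 * pi * (real n + Omega J m r \<delta> / 24) \<le> 4 * (real N)\<^sup>2" for n N
  proof -
    define \<rho> where "\<rho> = 1 / (real N)\<^sup>2"
    have \<rho>0: "\<rho> > 0" using N by (simp add: \<rho>_def)
    obtain \<Phi> where \<Phi>: "\<And>\<tau>. Im \<tau> > 0 \<Longrightarrow> (\<Phi> has_field_derivative integrand n \<tau>) (at \<tau>)"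
      "\<And>\<tau>. \<Phi> (\<tau> + 1) = \<Phi> \<tau> + g n"
      using coefficient_primitive[of g "\<lambda>q. \<Prod>j=1..J. theta_prod (m j) (r j) q powi \<delta> j" n] g
      unfolding integrand_def by blast
    define \<Psi> where "\<Psi> = (\<lambda>x. \<Phi> (of_real x + \<i> * of_real \<rho>))"
    obtain \<theta> \<theta>' where \<theta>: "\<And>h k. (h, k) \<in> farey_fractions N \<Longrightarrow> 1 / (2 * real k * real N) \<le> \<theta> (h, k) \<and> \<theta> (h, k) \<le> 1 / (real k * real N)"
      and \<theta>': "\<And>h k. (h, k) \<in> farey_fractions N \<Longrightarrow> 1 / (2 * real k * real N) \<le> \<theta>' (h, k) \<and> \<theta>' (h, k) \<le> 1 / (real k * real N)"
      and diss: "\<And>(\<Phi> :: real \<Rightarrow> complex) D. (\<And>x. \<Phi> (x + 1) = \<Phi> x + D) \<Longrightarrow>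
      (\<Sum>(h, k)\<in>farey_fractions N. \<Phi> (real h / real k + \<theta>' (h, k)) - \<Phi> (real h / real k - \<theta> (h, k))) = D"
      using farey_dissection[OF N] by blast
    have "\<Psi> (x + 1) = \<Psi> x + g n" for x
      using \<Phi>(2)[of "of_real x + \<i> * of_real \<rho>"] by (simp add: \<Psi>_def add_ac)
    note gn = diss[of \<Psi> "g n", OF this]
    have int_cont: "continuous_on {\<tau>. Im \<tau> > 0} (integrand n)"
    proof -
      have op: "open {\<tau>. Im \<tau> > 0}" by (rule open_halfspace_Im_gt)
      have "\<Phi> holomorphic_on {\<tau>. Im \<tau> > 0}"
        using \<Phi>(1) op by (auto simp: holomorphic_on_open)
      then have "deriv \<Phi> holomorphic_on {\<tau>. Im \<tau> > 0}" using op by (rule holomorphic_deriv)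
      then have "continuous_on {\<tau>. Im \<tau> > 0} (deriv \<Phi>)" by (rule holomorphic_on_imp_continuous_on)
      moreover have "deriv \<Phi> \<tau> = integrand n \<tau>" if "Im \<tau> > 0" for \<tau> by (rule DERIV_imp_deriv[OF \<Phi>(1)[OF that]])
      ultimately show ?thesis by (auto intro: continuous_on_eq)
    qed
    have arc: "norm (\<Psi> (real h / real k + \<theta>' (h, k)) - \<Psi> (real h / real k - \<theta> (h, k)) - arc_term hb n h k)
        \<le> C * (1 / (real k * real N))"
      if hk: "(h, k) \<in> farey_fractions N" for h k
    proof -
      define t t' where "t = \<theta> (h, k)" and "t' = \<theta>' (h, k)"
      have "k > 0" using hk by (auto simp: farey_fractions_def)
      then have "0 < 1 / (2 * real k * real N)" using N by simp
      then have t0: "t > 0" "t' > 0" using \<theta>[OF hk] \<theta>'[OF hk] unfolding t_def t'_def by linarith+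
      have iz: "of_nat h / of_nat k + \<i> * Complex \<rho> (- x) = of_real (real h / real k + x) + \<i> * of_real \<rho>" for x
        by (simp add: complex_eq_iff)
      define G where "G = (\<lambda>x. integrand n (of_nat h / of_nat k + \<i> * Complex \<rho> (- x)))"
      have G_cont: "continuous_on {-t..t'} G"
        unfolding G_def iz
        by (rule continuous_on_compose2[OF int_cont]) (use \<rho>0 in \<open>auto intro!: continuous_intros\<close>)
      have "(G has_integral (\<Psi> (real h / real k + t') - \<Psi> (real h / real k + (- t)))) {-t..t'}"
      proof (rule fundamental_theorem_of_calculus)
        show "- t \<le> t'" using t0 by simp
        fix x assume "x \<in> {-t..t'}"
        define c where "c = of_real (real h / real k) + \<i> * of_real \<rho>"
        have "Im (of_real x + c) > 0" using \<rho>0 by (simp add: c_def)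
        then have "(\<Phi> has_field_derivative integrand n (of_real x + c)) (at (of_real x + c))" by (rule \<Phi>(1))
        then have "((\<lambda>w. \<Phi> (w + c)) has_field_derivative integrand n (of_real x + c)) (at (of_real x))"
          by (rule iffD1[OF DERIV_shift])
        then have "((\<lambda>x. \<Phi> (of_real x + c)) has_vector_derivative integrand n (of_real x + c)) (at x within {-t..t'})"
          by (rule has_vector_derivative_real_field)
        moreover have "(\<lambda>x. \<Phi> (of_real x + c)) = (\<lambda>x. \<Psi> (real h / real k + x))"
          by (simp add: \<Psi>_def c_def fun_eq_iff add_ac)
        moreover have "integrand n (of_real x + c) = G x" unfolding G_def iz c_def by (simp add: add_ac)
        ultimately show "((\<lambda>x. \<Psi> (real h / real k + x)) has_vector_derivative G x) (at x within {-t..t'})" by simp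
      qed
      then have I1: "\<Psi> (real h / real k + t') - \<Psi> (real h / real k - t) = integral {-t..t'} G"
        by (simp add: integral_unique)
      have "norm (integral {-t..t'} G - arc_term hb n h k) \<le> C * (1 / (real k * real N))"
        unfolding G_def \<rho>_def
        by (rule C[OF N pos aN hk \<theta>[OF hk, folded t_def] \<theta>'[OF hk, folded t'_def] G_cont[unfolded G_def \<rho>_def]])
      from this[folded I1] show ?thesis unfolding t_def t'_def .
    qed
    have "norm (g n - (\<Sum>(h, k)\<in>farey_fractions N. arc_term hb n h k)) =
       norm (\<Sum>(h, k)\<in>farey_fractions N. \<Psi> (real h / real k + \<theta>' (h, k)) - \<Psi> (real h / real k - \<theta> (h, k)) - arc_term hb n h k)"
      using gn by (simp add: case_prod_unfold sum_subtractf)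
    also have "\<dots> \<le> (\<Sum>(h, k)\<in>farey_fractions N. C * (1 / (real k * real N)))"
    proof (rule sum_norm_le)
      fix p assume "p \<in> farey_fractions N"
      then show "norm (case p of (h, k) \<Rightarrow> \<Psi> (real h / real k + \<theta>' (h, k)) - \<Psi> (real h / real k - \<theta> (h, k)) - arc_term hb n h k)
          \<le> (case p of (h, k) \<Rightarrow> C * (1 / (real k * real N)))"
        using arc by (cases p) (simp only: prod.case)
    qed
    also have "\<dots> \<le> (\<Sum>(h, k)\<in>(\<lambda>(k, h). (h, k)) ` (SIGMA k:{1..N}. {..<k}). C * (1 / (real k * real N)))"
      by (rule sum_mono2) (auto simp: farey_fractions_def C0 image_iff)
    also have "\<dots> = (\<Sum>(k, h)\<in>(SIGMA k:{1..N}. {..<k}). C * (1 / (real k * real N)))"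
      by (subst sum.reindex) (auto simp: inj_on_def case_prod_unfold)
    also have "\<dots> = (\<Sum>k\<in>{1..N}. \<Sum>h\<in>{..<k}. C * (1 / (real k * real N)))" by (rule sum.Sigma[symmetric]) auto
    also have "\<dots> = (\<Sum>k\<in>{1..N}. C / real N)" by (intro sum.cong refl) simp
    also have "\<dots> = C" using N by simp
    finally show ?thesis .
  qed
  then show ?thesis using C0 by blast
qed

end

text \<open>
  For \<open>N\<^sup>\<star> \<ge> 1\<close> the preceding estimate applies with \<open>N = N\<^sup>\<star>\<close>. Only finitely many \<open>n\<close> have
  \<open>N\<^sup>\<star> = 0\<close>; then the sum is empty and the error is \<open>g(n)\<close> itself.
\<close>

theorem theorem1p1:
  fixes J :: nat
    and m r :: "nat \<Rightarrow> nat"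
    and \<delta> :: "nat \<Rightarrow> int"
    and g :: "nat \<Rightarrow> complex"
  assumes "J \<ge> 1"
    and "\<And>j. j \<in> {1..J} \<Longrightarrow> 1 \<le> r j \<and> r j < m j"
    and "\<And>j. j \<in> {1..J} \<Longrightarrow> \<delta> j \<noteq> 0"
    and "\<And>q :: complex. norm q < 1 \<Longrightarrow>
           (\<lambda>n. g n * q ^ n) sums (\<Prod>j=1..J. theta_prod (m j) (r j) q powi \<delta> j)"
    and "\<And>\<kappa> l. 1 \<le> l \<Longrightarrow> l \<le> lcm_mod J m \<Longrightarrow> \<kappa> < l \<Longrightarrow>
           Min ((\<lambda>j. Upsilon (lam_star (m j) (r j) \<kappa> l) * (real (gcd (m j) l))\<^sup>2 / real (m j)) ` {1..J})
             \<ge> Delta J m r \<delta> \<kappa> l / 24"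
  shows "\<exists>(E :: nat \<Rightarrow> complex) (C :: real).
    (\<forall>n::nat. n > 0 \<longrightarrow> real n > - Omega J m r \<delta> / 24 \<longrightarrow> norm (E n) \<le> C) \<and>
    (\<forall>hb. hbar_choice hb \<longrightarrow>
      (\<forall>n::nat. n > 0 \<longrightarrow> real n > - Omega J m r \<delta> / 24 \<longrightarrow>
        g n = E n + 2 * of_real pi * \<i> powi (\<Sum>j=1..J. \<delta> j) *
          (\<Sum>(\<kappa>, l) \<in> L_pos J m r \<delta>.
            of_real (((24 * real n + Omega J m r \<delta>) / Delta J m r \<delta> \<kappa> l) powr (- 1 / 2)) *
            (\<Sum>k \<in> {k \<in> {1..N_star J m r \<delta> n}. [k = l] (mod lcm_mod J m)}.
              of_real (1 / real k *
                bessel_I (- 1) (pi / (6 * real k) *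
                  sqrt (Delta J m r \<delta> \<kappa> l * (24 * real n + Omega J m r \<delta>)))) *
              (\<Sum>h \<in> {h \<in> {0..<k}. coprime h k \<and> [h = \<kappa>] (mod l)}.
                exp (- 2 * of_real pi * \<i> * of_nat n * of_nat h / of_nat k) *
                (- 1) powi (\<Sum>j=1..J. \<delta> j * lam (m j) (r j) h k) *
                (omega J m \<delta> h k)\<^sup>2 *
                D_factor J m r \<delta> hb h k *
                Pi_factor J m r \<delta> hb h k)))))"
proof -
  interpret theta_quotient_min J m r \<delta>
    by unfold_locales (use assms in auto)
  define main where "main = (\<lambda>hb n. 2 * of_real pi * \<i> powi (\<Sum>j=1..J. \<delta> j) *
          (\<Sum>(\<kappa>, l) \<in> L_pos J m r \<delta>.
            of_real (((24 * real n + Omega J m r \<delta>) / Delta J m r \<delta> \<kappa> l) powr (- 1 / 2)) *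
            (\<Sum>k \<in> {k \<in> {1..N_star J m r \<delta> n}. [k = l] (mod lcm_mod J m)}.
              of_real (1 / real k *
                bessel_I (- 1) (pi / (6 * real k) *
                  sqrt (Delta J m r \<delta> \<kappa> l * (24 * real n + Omega J m r \<delta>)))) *
              (\<Sum>h \<in> {h \<in> {0..<k}. coprime h k \<and> [h = \<kappa>] (mod l)}. cusp_coeff hb n h k))))"
  have main_eq: "main hb n = (\<Sum>(h, k)\<in>farey_fractions (N_star J m r \<delta> n). arc_term hb n h k)" for hb n
  proof -
    have "main hb n = (\<Sum>(h, k)\<in>{(h, k) \<in> farey_fractions (N_star J m r \<delta> n). Delta J m r \<delta> h k > 0}.
          \<i> powi (\<Sum>j=1..J. \<delta> j) * cusp_coeff hb n h k * of_real (arc_main n h k))"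
      unfolding main_def
        regroup_sum_by_class[where u = "\<lambda>D. of_real (((24 * real n + Omega J m r \<delta>) / D) powr (- 1 / 2))"
         and \<beta> = "\<lambda>D k. of_real (1 / real k * bessel_I (- 1) (pi / (6 * real k) * sqrt (D * (24 * real n + Omega J m r \<delta>))))"
         and w = "cusp_coeff hb n"]
      unfolding sum_distrib_left by (intro sum.cong refl) (simp add: arc_main_def case_prod_unfold mult_ac)
    also have "\<dots> = (\<Sum>(h, k)\<in>farey_fractions (N_star J m r \<delta> n). arc_term hb n h k)"
      by (rule sum.mono_neutral_cong_left) (auto simp: finite_farey_fractions arc_term_def split: if_splits)
    finally show ?thesis .
  qed
  have main_hb: "main hb n = main hb' n" if "hbar_choice hb" "hbar_choice hb'" for hb hb' n
    unfolding main_eq arc_term_def using cusp_coeff_hbar_unique[OF that]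
    by (intro sum.cong refl) (auto simp: farey_fractions_def)
  obtain hb0 where hb0: "hbar_choice hb0" using hbar_choice_exists by blast
  obtain C where C: "C \<ge> 0" "\<And>n N. N \<ge> 1 \<Longrightarrow> 24 * real n + Omega J m r \<delta> > 0 \<Longrightarrow>
      2 * pi * (real n + Omega J m r \<delta> / 24) \<le> 4 * (real N)\<^sup>2 \<Longrightarrow>
      norm (g n - (\<Sum>(h, k)\<in>farey_fractions N. arc_term hb0 n h k)) \<le> C"
    using coefficient_minus_arc_terms_bounded[OF hb0 assms(4)] by blast
  define E where "E = (\<lambda>n. g n - main hb0 n)"
  \<comment> \<open>\<open>N\<^sup>\<star> = 0\<close> is possible only for \<open>n \<le> Q\<close>.\<close>
  define Q where "Q = nat \<lceil>1 - Omega J m r \<delta> / 24\<rceil>"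
  have bound: "norm (E n) \<le> C + (\<Sum>i\<le>Q. norm (g i))" if n: "real n > - Omega J m r \<delta> / 24" for n
  proof -
    define a where "a = 2 * pi * (real n + Omega J m r \<delta> / 24)"
    define N where "N = N_star J m r \<delta> n"
    have a0: "a > 0" using n by (simp add: a_def)
    have N: "N = nat \<lfloor>sqrt a\<rfloor>" by (simp add: N_def N_star_def a_def)
    have S0: "0 \<le> (\<Sum>i\<le>Q. norm (g i))" by (intro sum_nonneg) auto
    show ?thesis
    proof (cases "N \<ge> 1")
      case True
      \<comment> \<open>\<open>N\<^sup>\<star> \<ge> 1\<close> lies within a factor 2 of \<open>sqrt a\<close>.\<close>
      have "sqrt a < real N + 1" using a0 unfolding N by simp
      then have "sqrt a \<le> 2 * real N" using True by linarith
      then have "(sqrt a)\<^sup>2 \<le> (2 * real N)\<^sup>2" using a0 by (intro power_mono) auto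
      then have "a \<le> 4 * (real N)\<^sup>2" using a0 by (simp add: power_mult_distrib)
      then have "norm (E n) \<le> C" unfolding E_def main_eq N_def[symmetric]
        using True n by (intro C(2)) (auto simp: a_def)
      then show ?thesis using S0 by simp
    next
      case False
      then have "farey_fractions N = {}" by (auto simp: farey_fractions_def)
      then have "E n = g n" unfolding E_def main_eq N_def[symmetric] by simp
      moreover have "n \<le> Q"
      proof -
        have "sqrt a < 1" using False a0 unfolding N by linarith
        then have "a < 1" using a0 by (simp add: real_sqrt_lt_1_iff)
        moreover have "real n + Omega J m r \<delta> / 24 \<le> a"
          using n pi_ge_two mult_right_mono[of 1 "2 * pi" "real n + Omega J m r \<delta> / 24"] by (simp add: a_def)
        ultimately have "real n \<le> 1 - Omega J m r \<delta> / 24" by linarith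
        then show ?thesis unfolding Q_def by linarith
      qed
      then have "norm (g n) \<le> (\<Sum>i\<le>Q. norm (g i))" by (intro member_le_sum) auto
      ultimately show ?thesis using C(1) by simp
    qed
  qed
  have "g n = E n + main hb n" if "hbar_choice hb" for hb n
    using main_hb[OF that hb0, of n] by (simp add: E_def)
  then show ?thesis
    using bound unfolding main_def cusp_coeff_def by (intro exI[of _ E] exI[of _ "C + (\<Sum>i\<le>Q. norm (g i))"]) blast
qed

end
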